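(* Let $(\mathcal{V},\otimes,\mathbf{1})$ be a concrete bicomplete closed symmetric monoidal category with compact unit. Let $\mathcal{C}$ be a cocomplete $\mathcal{V}$-category and let $\theta:\mathrm{id}\to\Omega$ be a well-pointed $\mathcal{V}$-endofunctor of $\mathcal{C}$. Let $L_\Omega(\mathcal{C})\hookrightarrow\hat{\mathcal{C}}$ be the essential image of the $\mathcal{V}$-functor $\Omega^\infty:\mathcal{C}\to\hat{\mathcal{C}}$ sending $X$ to the colimit, taken in the enriched ind-category $\hat{\mathcal{C}}$, of $X\xrightarrow{\theta_X}\Omega X\xrightarrow{\theta_{\Omega X}}\Omega^2X\to\cdots$. Then $\Omega^\infty:\mathcal{C}\to L_\Omega(\mathcal{C})$ is the localisation of $\mathcal{C}$ along $\theta$.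
   Context: Conventions on $\mathcal{V}$: $\mathcal{V}$ is a bicomplete closed symmetric monoidal category with unit $\mathbf{1}$. Concrete means that $\mathrm{Hom}_{\mathcal{V}}(\mathbf{1},-):\mathcal{V}\to\mathbf{Set}$ is faithful. The unit $\mathbf{1}$ is compact, i.e. $\mathrm{Hom}_{\mathcal{V}}(\mathbf{1},-)$ preserves filtered colimits; the standing convention is that limits and filtered colimits in $\mathcal{V}$ are thereby created in $\mathbf{Set}$. (Examples to keep in mind: $\mathbf{Set}$, $\mathbf{Vect}$, $\mathbf{dgVect}$.) All categories, functors and natural transformations are $\mathcal{V}$-enriched; hom-objects are written $\mathcal{C}(x,y)\in\mathcal{V}$. Enriched ind-category: $\hat{\mathcal{C}}$ is the $\mathcal{V}$-category whose objects are diagrams $X:J\to\mathcal{C}$ with $J$ small and filtered, with hom-objects $\hat{\mathcal{C}}(X,Y)=\varprojlim_i\varinjlim_j\mathcal{C}(X_i,Y_j)$ computed in $\mathcal{V}$. Its underlying category is the usual ind-category $\mathrm{ind}\,\mathcal{C}$. There is a fully faithful $\mathcal{V}$-functor $\mathcal{C}\hookrightarrow\hat{\mathcal{C}}$ sending $x$ to the one-object diagram at $x$. A $\mathcal{V}$-functor $F:\mathcal{C}\to\mathcal{D}$ extends to a $\mathcal{V}$-functor $\hat F:\hat{\mathcal{C}}\to\hat{\mathcal{D}}$ commuting with formal filtered colimits. Well-pointed: a pointed endofunctor of $\mathcal{C}$ is an endofunctor $\Omega$ together with a natural transformation $\theta:\mathrm{id}\to\Omega$. It is well-pointed if $\theta_{\Omega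 X}=\Omega(\theta_X)$ as maps $\Omega X\to\Omega^2X$ for all objects $X$. Localisation: a functor $F:\mathcal{C}\to\mathcal{D}$ inverts $\theta$ if $F(\theta_X)$ is an isomorphism for every object $X$ of $\mathcal{C}$. The localisation of $\mathcal{C}$ along $\theta$ is the initial functor inverting $\theta$: a functor $\gamma:\mathcal{C}\to\mathcal{C}'$ that inverts $\theta$ and such that, whenever $F:\mathcal{C}\to\mathcal{D}$ inverts $\theta$, there exists a unique $F':\mathcal{C}'\to\mathcal{D}$ with $F=F'\gamma$.
   Formalization: Strict uniqueness of F' fails on the essential image (values at objects merely isomorphic to some Ω^∞X can be changed, e.g. Ω = id); proved instead: F = F'Ω^∞ strictly, with F' unique up to a unique compatible V-natural isomorphism. *)

theory Defs
  imports "HOL-Library.Equipollence" "HOL-Library.FuncSet" "HOL-Library.Nat_Bijection"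
begin

section \<open>Ordinary categories\<close>

record ('o, 'a) cat =
  Obj :: "'o set"
  Arr :: "'a set"
  Dom :: "'a \<Rightarrow> 'o"
  Cod :: "'a \<Rightarrow> 'o"
  Idt :: "'o \<Rightarrow> 'a"  ("\<iota>\<index>")
  Cmp :: "'a \<Rightarrow> 'a \<Rightarrow> 'a"  (infixr "\<cdot>\<index>" 60)

definition hom :: "('o, 'a, 'z) cat_scheme \<Rightarrow> 'o \<Rightarrow> 'o \<Rightarrow> 'a set" where
  "hom C x y = {f \<in> Arr C. Dom C f = x \<and> Cod C f = y}"

locale category =
  fixes C :: "('o, 'a, 'z) cat_scheme" (structure)
  assumes dom_obj: "f \<in> Arr C \<Longrightarrow> Dom C f \<in> Obj C"
    and cod_obj: "f \<in> Arr C \<Longrightarrow> Cod C f \<in> Obj C"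
    and idt_hom: "x \<in> Obj C \<Longrightarrow> \<iota> x \<in> hom C x x"
    and cmp_hom: "f \<in> hom C x y \<Longrightarrow> g \<in> hom C y z \<Longrightarrow> g \<cdot> f \<in> hom C x z"
    and cmp_idt: "f \<in> hom C x y \<Longrightarrow> f \<cdot> \<iota> x = f"
    and idt_cmp: "f \<in> hom C x y \<Longrightarrow> \<iota> y \<cdot> f = f"
    and cmp_assoc: "f \<in> hom C w x \<Longrightarrow> g \<in> hom C x y \<Longrightarrow> h \<in> hom C y z \<Longrightarrow>
      (h \<cdot> g) \<cdot> f = h \<cdot> (g \<cdot> f)"

definition inverse_arrs :: "('o, 'a, 'z) cat_scheme \<Rightarrow> 'a \<Rightarrow> 'a \<Rightarrow> bool" where
  "inverse_arrs C f g \<longleftrightarrow> f \<in> Arr C \<and> g \<in> hom C (Cod C f) (Dom C f) \<and>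
     g \<cdot>\<^bsub>C\<^esub> f = \<iota>\<^bsub>C\<^esub> (Dom C f) \<and> f \<cdot>\<^bsub>C\<^esub> g = \<iota>\<^bsub>C\<^esub> (Cod C f)"

definition iso_arr :: "('o, 'a, 'z) cat_scheme \<Rightarrow> 'a \<Rightarrow> bool" where
  "iso_arr C f \<longleftrightarrow> (\<exists>g. inverse_arrs C f g)"

definition inv_arr :: "('o, 'a, 'z) cat_scheme \<Rightarrow> 'a \<Rightarrow> 'a" where
  "inv_arr C f = (THE g. inverse_arrs C f g)"

definition iso_objs :: "('o, 'a, 'z) cat_scheme \<Rightarrow> 'o \<Rightarrow> 'o \<Rightarrow> bool" where
  "iso_objs C x y \<longleftrightarrow> (\<exists>f \<in> hom C x y. iso_arr C f)"

definition op_cat :: "('o, 'a, 'z) cat_scheme \<Rightarrow> ('o, 'a) cat" where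
  "op_cat C = \<lparr>Obj = Obj C, Arr = Arr C, Dom = Cod C, Cod = Dom C, Idt = Idt C,
     Cmp = (\<lambda>g f. f \<cdot>\<^bsub>C\<^esub> g)\<rparr>"

record ('j, 'k, 'o, 'a) ftr =
  FO :: "'j \<Rightarrow> 'o"
  FA :: "'k \<Rightarrow> 'a"

definition is_functor ::
    "('j, 'k, 'y) cat_scheme \<Rightarrow> ('o, 'a, 'z) cat_scheme \<Rightarrow> ('j, 'k, 'o, 'a) ftr \<Rightarrow> bool" where
  "is_functor J C F \<longleftrightarrow> (\<forall>j \<in> Obj J. FO F j \<in> Obj C)
     \<and> (\<forall>f \<in> Arr J. FA F f \<in> hom C (FO F (Dom J f)) (FO F (Cod J f)))
     \<and> (\<forall>j \<in> Obj J. FA F (\<iota>\<^bsub>J\<^esub> j) = \<iota>\<^bsub>C\<^esub> (FO F j))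
     \<and> (\<forall>i j k. \<forall>f \<in> hom J i j. \<forall>g \<in> hom J j k. FA F (g \<cdot>\<^bsub>J\<^esub> f) = FA F g \<cdot>\<^bsub>C\<^esub> FA F f)"

definition ftr_comp :: "('o, 'a, 'p, 'b) ftr \<Rightarrow> ('j, 'k, 'o, 'a) ftr \<Rightarrow> ('j, 'k, 'p, 'b) ftr" where
  "ftr_comp G F = \<lparr>FO = FO G \<circ> FO F, FA = FA G \<circ> FA F\<rparr>"

definition faithful :: "('o, 'a, 'y) cat_scheme \<Rightarrow> ('o, 'a, 'p, 'b) ftr \<Rightarrow> bool" where
  "faithful C F \<longleftrightarrow> (\<forall>x \<in> Obj C. \<forall>y \<in> Obj C. inj_on (FA F) (hom C x y))"


subsection \<open>Limits and colimits\<close>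

definition is_cone :: "('j, 'k, 'y) cat_scheme \<Rightarrow> ('o, 'a, 'z) cat_scheme \<Rightarrow>
    ('j, 'k, 'o, 'a) ftr \<Rightarrow> 'o \<Rightarrow> ('j \<Rightarrow> 'a) \<Rightarrow> bool" where
  "is_cone J C D L p \<longleftrightarrow> L \<in> Obj C \<and> (\<forall>j \<in> Obj J. p j \<in> hom C L (FO D j))
     \<and> (\<forall>f \<in> Arr J. FA D f \<cdot>\<^bsub>C\<^esub> p (Dom J f) = p (Cod J f))"

definition is_limit :: "('j, 'k, 'y) cat_scheme \<Rightarrow> ('o, 'a, 'z) cat_scheme \<Rightarrow>
    ('j, 'k, 'o, 'a) ftr \<Rightarrow> 'o \<Rightarrow> ('j \<Rightarrow> 'a) \<Rightarrow> bool" where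
  "is_limit J C D L p \<longleftrightarrow> is_cone J C D L p
     \<and> (\<forall>T q. is_cone J C D T q \<longrightarrow> (\<exists>!h. h \<in> hom C T L \<and> (\<forall>j \<in> Obj J. p j \<cdot>\<^bsub>C\<^esub> h = q j)))"

definition is_cocone :: "('j, 'k, 'y) cat_scheme \<Rightarrow> ('o, 'a, 'z) cat_scheme \<Rightarrow>
    ('j, 'k, 'o, 'a) ftr \<Rightarrow> 'o \<Rightarrow> ('j \<Rightarrow> 'a) \<Rightarrow> bool" where
  "is_cocone J C D L p \<longleftrightarrow> L \<in> Obj C \<and> (\<forall>j \<in> Obj J. p j \<in> hom C (FO D j) L)
     \<and> (\<forall>f \<in> Arr J. p (Cod J f) \<cdot>\<^bsub>C\<^esub> FA D f = p (Dom J f))"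

definition is_colimit :: "('j, 'k, 'y) cat_scheme \<Rightarrow> ('o, 'a, 'z) cat_scheme \<Rightarrow>
    ('j, 'k, 'o, 'a) ftr \<Rightarrow> 'o \<Rightarrow> ('j \<Rightarrow> 'a) \<Rightarrow> bool" where
  "is_colimit J C D L p \<longleftrightarrow> is_cocone J C D L p
     \<and> (\<forall>T q. is_cocone J C D T q \<longrightarrow> (\<exists>!h. h \<in> hom C L T \<and> (\<forall>j \<in> Obj J. h \<cdot>\<^bsub>C\<^esub> p j = q j)))"

definition limit_of :: "('j, 'k, 'y) cat_scheme \<Rightarrow> ('o, 'a, 'z) cat_scheme \<Rightarrow>
    ('j, 'k, 'o, 'a) ftr \<Rightarrow> 'o \<times> ('j \<Rightarrow> 'a)" where
  "limit_of J C D = (SOME (L, p). is_limit J C D L p)"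

definition colimit_of :: "('j, 'k, 'y) cat_scheme \<Rightarrow> ('o, 'a, 'z) cat_scheme \<Rightarrow>
    ('j, 'k, 'o, 'a) ftr \<Rightarrow> 'o \<times> ('j \<Rightarrow> 'a)" where
  "colimit_of J C D = (SOME (L, p). is_colimit J C D L p)"

text \<open>
  Size is measured by a type \<open>'u\<close> in the role of the universe: a set is small when its
  cardinality is strictly below that of \<open>'u\<close>, so up to isomorphism a small category has its
  objects and arrows in \<open>'u\<close>. A Grothendieck universe is the case where the cardinality of
  \<open>'u\<close> is inaccessible; the definitions do not need this.
\<close>

definition small :: "'u set \<Rightarrow> bool" where
  "small A \<longleftrightarrow> A \<prec> (UNIV :: 'u set)"

definition small_category :: "('u, 'u, 'z) cat_scheme \<Rightarrow> bool" where
  "small_category J \<longleftrightarrow> category J \<and> small (Arr J)"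

definition filtered :: "('j, 'k, 'z) cat_scheme \<Rightarrow> bool" where
  "filtered J \<longleftrightarrow> Obj J \<noteq> {}
     \<and> (\<forall>i \<in> Obj J. \<forall>j \<in> Obj J. \<exists>k \<in> Obj J. hom J i k \<noteq> {} \<and> hom J j k \<noteq> {})
     \<and> (\<forall>i \<in> Obj J. \<forall>j \<in> Obj J. \<forall>f \<in> hom J i j. \<forall>g \<in> hom J i j.
          \<exists>k \<in> Obj J. \<exists>h \<in> hom J j k. h \<cdot>\<^bsub>J\<^esub> f = h \<cdot>\<^bsub>J\<^esub> g)"

definition bicomplete :: "'u itself \<Rightarrow> ('o, 'a, 'z) cat_scheme \<Rightarrow> bool" where
  "bicomplete TYPE('u) C \<longleftrightarrow> (\<forall>(J :: ('u, 'u) cat) D. small_category J \<and> is_functor J C D \<longrightarrow>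
     (\<exists>L p. is_limit J C D L p) \<and> (\<exists>L p. is_colimit J C D L p))"

definition preserves_filtered_colimits :: "'u itself \<Rightarrow> ('o, 'a, 'y) cat_scheme \<Rightarrow>
    ('p, 'b, 'z) cat_scheme \<Rightarrow> ('o, 'a, 'p, 'b) ftr \<Rightarrow> bool" where
  "preserves_filtered_colimits TYPE('u) C S F \<longleftrightarrow>
     (\<forall>(J :: ('u, 'u) cat) D L p. small_category J \<and> filtered J \<and> is_functor J C D \<and>
        is_colimit J C D L p \<longrightarrow> is_colimit J S (ftr_comp F D) (FO F L) (FA F \<circ> p))"

text \<open>
  Creation is meant in the isomorphism-invariant sense: limits lift, and a cone is a limit
  exactly when its image is one.
\<close>

definition creates_limits :: "'u itself \<Rightarrow> ('o, 'a, 'y) cat_scheme \<Rightarrow>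
    ('p, 'b, 'z) cat_scheme \<Rightarrow> ('o, 'a, 'p, 'b) ftr \<Rightarrow> bool" where
  "creates_limits TYPE('u) C S F \<longleftrightarrow>
     (\<forall>(J :: ('u, 'u) cat) D. small_category J \<and> is_functor J C D \<and>
        (\<exists>L p. is_limit J S (ftr_comp F D) L p) \<longrightarrow>
        (\<exists>L p. is_limit J C D L p) \<and>
        (\<forall>L p. is_cone J C D L p \<longrightarrow>
           (is_limit J C D L p \<longleftrightarrow> is_limit J S (ftr_comp F D) (FO F L) (FA F \<circ> p))))"

definition creates_filtered_colimits :: "'u itself \<Rightarrow> ('o, 'a, 'y) cat_scheme \<Rightarrow>
    ('p, 'b, 'z) cat_scheme \<Rightarrow> ('o, 'a, 'p, 'b) ftr \<Rightarrow> bool" where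
  "creates_filtered_colimits TYPE('u) C S F \<longleftrightarrow>
     (\<forall>(J :: ('u, 'u) cat) D. small_category J \<and> filtered J \<and> is_functor J C D \<and>
        (\<exists>L p. is_colimit J S (ftr_comp F D) L p) \<longrightarrow>
        (\<exists>L p. is_colimit J C D L p) \<and>
        (\<forall>L p. is_cocone J C D L p \<longrightarrow>
           (is_colimit J C D L p \<longleftrightarrow> is_colimit J S (ftr_comp F D) (FO F L) (FA F \<circ> p))))"

text \<open>Sets and functions; all sets that occur below are hom-sets, hence subsets of one type.\<close>

definition set_cat :: "('x set, 'x set \<times> ('x \<Rightarrow> 'x) \<times> 'x set) cat" where
  "set_cat = \<lparr>Obj = UNIV, Arr = {(A, f, B). f \<in> A \<rightarrow>\<^sub>E B},
     Dom = (\<lambda>(A, f, B). A), Cod = (\<lambda>(A, f, B). B), Idt = (\<lambda>A. (A, \<lambda>x \<in> A. x, A)),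
     Cmp = (\<lambda>(B, g, Z) (A, f, B'). (A, \<lambda>x \<in> A. g (f x), Z))\<rparr>"

definition hom_functor :: "('o, 'a, 'z) cat_scheme \<Rightarrow> 'o \<Rightarrow>
    ('o, 'a, 'a set, 'a set \<times> ('a \<Rightarrow> 'a) \<times> 'a set) ftr" where
  "hom_functor C x = \<lparr>FO = (\<lambda>y. hom C x y),
     FA = (\<lambda>f. (hom C x (Dom C f), \<lambda>g \<in> hom C x (Dom C f). f \<cdot>\<^bsub>C\<^esub> g, hom C x (Cod C f)))\<rparr>"


section \<open>Closed symmetric monoidal categories\<close>

text \<open>\<open>\<otimes>\<close> is the tensor product of objects and \<open>\<odot>\<close> that of arrows.\<close>

record ('o, 'a) smc = "('o, 'a) cat" +
  Unit :: "'o"  ("\<one>\<index>")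
  Tens :: "'o \<Rightarrow> 'o \<Rightarrow> 'o"  (infixr "\<otimes>\<index>" 70)
  TensA :: "'a \<Rightarrow> 'a \<Rightarrow> 'a"  (infixr "\<odot>\<index>" 70)
  Ass :: "'o \<Rightarrow> 'o \<Rightarrow> 'o \<Rightarrow> 'a"
  LUnit :: "'o \<Rightarrow> 'a"
  RUnit :: "'o \<Rightarrow> 'a"
  Sym :: "'o \<Rightarrow> 'o \<Rightarrow> 'a"
  IHom :: "'o \<Rightarrow> 'o \<Rightarrow> 'o"
  Ev :: "'o \<Rightarrow> 'o \<Rightarrow> 'a"

locale monoidal_category = category V
  for V :: "('o, 'a) smc" (structure) +
  assumes unit_obj: "\<one> \<in> Obj V"
    and tens_obj: "A \<in> Obj V \<Longrightarrow> B \<in> Obj V \<Longrightarrow> A \<otimes> B \<in> Obj V"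
    and tensA_hom: "f \<in> hom V A A' \<Longrightarrow> g \<in> hom V B B' \<Longrightarrow> f \<odot> g \<in> hom V (A \<otimes> B) (A' \<otimes> B')"
    and tensA_idt: "A \<in> Obj V \<Longrightarrow> B \<in> Obj V \<Longrightarrow> \<iota> A \<odot> \<iota> B = \<iota> (A \<otimes> B)"
    and tensA_cmp: "f \<in> hom V A A' \<Longrightarrow> f' \<in> hom V A' A'' \<Longrightarrow> g \<in> hom V B B' \<Longrightarrow> g' \<in> hom V B' B'' \<Longrightarrow>
      (f' \<cdot> f) \<odot> (g' \<cdot> g) = (f' \<odot> g') \<cdot> (f \<odot> g)"
    and ass_hom: "A \<in> Obj V \<Longrightarrow> B \<in> Obj V \<Longrightarrow> D \<in> Obj V \<Longrightarrow>
      Ass V A B D \<in> hom V ((A \<otimes> B) \<otimes> D) (A \<otimes> (B \<otimes> D))"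
    and ass_iso: "A \<in> Obj V \<Longrightarrow> B \<in> Obj V \<Longrightarrow> D \<in> Obj V \<Longrightarrow> iso_arr V (Ass V A B D)"
    and ass_nat: "f \<in> hom V A A' \<Longrightarrow> g \<in> hom V B B' \<Longrightarrow> h \<in> hom V D D' \<Longrightarrow>
      Ass V A' B' D' \<cdot> ((f \<odot> g) \<odot> h) = (f \<odot> (g \<odot> h)) \<cdot> Ass V A B D"
    and lunit_hom: "A \<in> Obj V \<Longrightarrow> LUnit V A \<in> hom V (\<one> \<otimes> A) A"
    and lunit_iso: "A \<in> Obj V \<Longrightarrow> iso_arr V (LUnit V A)"
    and lunit_nat: "f \<in> hom V A A' \<Longrightarrow> LUnit V A' \<cdot> (\<iota> \<one> \<odot> f) = f \<cdot> LUnit V A"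
    and runit_hom: "A \<in> Obj V \<Longrightarrow> RUnit V A \<in> hom V (A \<otimes> \<one>) A"
    and runit_iso: "A \<in> Obj V \<Longrightarrow> iso_arr V (RUnit V A)"
    and runit_nat: "f \<in> hom V A A' \<Longrightarrow> RUnit V A' \<cdot> (f \<odot> \<iota> \<one>) = f \<cdot> RUnit V A"
    and triangle: "A \<in> Obj V \<Longrightarrow> B \<in> Obj V \<Longrightarrow>
      (\<iota> A \<odot> LUnit V B) \<cdot> Ass V A \<one> B = RUnit V A \<odot> \<iota> B"
    and pentagon: "A \<in> Obj V \<Longrightarrow> B \<in> Obj V \<Longrightarrow> D \<in> Obj V \<Longrightarrow> E \<in> Obj V \<Longrightarrow>
      Ass V A B (D \<otimes> E) \<cdot> Ass V (A \<otimes> B) D E =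
      (\<iota> A \<odot> Ass V B D E) \<cdot> Ass V A (B \<otimes> D) E \<cdot> (Ass V A B D \<odot> \<iota> E)"

locale symmetric_monoidal_category = monoidal_category V
  for V :: "('o, 'a) smc" (structure) +
  assumes sym_hom: "A \<in> Obj V \<Longrightarrow> B \<in> Obj V \<Longrightarrow> Sym V A B \<in> hom V (A \<otimes> B) (B \<otimes> A)"
    and sym_nat: "f \<in> hom V A A' \<Longrightarrow> g \<in> hom V B B' \<Longrightarrow>
      Sym V A' B' \<cdot> (f \<odot> g) = (g \<odot> f) \<cdot> Sym V A B"
    and sym_sym: "A \<in> Obj V \<Longrightarrow> B \<in> Obj V \<Longrightarrow> Sym V B A \<cdot> Sym V A B = \<iota> (A \<otimes> B)"
    and hexagon: "A \<in> Obj V \<Longrightarrow> B \<in> Obj V \<Longrightarrow> D \<in> Obj V \<Longrightarrow>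
      Ass V B D A \<cdot> Sym V A (B \<otimes> D) \<cdot> Ass V A B D =
      (\<iota> B \<odot> Sym V A D) \<cdot> Ass V B A D \<cdot> (Sym V A B \<odot> \<iota> D)"

locale closed_symmetric_monoidal_category = symmetric_monoidal_category V
  for V :: "('o, 'a) smc" (structure) +
  assumes ihom_obj: "A \<in> Obj V \<Longrightarrow> B \<in> Obj V \<Longrightarrow> IHom V A B \<in> Obj V"
    and ev_hom: "A \<in> Obj V \<Longrightarrow> B \<in> Obj V \<Longrightarrow> Ev V A B \<in> hom V (IHom V A B \<otimes> A) B"
    and ev_univ: "T \<in> Obj V \<Longrightarrow> A \<in> Obj V \<Longrightarrow> B \<in> Obj V \<Longrightarrow> f \<in> hom V (T \<otimes> A) B \<Longrightarrow>
      \<exists>!g. g \<in> hom V T (IHom V A B) \<and> Ev V A B \<cdot> (g \<odot> \<iota> A) = f"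

definition curry_arr :: "('o, 'a) smc \<Rightarrow> 'o \<Rightarrow> 'o \<Rightarrow> 'o \<Rightarrow> 'a \<Rightarrow> 'a" where
  "curry_arr V T A B f =
     (THE g. g \<in> hom V T (IHom V A B) \<and> Ev V A B \<cdot>\<^bsub>V\<^esub> (g \<odot>\<^bsub>V\<^esub> \<iota>\<^bsub>V\<^esub> A) = f)"

definition concrete :: "('o, 'a) smc \<Rightarrow> bool" where
  "concrete V \<longleftrightarrow> faithful V (hom_functor V \<one>\<^bsub>V\<^esub>)"

definition compact_unit :: "'u itself \<Rightarrow> ('o, 'a) smc \<Rightarrow> bool" where
  "compact_unit TYPE('u) V \<longleftrightarrow>
     preserves_filtered_colimits TYPE('u) V set_cat (hom_functor V \<one>\<^bsub>V\<^esub>)"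

definition created_in_set :: "'u itself \<Rightarrow> ('o, 'a) smc \<Rightarrow> bool" where
  "created_in_set TYPE('u) V \<longleftrightarrow>
     creates_limits TYPE('u) V set_cat (hom_functor V \<one>\<^bsub>V\<^esub>) \<and>
     creates_filtered_colimits TYPE('u) V set_cat (hom_functor V \<one>\<^bsub>V\<^esub>)"


section \<open>Enriched categories\<close>

text \<open>\<open>VComp C x y z\<close> is the composition \<open>C(y, z) \<otimes> C(x, y) \<rightarrow> C(x, z)\<close>.\<close>

record ('c, 'o, 'a) vcat =
  VObj :: "'c set"
  VHom :: "'c \<Rightarrow> 'c \<Rightarrow> 'o"
  VId :: "'c \<Rightarrow> 'a"
  VComp :: "'c \<Rightarrow> 'c \<Rightarrow> 'c \<Rightarrow> 'a"

definition vcategory :: "('o, 'a) smc \<Rightarrow> ('c, 'o, 'a) vcat \<Rightarrow> bool" where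
  "vcategory V C \<longleftrightarrow>
     (\<forall>x \<in> VObj C. \<forall>y \<in> VObj C. VHom C x y \<in> Obj V)
     \<and> (\<forall>x \<in> VObj C. VId C x \<in> hom V \<one>\<^bsub>V\<^esub> (VHom C x x))
     \<and> (\<forall>x \<in> VObj C. \<forall>y \<in> VObj C. \<forall>z \<in> VObj C.
          VComp C x y z \<in> hom V (VHom C y z \<otimes>\<^bsub>V\<^esub> VHom C x y) (VHom C x z))
     \<and> (\<forall>w \<in> VObj C. \<forall>x \<in> VObj C. \<forall>y \<in> VObj C. \<forall>z \<in> VObj C.
          VComp C w x z \<cdot>\<^bsub>V\<^esub> (VComp C x y z \<odot>\<^bsub>V\<^esub> \<iota>\<^bsub>V\<^esub> (VHom C w x)) =
          VComp C w y z \<cdot>\<^bsub>V\<^esub> (\<iota>\<^bsub>V\<^esub> (VHom C y z) \<odot>\<^bsub>V\<^esub> VComp C w x y)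
            \<cdot>\<^bsub>V\<^esub> Ass V (VHom C y z) (VHom C x y) (VHom C w x))
     \<and> (\<forall>x \<in> VObj C. \<forall>y \<in> VObj C.
          VComp C x y y \<cdot>\<^bsub>V\<^esub> (VId C y \<odot>\<^bsub>V\<^esub> \<iota>\<^bsub>V\<^esub> (VHom C x y)) = LUnit V (VHom C x y)
          \<and> VComp C x x y \<cdot>\<^bsub>V\<^esub> (\<iota>\<^bsub>V\<^esub> (VHom C x y) \<odot>\<^bsub>V\<^esub> VId C x) = RUnit V (VHom C x y))"

text \<open>
  Arrows of the underlying category carry their endpoints, because different pairs of objects
  may have the same hom-object.
\<close>

definition underlying :: "('o, 'a) smc \<Rightarrow> ('c, 'o, 'a) vcat \<Rightarrow> ('c, 'c \<times> 'a \<times> 'c) cat" where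
  "underlying V C = \<lparr>Obj = VObj C,
     Arr = {(x, f, y). x \<in> VObj C \<and> y \<in> VObj C \<and> f \<in> hom V \<one>\<^bsub>V\<^esub> (VHom C x y)},
     Dom = (\<lambda>(x, f, y). x), Cod = (\<lambda>(x, f, y). y), Idt = (\<lambda>x. (x, VId C x, x)),
     Cmp = (\<lambda>(y, g, z) (x, f, y').
       (x, VComp C x y z \<cdot>\<^bsub>V\<^esub> (g \<odot>\<^bsub>V\<^esub> f) \<cdot>\<^bsub>V\<^esub> inv_arr V (LUnit V \<one>\<^bsub>V\<^esub>), z))\<rparr>"

text \<open>For \<open>u : x \<rightarrow> y\<close> in the underlying category: \<open>C(z, u)\<close> and \<open>C(u, z)\<close>.\<close>

definition post_comp :: "('o, 'a) smc \<Rightarrow> ('c, 'o, 'a) vcat \<Rightarrow> 'c \<Rightarrow> 'c \<times> 'a \<times> 'c \<Rightarrow> 'a" where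
  "post_comp V C z = (\<lambda>(x, f, y).
     VComp C z x y \<cdot>\<^bsub>V\<^esub> (f \<odot>\<^bsub>V\<^esub> \<iota>\<^bsub>V\<^esub> (VHom C z x)) \<cdot>\<^bsub>V\<^esub> inv_arr V (LUnit V (VHom C z x)))"

definition pre_comp :: "('o, 'a) smc \<Rightarrow> ('c, 'o, 'a) vcat \<Rightarrow> 'c \<Rightarrow> 'c \<times> 'a \<times> 'c \<Rightarrow> 'a" where
  "pre_comp V C z = (\<lambda>(x, f, y).
     VComp C x y z \<cdot>\<^bsub>V\<^esub> (\<iota>\<^bsub>V\<^esub> (VHom C y z) \<odot>\<^bsub>V\<^esub> f) \<cdot>\<^bsub>V\<^esub> inv_arr V (RUnit V (VHom C y z)))"

record ('c, 'd, 'a) vfun =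
  VFO :: "'c \<Rightarrow> 'd"
  VFH :: "'c \<Rightarrow> 'c \<Rightarrow> 'a"

definition vfunctor :: "('o, 'a) smc \<Rightarrow> ('c, 'o, 'a) vcat \<Rightarrow> ('d, 'o, 'a) vcat \<Rightarrow>
    ('c, 'd, 'a) vfun \<Rightarrow> bool" where
  "vfunctor V C D F \<longleftrightarrow>
     (\<forall>x \<in> VObj C. VFO F x \<in> VObj D)
     \<and> (\<forall>x \<in> VObj C. \<forall>y \<in> VObj C. VFH F x y \<in> hom V (VHom C x y) (VHom D (VFO F x) (VFO F y)))
     \<and> (\<forall>x \<in> VObj C. VFH F x x \<cdot>\<^bsub>V\<^esub> VId C x = VId D (VFO F x))
     \<and> (\<forall>x \<in> VObj C. \<forall>y \<in> VObj C. \<forall>z \<in> VObj C.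
          VFH F x z \<cdot>\<^bsub>V\<^esub> VComp C x y z =
          VComp D (VFO F x) (VFO F y) (VFO F z) \<cdot>\<^bsub>V\<^esub> (VFH F y z \<odot>\<^bsub>V\<^esub> VFH F x y))"

definition vfun_eq :: "('c, 'o, 'a) vcat \<Rightarrow> ('c, 'd, 'a) vfun \<Rightarrow> ('c, 'd, 'a) vfun \<Rightarrow> bool" where
  "vfun_eq C F G \<longleftrightarrow> (\<forall>x \<in> VObj C. VFO F x = VFO G x) \<and>
     (\<forall>x \<in> VObj C. \<forall>y \<in> VObj C. VFH F x y = VFH G x y)"

definition vfun_id :: "('o, 'a) smc \<Rightarrow> ('c, 'o, 'a) vcat \<Rightarrow> ('c, 'c, 'a) vfun" where
  "vfun_id V C = \<lparr>VFO = (\<lambda>x. x), VFH = (\<lambda>x y. \<iota>\<^bsub>V\<^esub> (VHom C x y))\<rparr>"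

definition vfun_comp :: "('o, 'a) smc \<Rightarrow> ('d, 'e, 'a) vfun \<Rightarrow> ('c, 'd, 'a) vfun \<Rightarrow>
    ('c, 'e, 'a) vfun" where
  "vfun_comp V G F = \<lparr>VFO = (\<lambda>x. VFO G (VFO F x)),
     VFH = (\<lambda>x y. VFH G (VFO F x) (VFO F y) \<cdot>\<^bsub>V\<^esub> VFH F x y)\<rparr>"

primrec vfun_pow :: "('o, 'a) smc \<Rightarrow> ('c, 'o, 'a) vcat \<Rightarrow> ('c, 'c, 'a) vfun \<Rightarrow> nat \<Rightarrow>
    ('c, 'c, 'a) vfun" where
  "vfun_pow V C F 0 = vfun_id V C"
| "vfun_pow V C F (Suc n) = vfun_comp V F (vfun_pow V C F n)"

definition underlying_ftr :: "('o, 'a) smc \<Rightarrow> ('c, 'd, 'a) vfun \<Rightarrow>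
    ('c, 'c \<times> 'a \<times> 'c, 'd, 'd \<times> 'a \<times> 'd) ftr" where
  "underlying_ftr V F = \<lparr>FO = VFO F,
     FA = (\<lambda>(x, f, y). (VFO F x, VFH F x y \<cdot>\<^bsub>V\<^esub> f, VFO F y))\<rparr>"

definition vnat :: "('o, 'a) smc \<Rightarrow> ('c, 'o, 'a) vcat \<Rightarrow> ('d, 'o, 'a) vcat \<Rightarrow>
    ('c, 'd, 'a) vfun \<Rightarrow> ('c, 'd, 'a) vfun \<Rightarrow> ('c \<Rightarrow> 'a) \<Rightarrow> bool" where
  "vnat V C D F G \<eta> \<longleftrightarrow>
     (\<forall>x \<in> VObj C. \<eta> x \<in> hom V \<one>\<^bsub>V\<^esub> (VHom D (VFO F x) (VFO G x)))
     \<and> (\<forall>x \<in> VObj C. \<forall>y \<in> VObj C.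
          VComp D (VFO F x) (VFO F y) (VFO G y) \<cdot>\<^bsub>V\<^esub> (\<eta> y \<odot>\<^bsub>V\<^esub> VFH F x y)
            \<cdot>\<^bsub>V\<^esub> inv_arr V (LUnit V (VHom C x y)) =
          VComp D (VFO F x) (VFO G x) (VFO G y) \<cdot>\<^bsub>V\<^esub> (VFH G x y \<odot>\<^bsub>V\<^esub> \<eta> x)
            \<cdot>\<^bsub>V\<^esub> inv_arr V (RUnit V (VHom C x y)))"

definition vnat_arr :: "('c, 'd, 'a) vfun \<Rightarrow> ('c, 'd, 'a) vfun \<Rightarrow> ('c \<Rightarrow> 'a) \<Rightarrow> 'c \<Rightarrow>
    'd \<times> 'a \<times> 'd" where
  "vnat_arr F G \<eta> x = (VFO F x, \<eta> x, VFO G x)"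

definition vnat_iso :: "('o, 'a) smc \<Rightarrow> ('c, 'o, 'a) vcat \<Rightarrow> ('d, 'o, 'a) vcat \<Rightarrow>
    ('c, 'd, 'a) vfun \<Rightarrow> ('c, 'd, 'a) vfun \<Rightarrow> ('c \<Rightarrow> 'a) \<Rightarrow> bool" where
  "vnat_iso V C D F G \<eta> \<longleftrightarrow> vnat V C D F G \<eta> \<and>
     (\<forall>x \<in> VObj C. iso_arr (underlying V D) (vnat_arr F G \<eta> x))"

definition full_vsub :: "('c, 'o, 'a) vcat \<Rightarrow> 'c set \<Rightarrow> ('c, 'o, 'a) vcat" where
  "full_vsub C S = C\<lparr>VObj := S\<rparr>"

definition ess_image :: "('o, 'a) smc \<Rightarrow> ('c, 'o, 'a) vcat \<Rightarrow> ('d, 'o, 'a) vcat \<Rightarrow>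
    ('c, 'd, 'a) vfun \<Rightarrow> ('d, 'o, 'a) vcat" where
  "ess_image V C D F =
     full_vsub D {y \<in> VObj D. \<exists>x \<in> VObj C. iso_objs (underlying V D) (VFO F x) y}"


subsection \<open>Weighted colimits and cocompleteness\<close>

definition vop :: "('o, 'a) smc \<Rightarrow> ('c, 'o, 'a) vcat \<Rightarrow> ('c, 'o, 'a) vcat" where
  "vop V C = \<lparr>VObj = VObj C, VHom = (\<lambda>x y. VHom C y x), VId = VId C,
     VComp = (\<lambda>x y z. VComp C z y x \<cdot>\<^bsub>V\<^esub> Sym V (VHom C z y) (VHom C y x))\<rparr>"

definition vself :: "('o, 'a) smc \<Rightarrow> ('o, 'o, 'a) vcat" where
  "vself V = \<lparr>VObj = Obj V, VHom = IHom V, VId = (\<lambda>A. curry_arr V \<one>\<^bsub>V\<^esub> A A (LUnit V A)),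
     VComp = (\<lambda>A B D. curry_arr V (IHom V B D \<otimes>\<^bsub>V\<^esub> IHom V A B) A D
       (Ev V B D \<cdot>\<^bsub>V\<^esub> (\<iota>\<^bsub>V\<^esub> (IHom V B D) \<odot>\<^bsub>V\<^esub> Ev V A B) \<cdot>\<^bsub>V\<^esub> Ass V (IHom V B D) (IHom V A B) A))\<rparr>"

text \<open>
  \<open>vnat_object\<close> says that \<open>E\<close> with the projections \<open>\<pi>\<close> is the object \<open>[A, B](F, G)\<close> of
  V-natural transformations, i.e. the end of \<open>B(F a, G a)\<close>.
\<close>

definition vnat_family :: "('o, 'a) smc \<Rightarrow> ('c, 'o, 'a) vcat \<Rightarrow> ('d, 'o, 'a) vcat \<Rightarrow>
    ('c, 'd, 'a) vfun \<Rightarrow> ('c, 'd, 'a) vfun \<Rightarrow> 'o \<Rightarrow> ('c \<Rightarrow> 'a) \<Rightarrow> bool" where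
  "vnat_family V A B F G T \<tau> \<longleftrightarrow> T \<in> Obj V
     \<and> (\<forall>a \<in> VObj A. \<tau> a \<in> hom V T (VHom B (VFO F a) (VFO G a)))
     \<and> (\<forall>a \<in> VObj A. \<forall>b \<in> VObj A.
          VComp B (VFO F a) (VFO F b) (VFO G b) \<cdot>\<^bsub>V\<^esub> (\<tau> b \<odot>\<^bsub>V\<^esub> VFH F a b) =
          VComp B (VFO F a) (VFO G a) (VFO G b) \<cdot>\<^bsub>V\<^esub> (VFH G a b \<odot>\<^bsub>V\<^esub> \<tau> a)
            \<cdot>\<^bsub>V\<^esub> Sym V T (VHom A a b))"

definition vnat_object :: "('o, 'a) smc \<Rightarrow> ('c, 'o, 'a) vcat \<Rightarrow> ('d, 'o, 'a) vcat \<Rightarrow>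
    ('c, 'd, 'a) vfun \<Rightarrow> ('c, 'd, 'a) vfun \<Rightarrow> 'o \<Rightarrow> ('c \<Rightarrow> 'a) \<Rightarrow> bool" where
  "vnat_object V A B F G E \<pi> \<longleftrightarrow> vnat_family V A B F G E \<pi>
     \<and> (\<forall>T \<tau>. vnat_family V A B F G T \<tau> \<longrightarrow>
          (\<exists>!h. h \<in> hom V T E \<and> (\<forall>a \<in> VObj A. \<pi> a \<cdot>\<^bsub>V\<^esub> h = \<tau> a)))"

text \<open>The presheaf \<open>C(D -, c)\<close> on \<open>K\<close> for a V-functor \<open>D : K \<rightarrow> C\<close>.\<close>

definition hom_presheaf :: "('o, 'a) smc \<Rightarrow> ('k, 'o, 'a) vcat \<Rightarrow> ('c, 'o, 'a) vcat \<Rightarrow>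
    ('k, 'c, 'a) vfun \<Rightarrow> 'c \<Rightarrow> ('k, 'o, 'a) vfun" where
  "hom_presheaf V K C D c = \<lparr>VFO = (\<lambda>k. VHom C (VFO D k) c),
     VFH = (\<lambda>k l. curry_arr V (VHom K l k) (VHom C (VFO D k) c) (VHom C (VFO D l) c)
       (VComp C (VFO D l) (VFO D k) c
         \<cdot>\<^bsub>V\<^esub> Sym V (VHom C (VFO D l) (VFO D k)) (VHom C (VFO D k) c)
         \<cdot>\<^bsub>V\<^esub> (VFH D l k \<odot>\<^bsub>V\<^esub> \<iota>\<^bsub>V\<^esub> (VHom C (VFO D k) c))))\<rparr>"

text \<open>
  \<open>L\<close> is the colimit of \<open>D : K \<rightarrow> C\<close> weighted by \<open>W : K\<^sup>o\<^sup>p \<rightarrow> V\<close>, with unit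
  \<open>\<upsilon> : W \<rightarrow> C(D -, L)\<close>, if the induced maps \<open>C(L, c) \<rightarrow> [C(D k, L), C(D k, c)] \<rightarrow> [W k, C(D k, c)]\<close>
  exhibit \<open>C(L, c)\<close> as \<open>[K\<^sup>o\<^sup>p, V](W, C(D -, c))\<close>.
\<close>

definition is_weighted_colimit :: "('o, 'a) smc \<Rightarrow> ('k, 'o, 'a) vcat \<Rightarrow> ('c, 'o, 'a) vcat \<Rightarrow>
    ('k, 'o, 'a) vfun \<Rightarrow> ('k, 'c, 'a) vfun \<Rightarrow> 'c \<Rightarrow> ('k \<Rightarrow> 'a) \<Rightarrow> bool" where
  "is_weighted_colimit V K C W D L \<upsilon> \<longleftrightarrow> L \<in> VObj C
     \<and> vnat V (vop V K) (vself V) W (hom_presheaf V K C D L) \<upsilon>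
     \<and> (\<forall>c \<in> VObj C. vnat_object V (vop V K) (vself V) W (hom_presheaf V K C D c) (VHom C L c)
          (\<lambda>k. VComp (vself V) (VFO W k) (VHom C (VFO D k) L) (VHom C (VFO D k) c)
             \<cdot>\<^bsub>V\<^esub> (curry_arr V (VHom C L c) (VHom C (VFO D k) L) (VHom C (VFO D k) c)
                     (VComp C (VFO D k) L c) \<odot>\<^bsub>V\<^esub> \<upsilon> k)
             \<cdot>\<^bsub>V\<^esub> inv_arr V (RUnit V (VHom C L c))))"

definition vcocomplete :: "'u itself \<Rightarrow> ('o, 'a) smc \<Rightarrow> ('c, 'o, 'a) vcat \<Rightarrow> bool" where
  "vcocomplete TYPE('u) V C \<longleftrightarrow>
     (\<forall>(K :: ('u, 'o, 'a) vcat) W D. vcategory V K \<and> small (VObj K) \<and>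
        vfunctor V (vop V K) (vself V) W \<and> vfunctor V K C D \<longrightarrow>
        (\<exists>L \<upsilon>. is_weighted_colimit V K C W D L \<upsilon>))"

text \<open>
  The conical colimit in the enriched sense, of an ordinary diagram in the underlying category:
  for every \<open>z\<close>, the object \<open>C(L, z)\<close> is the limit in V of the objects \<open>C(D j, z)\<close>.
\<close>

definition is_conical_colimit :: "('o, 'a) smc \<Rightarrow> ('j, 'k, 'y) cat_scheme \<Rightarrow>
    ('c, 'o, 'a) vcat \<Rightarrow> ('j, 'k, 'c, 'c \<times> 'a \<times> 'c) ftr \<Rightarrow> 'c \<Rightarrow> ('j \<Rightarrow> 'c \<times> 'a \<times> 'c) \<Rightarrow> bool" where
  "is_conical_colimit V J C D L p \<longleftrightarrow>
     is_functor J (underlying V C) D \<and> is_cocone J (underlying V C) D L p \<and>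
     (\<forall>z \<in> VObj C. is_limit (op_cat J) V
        \<lparr>FO = (\<lambda>j. VHom C (FO D j) z), FA = (\<lambda>f. pre_comp V C z (FA D f))\<rparr>
        (VHom C L z) (\<lambda>j. pre_comp V C z (p j)))"


section \<open>The enriched ind-category\<close>

text \<open>
  Diagrams that agree on objects and arrows but differ on values outside the index category
  count as different ind-objects; they are canonically isomorphic.
\<close>

record ('u, 'c, 'a) ind_obj =
  Idx :: "('u, 'u) cat"
  Dia :: "('u, 'u, 'c, 'c \<times> 'a \<times> 'c) ftr"

definition is_ind_obj :: "('o, 'a) smc \<Rightarrow> ('c, 'o, 'a) vcat \<Rightarrow> ('u, 'c, 'a) ind_obj \<Rightarrow> bool" where
  "is_ind_obj V C X \<longleftrightarrow> small_category (Idx X) \<and> filtered (Idx X) \<and>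
     is_functor (Idx X) (underlying V C) (Dia X)"

abbreviation ind_at :: "('u, 'c, 'a) ind_obj \<Rightarrow> 'u \<Rightarrow> 'c" where
  "ind_at X i \<equiv> FO (Dia X) i"

text \<open>\<open>ind_col V C x Y\<close> is the colimit over \<open>j\<close> of \<open>C(x, Y\<^sub>j)\<close>, with coprojections \<open>ind_in\<close>.\<close>

definition ind_col_pair :: "('o, 'a) smc \<Rightarrow> ('c, 'o, 'a) vcat \<Rightarrow> 'c \<Rightarrow> ('u, 'c, 'a) ind_obj \<Rightarrow>
    'o \<times> ('u \<Rightarrow> 'a)" where
  "ind_col_pair V C x Y = colimit_of (Idx Y) V
     \<lparr>FO = (\<lambda>j. VHom C x (ind_at Y j)), FA = (\<lambda>b. post_comp V C x (FA (Dia Y) b))\<rparr>"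

definition ind_col :: "('o, 'a) smc \<Rightarrow> ('c, 'o, 'a) vcat \<Rightarrow> 'c \<Rightarrow> ('u, 'c, 'a) ind_obj \<Rightarrow> 'o" where
  "ind_col V C x Y = fst (ind_col_pair V C x Y)"

definition ind_in :: "('o, 'a) smc \<Rightarrow> ('c, 'o, 'a) vcat \<Rightarrow> 'c \<Rightarrow> ('u, 'c, 'a) ind_obj \<Rightarrow>
    'u \<Rightarrow> 'a" where
  "ind_in V C x Y = snd (ind_col_pair V C x Y)"

definition ind_col_map :: "('o, 'a) smc \<Rightarrow> ('c, 'o, 'a) vcat \<Rightarrow> 'c \<times> 'a \<times> 'c \<Rightarrow>
    ('u, 'c, 'a) ind_obj \<Rightarrow> 'a" where
  "ind_col_map V C = (\<lambda>(x, f, x') Y. THE h. h \<in> hom V (ind_col V C x' Y) (ind_col V C x Y) \<and>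
     (\<forall>j \<in> Obj (Idx Y). h \<cdot>\<^bsub>V\<^esub> ind_in V C x' Y j =
        ind_in V C x Y j \<cdot>\<^bsub>V\<^esub> pre_comp V C (ind_at Y j) (x, f, x')))"

definition ind_hom_pair :: "('o, 'a) smc \<Rightarrow> ('c, 'o, 'a) vcat \<Rightarrow> ('u, 'c, 'a) ind_obj \<Rightarrow>
    ('u, 'c, 'a) ind_obj \<Rightarrow> 'o \<times> ('u \<Rightarrow> 'a)" where
  "ind_hom_pair V C X Y = limit_of (op_cat (Idx X)) V
     \<lparr>FO = (\<lambda>i. ind_col V C (ind_at X i) Y), FA = (\<lambda>a. ind_col_map V C (FA (Dia X) a) Y)\<rparr>"

definition ind_hom :: "('o, 'a) smc \<Rightarrow> ('c, 'o, 'a) vcat \<Rightarrow> ('u, 'c, 'a) ind_obj \<Rightarrow>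
    ('u, 'c, 'a) ind_obj \<Rightarrow> 'o" where
  "ind_hom V C X Y = fst (ind_hom_pair V C X Y)"

definition ind_proj :: "('o, 'a) smc \<Rightarrow> ('c, 'o, 'a) vcat \<Rightarrow> ('u, 'c, 'a) ind_obj \<Rightarrow>
    ('u, 'c, 'a) ind_obj \<Rightarrow> 'u \<Rightarrow> 'a" where
  "ind_proj V C X Y = snd (ind_hom_pair V C X Y)"

definition ind_id :: "('o, 'a) smc \<Rightarrow> ('c, 'o, 'a) vcat \<Rightarrow> ('u, 'c, 'a) ind_obj \<Rightarrow> 'a" where
  "ind_id V C X = (THE h. h \<in> hom V \<one>\<^bsub>V\<^esub> (ind_hom V C X X) \<and>
     (\<forall>i \<in> Obj (Idx X). ind_proj V C X X i \<cdot>\<^bsub>V\<^esub> h = ind_in V C (ind_at X i) X i \<cdot>\<^bsub>V\<^esub> VId C (ind_at X i)))"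

text \<open>
  Composition is induced by that of \<open>C\<close> in three steps, using that the tensor product preserves
  colimits in each variable:
  \<open>colim\<^sub>k C(y, Z\<^sub>k) \<otimes> C(x, y) \<rightarrow> colim\<^sub>k C(x, Z\<^sub>k)\<close>, then
  \<open>ind(Y, Z) \<otimes> colim\<^sub>j C(x, Y\<^sub>j) \<rightarrow> colim\<^sub>k C(x, Z\<^sub>k)\<close>, then
  \<open>ind(Y, Z) \<otimes> ind(X, Y) \<rightarrow> ind(X, Z)\<close>.
\<close>

definition ind_act :: "('o, 'a) smc \<Rightarrow> ('c, 'o, 'a) vcat \<Rightarrow> 'c \<Rightarrow> 'c \<Rightarrow> ('u, 'c, 'a) ind_obj \<Rightarrow>
    'a" where
  "ind_act V C x y Z = (THE h.
     h \<in> hom V (ind_col V C y Z \<otimes>\<^bsub>V\<^esub> VHom C x y) (ind_col V C x Z) \<and>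
     (\<forall>k \<in> Obj (Idx Z). h \<cdot>\<^bsub>V\<^esub> (ind_in V C y Z k \<odot>\<^bsub>V\<^esub> \<iota>\<^bsub>V\<^esub> (VHom C x y)) =
        ind_in V C x Z k \<cdot>\<^bsub>V\<^esub> VComp C x y (ind_at Z k)))"

definition ind_act2 :: "('o, 'a) smc \<Rightarrow> ('c, 'o, 'a) vcat \<Rightarrow> 'c \<Rightarrow> ('u, 'c, 'a) ind_obj \<Rightarrow>
    ('u, 'c, 'a) ind_obj \<Rightarrow> 'a" where
  "ind_act2 V C x Y Z = (THE h.
     h \<in> hom V (ind_hom V C Y Z \<otimes>\<^bsub>V\<^esub> ind_col V C x Y) (ind_col V C x Z) \<and>
     (\<forall>j \<in> Obj (Idx Y). h \<cdot>\<^bsub>V\<^esub> (\<iota>\<^bsub>V\<^esub> (ind_hom V C Y Z) \<odot>\<^bsub>V\<^esub> ind_in V C x Y j) =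
        ind_act V C x (ind_at Y j) Z \<cdot>\<^bsub>V\<^esub> (ind_proj V C Y Z j \<odot>\<^bsub>V\<^esub> \<iota>\<^bsub>V\<^esub> (VHom C x (ind_at Y j)))))"

definition ind_comp :: "('o, 'a) smc \<Rightarrow> ('c, 'o, 'a) vcat \<Rightarrow> ('u, 'c, 'a) ind_obj \<Rightarrow>
    ('u, 'c, 'a) ind_obj \<Rightarrow> ('u, 'c, 'a) ind_obj \<Rightarrow> 'a" where
  "ind_comp V C X Y Z = (THE h.
     h \<in> hom V (ind_hom V C Y Z \<otimes>\<^bsub>V\<^esub> ind_hom V C X Y) (ind_hom V C X Z) \<and>
     (\<forall>i \<in> Obj (Idx X). ind_proj V C X Z i \<cdot>\<^bsub>V\<^esub> h =
        ind_act2 V C (ind_at X i) Y Z \<cdot>\<^bsub>V\<^esub> (\<iota>\<^bsub>V\<^esub> (ind_hom V C Y Z) \<odot>\<^bsub>V\<^esub> ind_proj V C X Y i)))"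

definition ind_cat :: "'u itself \<Rightarrow> ('o, 'a) smc \<Rightarrow> ('c, 'o, 'a) vcat \<Rightarrow>
    (('u, 'c, 'a) ind_obj, 'o, 'a) vcat" where
  "ind_cat TYPE('u) V C = \<lparr>VObj = {X. is_ind_obj V C X}, VHom = ind_hom V C, VId = ind_id V C,
     VComp = ind_comp V C\<rparr>"

text \<open>The embedding of \<open>C\<close>; the one-object index category lives on an arbitrary element of \<open>'u\<close>.\<close>

definition const_ind_obj :: "('c, 'o, 'a) vcat \<Rightarrow> 'c \<Rightarrow> ('u, 'c, 'a) ind_obj" where
  "const_ind_obj C x = \<lparr>Idx = \<lparr>Obj = {undefined}, Arr = {undefined}, Dom = (\<lambda>_. undefined),
       Cod = (\<lambda>_. undefined), Idt = (\<lambda>_. undefined), Cmp = (\<lambda>_ _. undefined)\<rparr>,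
     Dia = \<lparr>FO = (\<lambda>_. x), FA = (\<lambda>_. (x, VId C x, x))\<rparr>\<rparr>"

definition ind_embed :: "'u itself \<Rightarrow> ('o, 'a) smc \<Rightarrow> ('c, 'o, 'a) vcat \<Rightarrow>
    ('c, ('u, 'c, 'a) ind_obj, 'a) vfun" where
  "ind_embed TYPE('u) V C = \<lparr>VFO = const_ind_obj C,
     VFH = (\<lambda>x y. let X = (const_ind_obj C x :: ('u, 'c, 'a) ind_obj);
                     Y = (const_ind_obj C y :: ('u, 'c, 'a) ind_obj) in
       THE h. h \<in> hom V (VHom C x y) (ind_hom V C X Y) \<and>
         ind_proj V C X Y undefined \<cdot>\<^bsub>V\<^esub> h = ind_in V C x Y undefined)\<rparr>"


section \<open>Well-pointed endofunctors and localisation\<close>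

definition well_pointed :: "('o, 'a) smc \<Rightarrow> ('c, 'o, 'a) vcat \<Rightarrow> ('c, 'c, 'a) vfun \<Rightarrow>
    ('c \<Rightarrow> 'a) \<Rightarrow> bool" where
  "well_pointed V C \<Omega> \<theta> \<longleftrightarrow> vfunctor V C C \<Omega> \<and> vnat V C C (vfun_id V C) \<Omega> \<theta> \<and>
     (\<forall>x \<in> VObj C. \<theta> (VFO \<Omega> x) = VFH \<Omega> x (VFO \<Omega> x) \<cdot>\<^bsub>V\<^esub> \<theta> x)"

definition inverts :: "('o, 'a) smc \<Rightarrow> ('c, 'o, 'a) vcat \<Rightarrow> ('c, 'c, 'a) vfun \<Rightarrow> ('c \<Rightarrow> 'a) \<Rightarrow>
    ('d, 'o, 'a) vcat \<Rightarrow> ('c, 'd, 'a) vfun \<Rightarrow> bool" where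
  "inverts V C \<Omega> \<theta> D F \<longleftrightarrow>
     (\<forall>x \<in> VObj C. iso_arr (underlying V D) (FA (underlying_ftr V F) (x, \<theta> x, VFO \<Omega> x)))"

text \<open>
  A localisation is the initial V-functor inverting \<open>\<theta>\<close>. Every \<open>F\<close> inverting \<open>\<theta>\<close> factors as
  \<open>F = F' \<gamma>\<close> on the nose. The factorisation is unique up to unique isomorphism: any two
  factorisations, even if they only hold up to isomorphisms \<open>\<phi>\<^sub>1 : F \<cong> F\<^sub>1 \<gamma>\<close> and
  \<open>\<phi>\<^sub>2 : F \<cong> F\<^sub>2 \<gamma>\<close>, are related by exactly one V-natural isomorphism \<open>\<alpha> : F\<^sub>1 \<cong> F\<^sub>2\<close> with
  \<open>\<alpha>\<gamma> \<cdot> \<phi>\<^sub>1 = \<phi>\<^sub>2\<close>. Literal uniqueness of \<open>F'\<close> is not available for a replete \<open>C'\<close>: the value of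
  \<open>F'\<close> at an object that is only isomorphic to some \<open>\<gamma> x\<close> can be replaced by an isomorphic one.
  Taking identities for \<open>\<phi>\<^sub>1\<close> and \<open>\<phi>\<^sub>2\<close> shows that strict factorisations agree literally on the full
  subcategory of the objects \<open>\<gamma> x\<close>.

  The type argument is the type of objects of the test V-categories \<open>D\<close>.
\<close>

definition is_localisation :: "'d itself \<Rightarrow> ('o, 'a) smc \<Rightarrow> ('c, 'o, 'a) vcat \<Rightarrow>
    ('c, 'c, 'a) vfun \<Rightarrow> ('c \<Rightarrow> 'a) \<Rightarrow> ('l, 'o, 'a) vcat \<Rightarrow> ('c, 'l, 'a) vfun \<Rightarrow> bool" where
  "is_localisation TYPE('d) V C \<Omega> \<theta> C' \<gamma> \<longleftrightarrow>
     vcategory V C' \<and> vfunctor V C C' \<gamma> \<and> inverts V C \<Omega> \<theta> C' \<gamma> \<and>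
     (\<forall>(D :: ('d, 'o, 'a) vcat) F. vcategory V D \<and> vfunctor V C D F \<and> inverts V C \<Omega> \<theta> D F \<longrightarrow>
        (\<exists>F'. vfunctor V C' D F' \<and> vfun_eq C F (vfun_comp V F' \<gamma>)) \<and>
        (\<forall>F\<^sub>1 F\<^sub>2 \<phi>\<^sub>1 \<phi>\<^sub>2. vfunctor V C' D F\<^sub>1 \<and> vfunctor V C' D F\<^sub>2 \<and>
           vnat_iso V C D F (vfun_comp V F\<^sub>1 \<gamma>) \<phi>\<^sub>1 \<and> vnat_iso V C D F (vfun_comp V F\<^sub>2 \<gamma>) \<phi>\<^sub>2 \<longrightarrow>
           (\<exists>!\<alpha>. \<alpha> \<in> extensional (VObj C') \<and> vnat_iso V C' D F\<^sub>1 F\<^sub>2 \<alpha> \<and>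
              (\<forall>x \<in> VObj C. vnat_arr F\<^sub>1 F\<^sub>2 \<alpha> (VFO \<gamma> x) \<cdot>\<^bsub>underlying V D\<^esub>
                   vnat_arr F (vfun_comp V F\<^sub>1 \<gamma>) \<phi>\<^sub>1 x =
                 vnat_arr F (vfun_comp V F\<^sub>2 \<gamma>) \<phi>\<^sub>2 x))))"


subsection \<open>The functor \<open>\<Omega>\<^sup>\<infinity>\<close>\<close>

definition nat_cat :: "(nat, nat \<times> nat) cat" where
  "nat_cat = \<lparr>Obj = UNIV, Arr = {(m, n). m \<le> n}, Dom = fst, Cod = snd, Idt = (\<lambda>n. (n, n)),
     Cmp = (\<lambda>b a. (fst a, snd b))\<rparr>"

primrec iter_arr :: "('o, 'a) smc \<Rightarrow> ('c, 'o, 'a) vcat \<Rightarrow> ('c, 'c, 'a) vfun \<Rightarrow> ('c \<Rightarrow> 'a) \<Rightarrow>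
    'c \<Rightarrow> nat \<Rightarrow> 'c \<times> 'a \<times> 'c" where
  "iter_arr V C \<Omega> \<theta> x 0 = \<iota>\<^bsub>underlying V C\<^esub> x"
| "iter_arr V C \<Omega> \<theta> x (Suc k) = (let y = (VFO \<Omega> ^^ k) x in
     (y, \<theta> y, VFO \<Omega> y) \<cdot>\<^bsub>underlying V C\<^esub> iter_arr V C \<Omega> \<theta> x k)"

definition iter_seq :: "('o, 'a) smc \<Rightarrow> ('c, 'o, 'a) vcat \<Rightarrow> ('c, 'c, 'a) vfun \<Rightarrow> ('c \<Rightarrow> 'a) \<Rightarrow>
    'c \<Rightarrow> (nat, nat \<times> nat, 'c, 'c \<times> 'a \<times> 'c) ftr" where
  "iter_seq V C \<Omega> \<theta> x = \<lparr>FO = (\<lambda>n. (VFO \<Omega> ^^ n) x),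
     FA = (\<lambda>(m, n). iter_arr V C \<Omega> \<theta> ((VFO \<Omega> ^^ m) x) (n - m))\<rparr>"

text \<open>
  A V-functor to the ind-category is the colimit functor of the sequence
  \<open>X \<rightarrow> \<Omega> X \<rightarrow> \<Omega>\<^sup>2 X \<rightarrow> \<dots>\<close> if it carries V-natural transformations from the functors \<open>\<Omega>\<^sup>n\<close> that
  are enriched colimit cocones for each \<open>X\<close>.
\<close>

definition is_seq_colimit_functor :: "'u itself \<Rightarrow> ('o, 'a) smc \<Rightarrow> ('c, 'o, 'a) vcat \<Rightarrow>
    ('c, 'c, 'a) vfun \<Rightarrow> ('c \<Rightarrow> 'a) \<Rightarrow> ('c, ('u, 'c, 'a) ind_obj, 'a) vfun \<Rightarrow> bool" where
  "is_seq_colimit_functor TYPE('u) V C \<Omega> \<theta> W \<longleftrightarrow> (\<exists>\<kappa>.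
     (\<forall>n. vnat V C (ind_cat TYPE('u) V C)
        (vfun_comp V (ind_embed TYPE('u) V C) (vfun_pow V C \<Omega> n)) W (\<kappa> n)) \<and>
     (\<forall>x \<in> VObj C. is_conical_colimit V nat_cat (ind_cat TYPE('u) V C)
        (ftr_comp (underlying_ftr V (ind_embed TYPE('u) V C)) (iter_seq V C \<Omega> \<theta> x))
        (VFO W x)
        (\<lambda>n. (const_ind_obj C ((VFO \<Omega> ^^ n) x), \<kappa> n x, VFO W x))))"

text \<open>
  The colimit is constructed as the formal one, i.e. the sequence itself regarded as a diagram.
  This requires a copy of \<open>nat_cat\<close> inside \<open>'u\<close>, by way of a chosen injection.
\<close>

definition nat_code :: "nat \<Rightarrow> 'u" where
  "nat_code = (SOME e. inj e)"

definition pair_code :: "nat \<times> nat \<Rightarrow> 'u" where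
  "pair_code p = nat_code (prod_encode p)"

definition omega_cat :: "('u, 'u) cat" where
  "omega_cat = \<lparr>Obj = range nat_code, Arr = pair_code ` Arr nat_cat,
     Dom = (\<lambda>a. nat_code (fst (inv pair_code a))), Cod = (\<lambda>a. nat_code (snd (inv pair_code a))),
     Idt = (\<lambda>u. pair_code (inv nat_code u, inv nat_code u)),
     Cmp = (\<lambda>b a. pair_code (inv pair_code b \<cdot>\<^bsub>nat_cat\<^esub> inv pair_code a))\<rparr>"

definition Omega_inf_obj :: "('o, 'a) smc \<Rightarrow> ('c, 'o, 'a) vcat \<Rightarrow> ('c, 'c, 'a) vfun \<Rightarrow>
    ('c \<Rightarrow> 'a) \<Rightarrow> 'c \<Rightarrow> ('u, 'c, 'a) ind_obj" where
  "Omega_inf_obj V C \<Omega> \<theta> x = \<lparr>Idx = omega_cat,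
     Dia = ftr_comp (iter_seq V C \<Omega> \<theta> x) \<lparr>FO = inv nat_code, FA = inv pair_code\<rparr>\<rparr>"

definition Omega_inf :: "'u itself \<Rightarrow> ('o, 'a) smc \<Rightarrow> ('c, 'o, 'a) vcat \<Rightarrow> ('c, 'c, 'a) vfun \<Rightarrow>
    ('c \<Rightarrow> 'a) \<Rightarrow> ('c, ('u, 'c, 'a) ind_obj, 'a) vfun" where
  "Omega_inf TYPE('u) V C \<Omega> \<theta> = \<lparr>VFO = Omega_inf_obj V C \<Omega> \<theta>,
     VFH = (\<lambda>x y. let X = (Omega_inf_obj V C \<Omega> \<theta> x :: ('u, 'c, 'a) ind_obj);
                     Y = (Omega_inf_obj V C \<Omega> \<theta> y :: ('u, 'c, 'a) ind_obj) in
       THE h. h \<in> hom V (VHom C x y) (ind_hom V C X Y) \<and>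
         (\<forall>n. ind_proj V C X Y (nat_code n) \<cdot>\<^bsub>V\<^esub> h =
            ind_in V C ((VFO \<Omega> ^^ n) x) Y (nat_code n) \<cdot>\<^bsub>V\<^esub> VFH (vfun_pow V C \<Omega> n) x y))\<rparr>"

definition L_Omega :: "'u itself \<Rightarrow> ('o, 'a) smc \<Rightarrow> ('c, 'o, 'a) vcat \<Rightarrow> ('c, 'c, 'a) vfun \<Rightarrow>
    ('c \<Rightarrow> 'a) \<Rightarrow> (('u, 'c, 'a) ind_obj, 'o, 'a) vcat" where
  "L_Omega TYPE('u) V C \<Omega> \<theta> =
     ess_image V C (ind_cat TYPE('u) V C) (Omega_inf TYPE('u) V C \<Omega> \<theta>)"

end

theory Submission
  imports Defs
begin

text \<open>
  Since \<open>V\<close> is concrete and closed, an arrow \<open>A \<rightarrow> B\<close> is determined by its values on the points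
  \<open>1 \<rightarrow> A\<close>, and an arrow \<open>A \<otimes> B \<rightarrow> D\<close> by its values on pairs of points, so every enriched identity
  can be checked on points. Compactness of the unit says that each point of \<open>colim\<^sub>j C(x, Y\<^sub>j)\<close> is
  the class \<open>[g]\<^sub>j\<close> of some \<open>g : x \<rightarrow> Y\<^sub>j\<close>.

  Well-pointedness gives \<open>\<Omega>\<^sup>n (\<theta> x) = \<theta> (\<Omega>\<^sup>n x)\<close>, hence \<open>\<Omega>\<^sup>\<infinity> (\<theta> x)\<close> is invertible, with inverse the
  shift of the sequence. It also makes precomposition with \<open>\<theta> x\<close> injective on
  \<open>colim\<^sub>n C(\<Omega> x, \<Omega>\<^sup>n y)\<close>, so an arrow \<open>\<Omega>\<^sup>\<infinity> x \<rightarrow> \<Omega>\<^sup>\<infinity> y\<close> is determined by its component \<open>[g]\<^sub>n\<close> at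
  \<open>x\<close>: up to \<open>n\<close> of the inverted arrows it is \<open>\<Omega>\<^sup>\<infinity> g\<close>. A functor \<open>F\<close> inverting \<open>\<theta>\<close> therefore has
  to send it to \<open>F(\<theta>\<^sup>n)\<^sup>-\<^sup>1 \<cdot> F g\<close>, which does define a V-functor, and chosen isomorphisms extend it to
  the essential image.
\<close>


section \<open>Points of a concrete closed category\<close>

text \<open>A function defined on points need not come from an arrow of \<open>V\<close>. The
  formulas on representatives therefore only verify equations; the arrows themselves (identities,
  composition, \<open>\<Omega>\<^sup>\<infinity>\<close>, the factorisation) are produced by the
  universal property of a colimit, a limit or an internal hom, after the formula has been shown
  compatible with the transition arrows. Two obstacles shape this. A tensor product can have points
  that are not pairs, so testing on pairs, and likewise moving colimits through the tensor product
  in the composition of the ind-category, goes through the adjunction with the internal hom. And the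
  factorisation reads an arrow of ind-objects through its component at stage 0 alone, which makes it
  easy to define but leaves its functoriality to a comparison of that component with all later
  ones.\<close>

context category begin

section \<open>Inverses and cancellation in ordinary categories\<close>

lemma hom_dom: "f \<in> hom C x y \<Longrightarrow> Dom C f = x"
  and hom_cod: "f \<in> hom C x y \<Longrightarrow> Cod C f = y"
  and hom_dom_obj: "f \<in> hom C x y \<Longrightarrow> x \<in> Obj C"
  and hom_cod_obj: "f \<in> hom C x y \<Longrightarrow> y \<in> Obj C"
  using dom_obj cod_obj by (auto simp: hom_def)

lemma inverse_arrs_unique:
  assumes "inverse_arrs C f g" "inverse_arrs C f h"
  shows "g = h"
proof -
  let ?x = "Dom C f" and ?y = "Cod C f"
  have f: "f \<in> hom C ?x ?y" and g: "g \<in> hom C ?y ?x" and h: "h \<in> hom C ?y ?x"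
    and gf: "g \<cdot> f = \<iota> ?x" and fh: "f \<cdot> h = \<iota> ?y"
    using assms by (auto simp: inverse_arrs_def hom_def)
  have "g = g \<cdot> (f \<cdot> h)" using g by (simp add: fh cmp_idt)
  also have "\<dots> = (g \<cdot> f) \<cdot> h" using f g h by (simp add: cmp_assoc)
  also have "\<dots> = h" using h by (simp add: gf idt_cmp)
  finally show ?thesis .
qed

lemma inverse_arrs_inv_arr:
  assumes "iso_arr C f"
  shows "inverse_arrs C f (inv_arr C f)"
proof -
  from assms obtain g where g: "inverse_arrs C f g" by (auto simp: iso_arr_def)
  have "inv_arr C f = g"
    unfolding inv_arr_def by (rule the_equality) (use g inverse_arrs_unique in auto)
  with g show ?thesis by simp
qed

lemma
  assumes "iso_arr C f" "f \<in> hom C x y"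
  shows inv_arr_hom: "inv_arr C f \<in> hom C y x"
    and inv_arr_cmp: "inv_arr C f \<cdot> f = \<iota> x"
    and cmp_inv_arr: "f \<cdot> inv_arr C f = \<iota> y"
  using inverse_arrs_inv_arr[OF assms(1)] assms(2) by (auto simp: inverse_arrs_def hom_def)

lemma iso_arrI:
  assumes "f \<in> hom C x y" "g \<in> hom C y x" "g \<cdot> f = \<iota> x" "f \<cdot> g = \<iota> y"
  shows "iso_arr C f"
  unfolding iso_arr_def inverse_arrs_def using assms by (auto simp: hom_def)

lemma iso_cancel_right:
  assumes e: "iso_arr C e" "e \<in> hom C x y" and f: "f \<in> hom C y z" and g: "g \<in> hom C y z"
    and eq: "f \<cdot> e = g \<cdot> e"
  shows "f = g"
proof -
  note i = inv_arr_hom[OF e] cmp_inv_arr[OF e]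
  have "f = (f \<cdot> e) \<cdot> inv_arr C e" using cmp_assoc[OF i(1) e(2) f] i f by (simp add: cmp_idt)
  also have "\<dots> = g" using cmp_assoc[OF i(1) e(2) g] i g eq by (simp add: cmp_idt)
  finally show ?thesis .
qed

lemma iso_cancel_left:
  assumes e: "iso_arr C e" "e \<in> hom C y z" and f: "f \<in> hom C x y" and g: "g \<in> hom C x y"
    and eq: "e \<cdot> f = e \<cdot> g"
  shows "f = g"
proof -
  note i = inv_arr_hom[OF e] inv_arr_cmp[OF e]
  have "f = inv_arr C e \<cdot> (e \<cdot> f)" using cmp_assoc[OF f e(2) i(1)] i f by (simp add: idt_cmp)
  also have "\<dots> = g" using cmp_assoc[OF g e(2) i(1)] i g eq by (simp add: idt_cmp)
  finally show ?thesis .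
qed

end

section \<open>Unit coherence in a monoidal category\<close>

context monoidal_category begin

text \<open>Naturality of the invertible unitor recovers \<open>f\<close> from
  \<open>\<iota> \<one> \<odot> f\<close>, so an identity may be proved after tensoring with
  \<open>\<one>\<close>.\<close>

lemma unit_tens_faithful:
  assumes "f \<in> hom V A B" "g \<in> hom V A B" "\<iota> \<one> \<odot> f = \<iota> \<one> \<odot> g"
  shows "f = g"
proof -
  have A: "A \<in> Obj V" using assms hom_dom_obj by blast
  show ?thesis
    using iso_cancel_right[OF lunit_iso[OF A] lunit_hom[OF A] assms(1,2)]
      lunit_nat[OF assms(1)] lunit_nat[OF assms(2)] assms(3) by simp
qed

lemma tens_unit_faithful:
  assumes "f \<in> hom V A B" "g \<in> hom V A B" "f \<odot> \<iota> \<one> = g \<odot> \<iota> \<one>"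
  shows "f = g"
proof -
  have A: "A \<in> Obj V" using assms hom_dom_obj by blast
  show ?thesis
    using iso_cancel_right[OF runit_iso[OF A] runit_hom[OF A] assms(1,2)]
      runit_nat[OF assms(1)] runit_nat[OF assms(2)] assms(3) by simp
qed

lemma tensA_iso:
  assumes "iso_arr V f" "f \<in> hom V A A'" "iso_arr V g" "g \<in> hom V B B'"
  shows "iso_arr V (f \<odot> g)"
proof (rule iso_arrI)
  note F = inv_arr_hom[OF assms(1,2)] and G = inv_arr_hom[OF assms(3,4)]
  have o: "A \<in> Obj V" "B \<in> Obj V" "A' \<in> Obj V" "B' \<in> Obj V"
    using assms hom_dom_obj hom_cod_obj by blast+
  show "f \<odot> g \<in> hom V (A \<otimes> B) (A' \<otimes> B')" using assms tensA_hom by blast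
  show "inv_arr V f \<odot> inv_arr V g \<in> hom V (A' \<otimes> B') (A \<otimes> B)" using F G tensA_hom by blast
  show "(inv_arr V f \<odot> inv_arr V g) \<cdot> (f \<odot> g) = \<iota> (A \<otimes> B)"
    using tensA_cmp[OF assms(2) F assms(4) G] inv_arr_cmp[OF assms(1,2)] inv_arr_cmp[OF assms(3,4)]
      tensA_idt o by simp
  show "(f \<odot> g) \<cdot> (inv_arr V f \<odot> inv_arr V g) = \<iota> (A' \<otimes> B')"
    using tensA_cmp[OF F assms(2) G assms(4)] cmp_inv_arr[OF assms(1,2)] cmp_inv_arr[OF assms(3,4)]
      tensA_idt o by simp
qed

lemma idt_iso: "A \<in> Obj V \<Longrightarrow> iso_arr V (\<iota> A)"
  by (rule iso_arrI[where x=A and y=A and g="\<iota> A"]) (auto simp: idt_hom idt_cmp[OF idt_hom])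

text \<open>This is naturality of the unitor at the unitor itself, with the invertible outer factor
  cancelled.\<close>

lemma lunit_tens:
  assumes A: "A \<in> Obj V"
  shows "LUnit V (\<one> \<otimes> A) = \<iota> \<one> \<odot> LUnit V A"
proof -
  have l: "LUnit V (\<one> \<otimes> A) \<in> hom V (\<one> \<otimes> (\<one> \<otimes> A)) (\<one> \<otimes> A)"
    using lunit_hom tens_obj unit_obj A by blast
  have r: "\<iota> \<one> \<odot> LUnit V A \<in> hom V (\<one> \<otimes> (\<one> \<otimes> A)) (\<one> \<otimes> A)"
    using tensA_hom[OF idt_hom[OF unit_obj] lunit_hom[OF A]] .
  show ?thesis
    by (rule iso_cancel_left[OF lunit_iso[OF A] lunit_hom[OF A] l r])
       (simp add: lunit_nat[OF lunit_hom[OF A]])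
qed

text \<open>Kelly's argument: the pentagon for \<open>\<one>\<close>, \<open>\<one>\<close>,
  \<open>A\<close>, \<open>B\<close>, together with two instances of the triangle and naturality of
  the associator, gives the claim tensored with \<open>\<one>\<close> and precomposed with
  associators.\<close>

lemma lunit_ass:
  assumes A: "A \<in> Obj V" and B: "B \<in> Obj V"
  shows "LUnit V (A \<otimes> B) \<cdot> Ass V \<one> A B = LUnit V A \<odot> \<iota> B"
proof -
  note o = unit_obj A B tens_obj
  note i1 = idt_hom[OF unit_obj] and iB = idt_hom[OF B] and iA = idt_hom[OF A]
  let ?I = "\<iota> \<one>"
  have AB: "A \<otimes> B \<in> Obj V" and OA: "\<one> \<otimes> A \<in> Obj V" and OO: "\<one> \<otimes> \<one> \<in> Obj V"
    using o by auto
  let ?e = "Ass V \<one> (\<one> \<otimes> A) B \<cdot> (Ass V \<one> \<one> A \<odot> \<iota> B)"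
  have e1: "Ass V \<one> (\<one> \<otimes> A) B \<in> hom V ((\<one> \<otimes> (\<one> \<otimes> A)) \<otimes> B) (\<one> \<otimes> ((\<one> \<otimes> A) \<otimes> B))"
    using ass_hom o by blast
  have e2: "Ass V \<one> \<one> A \<odot> \<iota> B \<in> hom V (((\<one> \<otimes> \<one>) \<otimes> A) \<otimes> B) ((\<one> \<otimes> (\<one> \<otimes> A)) \<otimes> B)"
    using tensA_hom[OF ass_hom iB] o by blast
  have e2i: "iso_arr V (Ass V \<one> \<one> A \<odot> \<iota> B)"
    by (rule tensA_iso[OF ass_iso ass_hom idt_iso iB]) (use o in auto)
  have e1i: "iso_arr V (Ass V \<one> (\<one> \<otimes> A) B)" using ass_iso o by blast
  have l: "LUnit V (A \<otimes> B) \<in> hom V (\<one> \<otimes> (A \<otimes> B)) (A \<otimes> B)" using lunit_hom o by blast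
  have a: "Ass V \<one> A B \<in> hom V ((\<one> \<otimes> A) \<otimes> B) (\<one> \<otimes> (A \<otimes> B))" using ass_hom o by blast
  have la: "LUnit V (A \<otimes> B) \<cdot> Ass V \<one> A B \<in> hom V ((\<one> \<otimes> A) \<otimes> B) (A \<otimes> B)"
    by (rule cmp_hom[OF a l])
  have lA: "LUnit V A \<odot> \<iota> B \<in> hom V ((\<one> \<otimes> A) \<otimes> B) (A \<otimes> B)"
    by (rule tensA_hom[OF lunit_hom[OF A] iB])
  have Il: "?I \<odot> LUnit V (A \<otimes> B) \<in> hom V (\<one> \<otimes> (\<one> \<otimes> (A \<otimes> B))) (\<one> \<otimes> (A \<otimes> B))"
    by (rule tensA_hom[OF i1 l])
  have Ia: "?I \<odot> Ass V \<one> A B \<in> hom V (\<one> \<otimes> ((\<one> \<otimes> A) \<otimes> B)) (\<one> \<otimes> (\<one> \<otimes> (A \<otimes> B)))"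
    by (rule tensA_hom[OF i1 a])
  have a11: "Ass V \<one> \<one> (A \<otimes> B) \<in> hom V ((\<one> \<otimes> \<one>) \<otimes> (A \<otimes> B)) (\<one> \<otimes> (\<one> \<otimes> (A \<otimes> B)))"
    using ass_hom o by blast
  have a12: "Ass V (\<one> \<otimes> \<one>) A B \<in> hom V (((\<one> \<otimes> \<one>) \<otimes> A) \<otimes> B) ((\<one> \<otimes> \<one>) \<otimes> (A \<otimes> B))"
    using ass_hom o by blast
  have Ila: "?I \<odot> (LUnit V (A \<otimes> B) \<cdot> Ass V \<one> A B) = (?I \<odot> LUnit V (A \<otimes> B)) \<cdot> (?I \<odot> Ass V \<one> A B)"
    using tensA_cmp[OF i1 i1 a l] idt_cmp[OF i1] by simp
  have lA1: "?I \<odot> LUnit V A \<in> hom V (\<one> \<otimes> (\<one> \<otimes> A)) (\<one> \<otimes> A)"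
    by (rule tensA_hom[OF i1 lunit_hom[OF A]])
  have assOOA: "Ass V \<one> \<one> A \<in> hom V ((\<one> \<otimes> \<one>) \<otimes> A) (\<one> \<otimes> (\<one> \<otimes> A))"
    using ass_hom o by blast
  have "(?I \<odot> (LUnit V (A \<otimes> B) \<cdot> Ass V \<one> A B)) \<cdot> ?e
      = (?I \<odot> LUnit V (A \<otimes> B)) \<cdot> ((?I \<odot> Ass V \<one> A B) \<cdot> ?e)"
    unfolding Ila by (rule cmp_assoc[OF cmp_hom[OF e2 e1] Ia Il])
  also have "\<dots> = (?I \<odot> LUnit V (A \<otimes> B)) \<cdot> (Ass V \<one> \<one> (A \<otimes> B) \<cdot> Ass V (\<one> \<otimes> \<one>) A B)"
    using pentagon[of \<one> \<one> A B] o by simp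
  also have "\<dots> = ((?I \<odot> LUnit V (A \<otimes> B)) \<cdot> Ass V \<one> \<one> (A \<otimes> B)) \<cdot> Ass V (\<one> \<otimes> \<one>) A B"
    by (rule cmp_assoc[OF a12 a11 Il, symmetric])
  also have "\<dots> = (RUnit V \<one> \<odot> \<iota> (A \<otimes> B)) \<cdot> Ass V (\<one> \<otimes> \<one>) A B"
    using triangle[of \<one> "A \<otimes> B"] o by simp
  also have "\<dots> = Ass V \<one> A B \<cdot> ((RUnit V \<one> \<odot> \<iota> A) \<odot> \<iota> B)"
    using ass_nat[OF runit_hom[OF unit_obj] iA iB] tensA_idt[OF A B] by simp
  also have "(RUnit V \<one> \<odot> \<iota> A) \<odot> \<iota> B = ((?I \<odot> LUnit V A) \<odot> \<iota> B) \<cdot> (Ass V \<one> \<one> A \<odot> \<iota> B)"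
    using tensA_cmp[OF assOOA lA1 iB iB] idt_cmp[OF iB] triangle[of \<one> A] o by simp
  also have "Ass V \<one> A B \<cdot> \<dots> = (Ass V \<one> A B \<cdot> ((?I \<odot> LUnit V A) \<odot> \<iota> B)) \<cdot> (Ass V \<one> \<one> A \<odot> \<iota> B)"
    by (rule cmp_assoc[OF e2 tensA_hom[OF lA1 iB] a, symmetric])
  also have "\<dots> = ((?I \<odot> (LUnit V A \<odot> \<iota> B)) \<cdot> Ass V \<one> (\<one> \<otimes> A) B) \<cdot> (Ass V \<one> \<one> A \<odot> \<iota> B)"
    using ass_nat[OF i1 lunit_hom[OF A] iB] by simp
  also have "\<dots> = (?I \<odot> (LUnit V A \<odot> \<iota> B)) \<cdot> ?e"
    by (rule cmp_assoc[OF e2 e1 tensA_hom[OF i1 lA]])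
  finally have eq: "(?I \<odot> (LUnit V (A \<otimes> B) \<cdot> Ass V \<one> A B)) \<cdot> ?e = (?I \<odot> (LUnit V A \<odot> \<iota> B)) \<cdot> ?e" .
  \<comment> \<open>The two associators are invertible and tensoring with the unit is faithful, so
    the three layers around the wanted identity come off one at a time.\<close>
  have 2: "((?I \<odot> (LUnit V (A \<otimes> B) \<cdot> Ass V \<one> A B)) \<cdot> Ass V \<one> (\<one> \<otimes> A) B) \<cdot> (Ass V \<one> \<one> A \<odot> \<iota> B)
     = ((?I \<odot> (LUnit V A \<odot> \<iota> B)) \<cdot> Ass V \<one> (\<one> \<otimes> A) B) \<cdot> (Ass V \<one> \<one> A \<odot> \<iota> B)"
    using eq cmp_assoc[OF e2 e1 tensA_hom[OF i1 lA]] cmp_assoc[OF e2 e1 tensA_hom[OF i1 la]] by simp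
  note 3 = iso_cancel_right[OF e2i e2 cmp_hom[OF e1 tensA_hom[OF i1 la]] cmp_hom[OF e1 tensA_hom[OF i1 lA]] 2]
  note 4 = iso_cancel_right[OF e1i e1 tensA_hom[OF i1 la] tensA_hom[OF i1 lA] 3]
  show ?thesis by (rule unit_tens_faithful[OF la lA 4])
qed

text \<open>Kelly's coherence lemma; it makes the two ways of pairing points with a unit agree.\<close>

lemma lunit_unit_eq_runit_unit: "LUnit V \<one> = RUnit V \<one>"
proof (rule tens_unit_faithful[OF lunit_hom[OF unit_obj] runit_hom[OF unit_obj]])
  show "LUnit V \<one> \<odot> \<iota> \<one> = RUnit V \<one> \<odot> \<iota> \<one>"
    using lunit_ass[OF unit_obj unit_obj] triangle[OF unit_obj unit_obj] lunit_tens[OF unit_obj]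
    by simp
qed

section \<open>Pairing points and evaluating arrows on pairs\<close>

abbreviation pt :: "'o \<Rightarrow> 'a set" where
  "pt A \<equiv> hom V \<one> A"

abbreviation delta :: 'a where
  "delta \<equiv> inv_arr V (LUnit V \<one>)"

lemma
  shows delta_hom: "delta \<in> hom V \<one> (\<one> \<otimes> \<one>)"
    and lunit_delta: "LUnit V \<one> \<cdot> delta = \<iota> \<one>"
    and delta_lunit: "delta \<cdot> LUnit V \<one> = \<iota> (\<one> \<otimes> \<one>)"
  using inv_arr_hom[OF lunit_iso lunit_hom] inv_arr_cmp[OF lunit_iso lunit_hom]
    cmp_inv_arr[OF lunit_iso lunit_hom] unit_obj by auto

text \<open>Reads an arrow out of \<open>A \<otimes> B\<close> as a binary operation on points;
  \<open>delta\<close> turns a pair of arrows out of \<open>\<one>\<close> into one arrow out of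
  \<open>\<one>\<close>.\<close>

definition ap :: "'a \<Rightarrow> 'a \<Rightarrow> 'a \<Rightarrow> 'a" where
  "ap m a b = m \<cdot> (a \<odot> b) \<cdot> delta"

lemma tens_pt: "a \<in> pt A \<Longrightarrow> b \<in> pt B \<Longrightarrow> (a \<odot> b) \<cdot> delta \<in> pt (A \<otimes> B)"
  using cmp_hom[OF delta_hom tensA_hom] .

lemma ap_pt: "m \<in> hom V (A \<otimes> B) D \<Longrightarrow> a \<in> pt A \<Longrightarrow> b \<in> pt B \<Longrightarrow> ap m a b \<in> pt D"
  unfolding ap_def using cmp_hom tens_pt by blast

lemma ap_cmp:
  "m \<in> hom V (A \<otimes> B) D \<Longrightarrow> f \<in> hom V D E \<Longrightarrow> a \<in> pt A \<Longrightarrow> b \<in> pt B \<Longrightarrow>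
    ap (f \<cdot> m) a b = f \<cdot> ap m a b"
  unfolding ap_def using cmp_assoc tens_pt by blast

lemma ap_tensA:
  assumes "m \<in> hom V (A' \<otimes> B') D" "f \<in> hom V A A'" "g \<in> hom V B B'" "a \<in> pt A" "b \<in> pt B"
  shows "ap (m \<cdot> (f \<odot> g)) a b = ap m (f \<cdot> a) (g \<cdot> b)"
proof -
  have "ap (m \<cdot> (f \<odot> g)) a b = m \<cdot> ((f \<odot> g) \<cdot> ((a \<odot> b) \<cdot> delta))"
    unfolding ap_def by (rule cmp_assoc[OF tens_pt[OF assms(4,5)] tensA_hom[OF assms(2,3)] assms(1)])
  also have "(f \<odot> g) \<cdot> ((a \<odot> b) \<cdot> delta) = ((f \<odot> g) \<cdot> (a \<odot> b)) \<cdot> delta"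
    by (rule cmp_assoc[OF delta_hom tensA_hom[OF assms(4,5)] tensA_hom[OF assms(2,3)], symmetric])
  also have "(f \<odot> g) \<cdot> (a \<odot> b) = (f \<cdot> a) \<odot> (g \<cdot> b)"
    by (rule tensA_cmp[OF assms(4,2,5,3), symmetric])
  finally show ?thesis unfolding ap_def .
qed

text \<open>Both sides become \<open>b\<close> after composing with the unitor. The inverse unitors
  in \<open>post_comp\<close> and \<open>vnat\<close> are translated into \<open>ap\<close> by this
  rule.\<close>

lemma inv_lunit_pt:
  assumes "b \<in> pt B"
  shows "inv_arr V (LUnit V B) \<cdot> b = (\<iota> \<one> \<odot> b) \<cdot> delta"
proof -
  have B: "B \<in> Obj V" using assms hom_cod_obj by blast
  note l = lunit_iso[OF B] lunit_hom[OF B]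
  note i = inv_arr_hom[OF l] inv_arr_cmp[OF l] cmp_inv_arr[OF l]
  have t: "(\<iota> \<one> \<odot> b) \<cdot> delta \<in> pt (\<one> \<otimes> B)" by (rule tens_pt[OF idt_hom[OF unit_obj] assms])
  have ib: "\<iota> \<one> \<odot> b \<in> hom V (\<one> \<otimes> \<one>) (\<one> \<otimes> B)" by (rule tensA_hom[OF idt_hom[OF unit_obj] assms])
  show ?thesis
  proof (rule iso_cancel_left[OF l cmp_hom[OF assms i(1)] t])
    have "LUnit V B \<cdot> (\<iota> \<one> \<odot> b) \<cdot> delta = (b \<cdot> LUnit V \<one>) \<cdot> delta"
      using cmp_assoc[OF delta_hom ib l(2)] lunit_nat[OF assms] by simp
    also have "\<dots> = b" using cmp_assoc[OF delta_hom lunit_hom[OF unit_obj] assms] lunit_delta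
        cmp_idt[OF assms] by simp
    also have "b = LUnit V B \<cdot> inv_arr V (LUnit V B) \<cdot> b"
      using cmp_assoc[OF assms i(1) l(2)] i(3) idt_cmp[OF assms] by simp
    finally show "LUnit V B \<cdot> inv_arr V (LUnit V B) \<cdot> b = LUnit V B \<cdot> (\<iota> \<one> \<odot> b) \<cdot> delta" by simp
  qed
qed

text \<open>Here \<open>delta\<close> has to invert the right unitor of \<open>\<one>\<close>
  although it is defined from the left one; \<open>lunit_unit_eq_runit_unit\<close> bridges the
  gap.\<close>

lemma inv_runit_pt:
  assumes "b \<in> pt B"
  shows "inv_arr V (RUnit V B) \<cdot> b = (b \<odot> \<iota> \<one>) \<cdot> delta"
proof -
  have B: "B \<in> Obj V" using assms hom_cod_obj by blast
  note l = runit_iso[OF B] runit_hom[OF B]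
  note i = inv_arr_hom[OF l] inv_arr_cmp[OF l] cmp_inv_arr[OF l]
  have t: "(b \<odot> \<iota> \<one>) \<cdot> delta \<in> pt (B \<otimes> \<one>)" by (rule tens_pt[OF assms idt_hom[OF unit_obj]])
  have ib: "b \<odot> \<iota> \<one> \<in> hom V (\<one> \<otimes> \<one>) (B \<otimes> \<one>)" by (rule tensA_hom[OF assms idt_hom[OF unit_obj]])
  show ?thesis
  proof (rule iso_cancel_left[OF l cmp_hom[OF assms i(1)] t])
    have "RUnit V B \<cdot> (b \<odot> \<iota> \<one>) \<cdot> delta = (b \<cdot> LUnit V \<one>) \<cdot> delta"
      using cmp_assoc[OF delta_hom ib l(2)] runit_nat[OF assms] lunit_unit_eq_runit_unit by simp
    also have "\<dots> = b" using cmp_assoc[OF delta_hom lunit_hom[OF unit_obj] assms] lunit_delta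
        cmp_idt[OF assms] by simp
    also have "b = RUnit V B \<cdot> inv_arr V (RUnit V B) \<cdot> b"
      using cmp_assoc[OF assms i(1) l(2)] i(3) idt_cmp[OF assms] by simp
    finally show "RUnit V B \<cdot> inv_arr V (RUnit V B) \<cdot> b = RUnit V B \<cdot> (b \<odot> \<iota> \<one>) \<cdot> delta" by simp
  qed
qed

text \<open>Naturality moves the three points outside the associator. What remains is an identity
  between arrows out of \<open>\<one> \<otimes> \<one>\<close> that involves only the unit.\<close>

lemma ass_pt:
  assumes "a \<in> pt A" "b \<in> pt B" "d \<in> pt D"
  shows "Ass V A B D \<cdot> (((a \<odot> b) \<cdot> delta) \<odot> d) \<cdot> delta = (a \<odot> ((b \<odot> d) \<cdot> delta)) \<cdot> delta"
proof -
  note i1 = idt_hom[OF unit_obj]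
  have o: "A \<in> Obj V" "B \<in> Obj V" "D \<in> Obj V" using assms hom_cod_obj by auto
  have di: "delta \<odot> \<iota> \<one> \<in> hom V (\<one> \<otimes> \<one>) ((\<one> \<otimes> \<one>) \<otimes> \<one>)" by (rule tensA_hom[OF delta_hom i1])
  have id: "\<iota> \<one> \<odot> delta \<in> hom V (\<one> \<otimes> \<one>) (\<one> \<otimes> (\<one> \<otimes> \<one>))" by (rule tensA_hom[OF i1 delta_hom])
  have a1: "Ass V \<one> \<one> \<one> \<in> hom V ((\<one> \<otimes> \<one>) \<otimes> \<one>) (\<one> \<otimes> (\<one> \<otimes> \<one>))" using ass_hom unit_obj by blast
  have aA: "Ass V A B D \<in> hom V ((A \<otimes> B) \<otimes> D) (A \<otimes> (B \<otimes> D))" using ass_hom o by blast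
  have il: "\<iota> \<one> \<odot> LUnit V \<one> \<in> hom V (\<one> \<otimes> (\<one> \<otimes> \<one>)) (\<one> \<otimes> \<one>)"
    by (rule tensA_hom[OF i1 lunit_hom[OF unit_obj]])
  have t1: "(a \<odot> b) \<odot> d \<in> hom V ((\<one> \<otimes> \<one>) \<otimes> \<one>) ((A \<otimes> B) \<otimes> D)"
    using assms tensA_hom by blast
  have t2: "a \<odot> (b \<odot> d) \<in> hom V (\<one> \<otimes> (\<one> \<otimes> \<one>)) (A \<otimes> (B \<otimes> D))"
    using assms tensA_hom by blast
  \<comment> \<open>The triangle at the unit expresses the associator by unitors: it is
    \<open>LUnit V \<one> \<odot> \<iota> \<one>\<close> followed by
    \<open>\<iota> \<one> \<odot> delta\<close>, and the first factor cancels against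
    \<open>delta \<odot> \<iota> \<one>\<close>.\<close>
  have key: "Ass V \<one> \<one> \<one> \<cdot> (delta \<odot> \<iota> \<one>) = \<iota> \<one> \<odot> delta"
  proof -
    have "(\<iota> \<one> \<odot> delta) \<cdot> (\<iota> \<one> \<odot> LUnit V \<one>) = \<iota> (\<one> \<otimes> (\<one> \<otimes> \<one>))"
      using tensA_cmp[OF i1 i1 lunit_hom[OF unit_obj] delta_hom] idt_cmp[OF i1] delta_lunit
        tensA_idt unit_obj tens_obj by simp
    then have "Ass V \<one> \<one> \<one> = ((\<iota> \<one> \<odot> delta) \<cdot> (\<iota> \<one> \<odot> LUnit V \<one>)) \<cdot> Ass V \<one> \<one> \<one>"
      using idt_cmp[OF a1] by simp
    also have "\<dots> = (\<iota> \<one> \<odot> delta) \<cdot> (LUnit V \<one> \<odot> \<iota> \<one>)"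
      using cmp_assoc[OF a1 il id] triangle[OF unit_obj unit_obj] lunit_unit_eq_runit_unit by simp
    finally have 1: "Ass V \<one> \<one> \<one> = (\<iota> \<one> \<odot> delta) \<cdot> (LUnit V \<one> \<odot> \<iota> \<one>)" .
    have "(LUnit V \<one> \<odot> \<iota> \<one>) \<cdot> (delta \<odot> \<iota> \<one>) = \<iota> (\<one> \<otimes> \<one>)"
      using tensA_cmp[OF delta_hom lunit_hom[OF unit_obj] i1 i1] idt_cmp[OF i1] lunit_delta
        tensA_idt unit_obj by simp
    then show ?thesis
      unfolding 1 using cmp_assoc[OF di tensA_hom[OF lunit_hom[OF unit_obj] i1] id] cmp_idt[OF id]
      by simp
  qed
  have l: "((a \<odot> b) \<cdot> delta) \<odot> d = ((a \<odot> b) \<odot> d) \<cdot> (delta \<odot> \<iota> \<one>)"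
    using tensA_cmp[OF delta_hom tensA_hom[OF assms(1,2)] i1 assms(3)] cmp_idt[OF assms(3)] by simp
  have r: "a \<odot> ((b \<odot> d) \<cdot> delta) = (a \<odot> (b \<odot> d)) \<cdot> (\<iota> \<one> \<odot> delta)"
    using tensA_cmp[OF i1 assms(1) delta_hom tensA_hom[OF assms(2,3)]] cmp_idt[OF assms(1)] by simp
  have "Ass V A B D \<cdot> (((a \<odot> b) \<cdot> delta) \<odot> d)
      = (Ass V A B D \<cdot> ((a \<odot> b) \<odot> d)) \<cdot> (delta \<odot> \<iota> \<one>)"
    unfolding l by (rule cmp_assoc[OF di t1 aA, symmetric])
  also have "\<dots> = ((a \<odot> (b \<odot> d)) \<cdot> Ass V \<one> \<one> \<one>) \<cdot> (delta \<odot> \<iota> \<one>)"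
    using ass_nat[OF assms] by simp
  also have "\<dots> = a \<odot> ((b \<odot> d) \<cdot> delta)"
    unfolding r using cmp_assoc[OF di a1 t2] key by simp
  finally have "Ass V A B D \<cdot> (((a \<odot> b) \<cdot> delta) \<odot> d) = a \<odot> ((b \<odot> d) \<cdot> delta)" .
  then show ?thesis
    using cmp_assoc[OF delta_hom cmp_hom[OF di t1] aA] l by simp
qed

end

section \<open>Currying, and colimits under the tensor product\<close>

context closed_symmetric_monoidal_category begin

lemma
  assumes "T \<in> Obj V" "A \<in> Obj V" "B \<in> Obj V" "f \<in> hom V (T \<otimes> A) B"
  shows curry_arr_hom: "curry_arr V T A B f \<in> hom V T (IHom V A B)"
    and ev_curry_arr: "Ev V A B \<cdot> (curry_arr V T A B f \<odot> \<iota> A) = f"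
  using theI'[OF ev_univ[OF assms]] unfolding curry_arr_def by auto

lemma curry_arr_unique:
  assumes A: "A \<in> Obj V" and B: "B \<in> Obj V"
    and "g \<in> hom V T (IHom V A B)" "g' \<in> hom V T (IHom V A B)"
    and "Ev V A B \<cdot> (g \<odot> \<iota> A) = Ev V A B \<cdot> (g' \<odot> \<iota> A)"
  shows "g = g'"
proof -
  have T: "T \<in> Obj V" using assms hom_dom_obj by blast
  have "Ev V A B \<cdot> (g' \<odot> \<iota> A) \<in> hom V (T \<otimes> A) B"
    using cmp_hom[OF tensA_hom[OF assms(4) idt_hom[OF A]] ev_hom[OF A B]] .
  from ev_univ[OF T A B this] assms(3-5) show ?thesis by blast
qed

lemma uncurry_cmp:
  assumes "A \<in> Obj V" "B \<in> Obj V" "f \<in> hom V S T" "g \<in> hom V T (IHom V A B)"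
  shows "Ev V A B \<cdot> ((g \<cdot> f) \<odot> \<iota> A) = (Ev V A B \<cdot> (g \<odot> \<iota> A)) \<cdot> (f \<odot> \<iota> A)"
proof -
  note iA = idt_hom[OF assms(1)]
  have "(g \<cdot> f) \<odot> \<iota> A = (g \<odot> \<iota> A) \<cdot> (f \<odot> \<iota> A)"
    using tensA_cmp[OF assms(3,4) iA iA] idt_cmp[OF iA] by simp
  then show ?thesis
    using cmp_assoc[OF tensA_hom[OF assms(3) iA] tensA_hom[OF assms(4) iA] ev_hom[OF assms(1,2)]]
    by simp
qed

text \<open>Tensoring with \<open>B\<close> is left adjoint to the internal hom out of
  \<open>B\<close>: the cocone is transposed, factored through the colimit, and transposed back.
  Unique existence is the form that the definite descriptions defining the ind-category call
  for.\<close>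

lemma colimit_tens:
  assumes D: "is_functor J V D" and L: "is_colimit J V D L p" and B: "B \<in> Obj V" and T: "T \<in> Obj V"
    and J: "category J"
    and q: "\<And>j. j \<in> Obj J \<Longrightarrow> q j \<in> hom V (FO D j \<otimes> B) T"
    and qc: "\<And>f. f \<in> Arr J \<Longrightarrow> q (Cod J f) \<cdot> (FA D f \<odot> \<iota> B) = q (Dom J f)"
  shows "\<exists>!h. h \<in> hom V (L \<otimes> B) T \<and> (\<forall>j \<in> Obj J. h \<cdot> (p j \<odot> \<iota> B) = q j)"
proof -
  interpret J: category J by (rule J)
  note iB = idt_hom[OF B]
  have Lo: "L \<in> Obj V" and p: "\<And>j. j \<in> Obj J \<Longrightarrow> p j \<in> hom V (FO D j) L"
    using L by (auto simp: is_colimit_def is_cocone_def)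
  have Do: "\<And>j. j \<in> Obj J \<Longrightarrow> FO D j \<in> Obj V"
    and Da: "\<And>f. f \<in> Arr J \<Longrightarrow> FA D f \<in> hom V (FO D (Dom J f)) (FO D (Cod J f))"
    using D by (auto simp: is_functor_def)
  define g where "g j = curry_arr V (FO D j) B T (q j)" for j
  have g: "g j \<in> hom V (FO D j) (IHom V B T)" "Ev V B T \<cdot> (g j \<odot> \<iota> B) = q j" if "j \<in> Obj J" for j
    unfolding g_def using curry_arr_hom[OF Do[OF that] B T q[OF that]]
      ev_curry_arr[OF Do[OF that] B T q[OF that]] by simp_all
  have "is_cocone J V D (IHom V B T) g"
    unfolding is_cocone_def
  proof (intro conjI ballI)
    show "IHom V B T \<in> Obj V" using ihom_obj B T by blast
    show "g j \<in> hom V (FO D j) (IHom V B T)" if "j \<in> Obj J" for j using g that by blast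
    fix f assume f: "f \<in> Arr J"
    note d = J.dom_obj[OF f] and c = J.cod_obj[OF f]
    show "g (Cod J f) \<cdot> FA D f = g (Dom J f)"
      by (rule curry_arr_unique[OF B T cmp_hom[OF Da[OF f] g(1)[OF c]] g(1)[OF d]])
         (simp add: uncurry_cmp[OF B T Da[OF f] g(1)[OF c]] g d c qc f)
  qed
  then have ex: "\<exists>!k. k \<in> hom V L (IHom V B T) \<and> (\<forall>j \<in> Obj J. k \<cdot> p j = g j)"
    using L by (auto simp: is_colimit_def)
  then obtain k where k: "k \<in> hom V L (IHom V B T)" "\<And>j. j \<in> Obj J \<Longrightarrow> k \<cdot> p j = g j" by blast
  show ?thesis
  proof (rule ex1I[where a="Ev V B T \<cdot> (k \<odot> \<iota> B)"], intro conjI ballI)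
    show "Ev V B T \<cdot> (k \<odot> \<iota> B) \<in> hom V (L \<otimes> B) T"
      using cmp_hom[OF tensA_hom[OF k(1) iB] ev_hom[OF B T]] .
    show "(Ev V B T \<cdot> (k \<odot> \<iota> B)) \<cdot> (p j \<odot> \<iota> B) = q j" if "j \<in> Obj J" for j
      using uncurry_cmp[OF B T p[OF that] k(1)] k(2)[OF that] g(2)[OF that] by simp
  next
    fix h assume h: "h \<in> hom V (L \<otimes> B) T \<and> (\<forall>j \<in> Obj J. h \<cdot> (p j \<odot> \<iota> B) = q j)"
    let ?k = "curry_arr V L B T h"
    have k': "?k \<in> hom V L (IHom V B T)" "Ev V B T \<cdot> (?k \<odot> \<iota> B) = h"
      using curry_arr_hom ev_curry_arr Lo B T h by blast+
    have "?k \<cdot> p j = g j" if j: "j \<in> Obj J" for j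
      by (rule curry_arr_unique[OF B T cmp_hom[OF p[OF j] k'(1)] g(1)[OF j]])
         (simp add: uncurry_cmp[OF B T p[OF j] k'(1)] k'(2) g(2)[OF j] h j)
    then have "?k = k" using ex k k'(1) by blast
    then show "h = Ev V B T \<cdot> (k \<odot> \<iota> B)" using k'(2) by simp
  qed
qed

text \<open>The symmetry carries the problem to the other variable, and naturality of
  \<open>Sym\<close> carries the cocone and its factorisation along.\<close>

lemma colimit_tens':
  assumes D: "is_functor J V D" and L: "is_colimit J V D L p" and B: "B \<in> Obj V" and T: "T \<in> Obj V"
    and J: "category J"
    and q: "\<And>j. j \<in> Obj J \<Longrightarrow> q j \<in> hom V (B \<otimes> FO D j) T"
    and qc: "\<And>f. f \<in> Arr J \<Longrightarrow> q (Cod J f) \<cdot> (\<iota> B \<odot> FA D f) = q (Dom J f)"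
  shows "\<exists>!h. h \<in> hom V (B \<otimes> L) T \<and> (\<forall>j \<in> Obj J. h \<cdot> (\<iota> B \<odot> p j) = q j)"
proof -
  interpret J: category J by (rule J)
  note iB = idt_hom[OF B]
  have Lo: "L \<in> Obj V" and p: "\<And>j. j \<in> Obj J \<Longrightarrow> p j \<in> hom V (FO D j) L"
    using L by (auto simp: is_colimit_def is_cocone_def)
  have Do: "\<And>j. j \<in> Obj J \<Longrightarrow> FO D j \<in> Obj V"
    and Da: "\<And>f. f \<in> Arr J \<Longrightarrow> FA D f \<in> hom V (FO D (Dom J f)) (FO D (Cod J f))"
    using D by (auto simp: is_functor_def)
  have S: "Sym V X B \<in> hom V (X \<otimes> B) (B \<otimes> X)" "Sym V B X \<in> hom V (B \<otimes> X) (X \<otimes> B)"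
    "Sym V X B \<cdot> Sym V B X = \<iota> (B \<otimes> X)" "Sym V B X \<cdot> Sym V X B = \<iota> (X \<otimes> B)"
    if "X \<in> Obj V" for X
    using that B sym_hom sym_sym by auto
  have "\<exists>!h. h \<in> hom V (L \<otimes> B) T \<and> (\<forall>j \<in> Obj J. h \<cdot> (p j \<odot> \<iota> B) = q j \<cdot> Sym V (FO D j) B)"
  proof (rule colimit_tens[OF D L B T J])
    show "q j \<cdot> Sym V (FO D j) B \<in> hom V (FO D j \<otimes> B) T" if "j \<in> Obj J" for j
      using cmp_hom[OF S(1) q] that Do by blast
    fix f assume f: "f \<in> Arr J"
    note d = J.dom_obj[OF f] and c = J.cod_obj[OF f]
    let ?q = "q (Cod J f)"
    have "(?q \<cdot> Sym V (FO D (Cod J f)) B) \<cdot> (FA D f \<odot> \<iota> B)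
        = ?q \<cdot> ((\<iota> B \<odot> FA D f) \<cdot> Sym V (FO D (Dom J f)) B)"
      using cmp_assoc[OF tensA_hom[OF Da[OF f] iB] S(1)[OF Do[OF c]] q[OF c]] sym_nat[OF Da[OF f] iB]
      by simp
    also have "\<dots> = (?q \<cdot> (\<iota> B \<odot> FA D f)) \<cdot> Sym V (FO D (Dom J f)) B"
      by (rule cmp_assoc[OF S(1)[OF Do[OF d]] tensA_hom[OF iB Da[OF f]] q[OF c], symmetric])
    finally show "(?q \<cdot> Sym V (FO D (Cod J f)) B) \<cdot> (FA D f \<odot> \<iota> B)
        = q (Dom J f) \<cdot> Sym V (FO D (Dom J f)) B" using qc[OF f] by simp
  qed
  then obtain h where h: "h \<in> hom V (L \<otimes> B) T"
      "\<And>j. j \<in> Obj J \<Longrightarrow> h \<cdot> (p j \<odot> \<iota> B) = q j \<cdot> Sym V (FO D j) B"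
    and u: "\<And>h'. h' \<in> hom V (L \<otimes> B) T \<Longrightarrow>
       (\<And>j. j \<in> Obj J \<Longrightarrow> h' \<cdot> (p j \<odot> \<iota> B) = q j \<cdot> Sym V (FO D j) B) \<Longrightarrow> h' = h"
    by (elim ex1E) blast
  show ?thesis
  proof (rule ex1I[where a="h \<cdot> Sym V B L"], intro conjI ballI)
    show "h \<cdot> Sym V B L \<in> hom V (B \<otimes> L) T" using cmp_hom[OF S(2)[OF Lo] h(1)] .
    fix j assume j: "j \<in> Obj J"
    have "(h \<cdot> Sym V B L) \<cdot> (\<iota> B \<odot> p j) = h \<cdot> ((p j \<odot> \<iota> B) \<cdot> Sym V B (FO D j))"
      using cmp_assoc[OF tensA_hom[OF iB p[OF j]] S(2)[OF Lo] h(1)] sym_nat[OF iB p[OF j]] by simp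
    also have "\<dots> = (h \<cdot> (p j \<odot> \<iota> B)) \<cdot> Sym V B (FO D j)"
      by (rule cmp_assoc[OF S(2)[OF Do[OF j]] tensA_hom[OF p[OF j] iB] h(1), symmetric])
    also have "\<dots> = q j \<cdot> (Sym V (FO D j) B \<cdot> Sym V B (FO D j))"
      using h(2)[OF j] cmp_assoc[OF S(2)[OF Do[OF j]] S(1)[OF Do[OF j]] q[OF j]] by simp
    also have "\<dots> = q j" using S(3)[OF Do[OF j]] cmp_idt[OF q[OF j]] by simp
    finally show "(h \<cdot> Sym V B L) \<cdot> (\<iota> B \<odot> p j) = q j" .
  next
    fix h' assume h': "h' \<in> hom V (B \<otimes> L) T \<and> (\<forall>j \<in> Obj J. h' \<cdot> (\<iota> B \<odot> p j) = q j)"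
    then have h1: "h' \<in> hom V (B \<otimes> L) T" by blast
    have "h' \<cdot> Sym V L B = h"
    proof (rule u)
      show "h' \<cdot> Sym V L B \<in> hom V (L \<otimes> B) T" using cmp_hom[OF S(1)[OF Lo]] h' by blast
      fix j assume j: "j \<in> Obj J"
      have "(h' \<cdot> Sym V L B) \<cdot> (p j \<odot> \<iota> B) = h' \<cdot> ((\<iota> B \<odot> p j) \<cdot> Sym V (FO D j) B)"
        using cmp_assoc[OF tensA_hom[OF p[OF j] iB] S(1)[OF Lo] h1] sym_nat[OF p[OF j] iB] by simp
      also have "\<dots> = (h' \<cdot> (\<iota> B \<odot> p j)) \<cdot> Sym V (FO D j) B"
        using cmp_assoc[OF S(1)[OF Do[OF j]] tensA_hom[OF iB p[OF j]] h1] by simp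
      finally show "(h' \<cdot> Sym V L B) \<cdot> (p j \<odot> \<iota> B) = q j \<cdot> Sym V (FO D j) B" using h' j by simp
    qed
    then show "h' = h \<cdot> Sym V B L"
      using cmp_assoc[OF S(2)[OF Lo] S(1)[OF Lo] h1] S(3)[OF Lo] cmp_idt[OF h1] by simp
  qed
qed

end


section \<open>Extensionality on points\<close>

locale concrete_base = closed_symmetric_monoidal_category V
  for V :: "('o, 'a) smc" (structure) +
  assumes conc: "concrete V"
begin

lemma pt_ext:
  assumes f: "f \<in> hom V A B" and g: "g \<in> hom V A B" and eq: "\<And>a. a \<in> pt A \<Longrightarrow> f \<cdot> a = g \<cdot> a"
  shows "f = g"
proof -
  have "A \<in> Obj V" "B \<in> Obj V" using f hom_dom_obj hom_cod_obj by auto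
  then have "inj_on (FA (hom_functor V \<one>)) (hom V A B)"
    using conc by (auto simp: concrete_def faithful_def)
  moreover have "FA (hom_functor V \<one>) f = FA (hom_functor V \<one>) g"
    using f g eq by (auto simp: hom_functor_def hom_dom hom_cod intro!: restrict_ext)
  ultimately show ?thesis using f g by (auto dest: inj_onD)
qed

lemma cmp_pt: "f \<in> hom V A B \<Longrightarrow> a \<in> pt A \<Longrightarrow> f \<cdot> a \<in> pt B"
  using cmp_hom by blast

text \<open>Since points of \<open>A \<otimes> B\<close> need not be pairs, \<open>pt_ext\<close> is
  used twice: on the transposes out of \<open>A\<close>, and then, for each point \<open>a\<close>,
  on the arrow out of \<open>B\<close> that the transpose names there.\<close>

lemma tens_pt_ext:
  assumes m: "m \<in> hom V (A \<otimes> B) D" and m': "m' \<in> hom V (A \<otimes> B) D"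
    and A: "A \<in> Obj V" and B: "B \<in> Obj V"
    and eq: "\<And>a b. a \<in> pt A \<Longrightarrow> b \<in> pt B \<Longrightarrow> ap m a b = ap m' a b"
  shows "m = m'"
proof -
  have D: "D \<in> Obj V" using m hom_cod_obj by auto
  note iB = idt_hom[OF B]
  let ?g = "curry_arr V A B D m" and ?g' = "curry_arr V A B D m'"
  have g: "?g \<in> hom V A (IHom V B D)" "Ev V B D \<cdot> (?g \<odot> \<iota> B) = m"
    and g': "?g' \<in> hom V A (IHom V B D)" "Ev V B D \<cdot> (?g' \<odot> \<iota> B) = m'"
    using curry_arr_hom ev_curry_arr A B D m m' by blast+
  have "?g = ?g'"
  proof (rule pt_ext[OF g(1) g'(1)])
    fix a assume a: "a \<in> pt A"
    show "?g \<cdot> a = ?g' \<cdot> a"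
    proof (rule curry_arr_unique[OF B D])
      show "?g \<cdot> a \<in> pt (IHom V B D)" "?g' \<cdot> a \<in> pt (IHom V B D)" using a g g' cmp_pt by auto
      note l = lunit_iso[OF B] lunit_hom[OF B]
      have ai: "a \<odot> \<iota> B \<in> hom V (\<one> \<otimes> B) (A \<otimes> B)" by (rule tensA_hom[OF a iB])
      have li: "inv_arr V (LUnit V B) \<in> hom V B (\<one> \<otimes> B)" by (rule inv_arr_hom[OF l])
      \<comment> \<open>The inverse unitor turns an arrow out of \<open>\<one> \<otimes> B\<close>
        into one out of \<open>B\<close>, to which \<open>pt_ext\<close> applies.\<close>
      have pw: "((n \<cdot> (a \<odot> \<iota> B)) \<cdot> inv_arr V (LUnit V B)) \<cdot> b = ap n a b"
        if n: "n \<in> hom V (A \<otimes> B) D" and b: "b \<in> pt B" for n b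
      proof -
        have "((n \<cdot> (a \<odot> \<iota> B)) \<cdot> inv_arr V (LUnit V B)) \<cdot> b
            = (n \<cdot> (a \<odot> \<iota> B)) \<cdot> (\<iota> \<one> \<odot> b) \<cdot> delta"
          using cmp_assoc[OF b li cmp_hom[OF ai n]] inv_lunit_pt[OF b] by simp
        also have "\<dots> = ap (n \<cdot> (a \<odot> \<iota> B)) (\<iota> \<one>) b" by (simp add: ap_def)
        also have "\<dots> = ap n a b"
          using ap_tensA[OF n a iB idt_hom[OF unit_obj] b] cmp_idt[OF a] idt_cmp[OF b] by simp
        finally show ?thesis .
      qed
      have "(m \<cdot> (a \<odot> \<iota> B)) \<cdot> inv_arr V (LUnit V B) = (m' \<cdot> (a \<odot> \<iota> B)) \<cdot> inv_arr V (LUnit V B)"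
        by (rule pt_ext[OF cmp_hom[OF li cmp_hom[OF ai m]] cmp_hom[OF li cmp_hom[OF ai m']]])
           (simp add: pw m m' eq a)
      moreover have "iso_arr V (inv_arr V (LUnit V B))"
        by (rule iso_arrI[OF li l(2) cmp_inv_arr[OF l] inv_arr_cmp[OF l]])
      ultimately have "m \<cdot> (a \<odot> \<iota> B) = m' \<cdot> (a \<odot> \<iota> B)"
        using iso_cancel_right[OF _ li cmp_hom[OF ai m] cmp_hom[OF ai m']] by blast
      then show "Ev V B D \<cdot> ((?g \<cdot> a) \<odot> \<iota> B) = Ev V B D \<cdot> ((?g' \<cdot> a) \<odot> \<iota> B)"
        using uncurry_cmp[OF B D a g(1)] uncurry_cmp[OF B D a g'(1)] g(2) g'(2) by simp
    qed
  qed
  then have "Ev V B D \<cdot> (?g \<odot> \<iota> B) = Ev V B D \<cdot> (?g' \<odot> \<iota> B)" by (rule arg_cong)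
  then show ?thesis unfolding g(2) g'(2) .
qed

lemma ap_ev_curry:
  assumes "A \<in> Obj V" "B \<in> Obj V" "m \<in> hom V (A \<otimes> B) D" "a \<in> pt A" "b \<in> pt B"
  shows "ap (Ev V B D) (curry_arr V A B D m \<cdot> a) b = ap m a b"
proof -
  have D: "D \<in> Obj V" using assms hom_cod_obj by auto
  note c = curry_arr_hom[OF assms(1,2) D assms(3)] ev_curry_arr[OF assms(1,2) D assms(3)]
  show ?thesis
    using ap_tensA[OF ev_hom[OF assms(2) D] c(1) idt_hom[OF assms(2)] assms(4,5)] c(2)
      idt_cmp[OF assms(5)] by simp
qed

text \<open>A point of the internal hom is an arrow out of \<open>\<one> \<otimes> B\<close>, hence
  up to the unitor an arrow out of \<open>B\<close>, and concreteness applies to that.\<close>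

lemma ihom_pt_ext:
  assumes B: "B \<in> Obj V" and D: "D \<in> Obj V"
    and s: "s \<in> pt (IHom V B D)" and t: "t \<in> pt (IHom V B D)"
    and eq: "\<And>b. b \<in> pt B \<Longrightarrow> ap (Ev V B D) s b = ap (Ev V B D) t b"
  shows "s = t"
proof (rule curry_arr_unique[OF B D s t])
  note iB = idt_hom[OF B]
  have h: "Ev V B D \<cdot> (r \<odot> \<iota> B) \<in> hom V (\<one> \<otimes> B) D" if "r \<in> pt (IHom V B D)" for r
    using cmp_hom[OF tensA_hom[OF that iB] ev_hom[OF B D]] .
  note l = lunit_iso[OF B] lunit_hom[OF B]
  show "Ev V B D \<cdot> (s \<odot> \<iota> B) = Ev V B D \<cdot> (t \<odot> \<iota> B)"
  proof (rule iso_cancel_right[of "inv_arr V (LUnit V B)"])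
    show li: "inv_arr V (LUnit V B) \<in> hom V B (\<one> \<otimes> B)" by (rule inv_arr_hom[OF l])
    show "iso_arr V (inv_arr V (LUnit V B))"
      by (rule iso_arrI[OF li l(2) cmp_inv_arr[OF l] inv_arr_cmp[OF l]])
    show "Ev V B D \<cdot> (s \<odot> \<iota> B) \<in> hom V (\<one> \<otimes> B) D" "Ev V B D \<cdot> (t \<odot> \<iota> B) \<in> hom V (\<one> \<otimes> B) D"
      using h s t by auto
    have pw: "((Ev V B D \<cdot> (r \<odot> \<iota> B)) \<cdot> inv_arr V (LUnit V B)) \<cdot> b = ap (Ev V B D) r b"
      if r: "r \<in> pt (IHom V B D)" and b: "b \<in> pt B" for r b
    proof -
      have "((Ev V B D \<cdot> (r \<odot> \<iota> B)) \<cdot> inv_arr V (LUnit V B)) \<cdot> b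
          = ap (Ev V B D \<cdot> (r \<odot> \<iota> B)) (\<iota> \<one>) b"
        using cmp_assoc[OF b li h[OF r]] inv_lunit_pt[OF b] by (simp add: ap_def)
      then show ?thesis
        using ap_tensA[OF ev_hom[OF B D] r iB idt_hom[OF unit_obj] b] cmp_idt[OF r] idt_cmp[OF b]
        by simp
    qed
    show "(Ev V B D \<cdot> (s \<odot> \<iota> B)) \<cdot> inv_arr V (LUnit V B) = (Ev V B D \<cdot> (t \<odot> \<iota> B)) \<cdot> inv_arr V (LUnit V B)"
      by (rule pt_ext[OF cmp_hom[OF li h[OF s]] cmp_hom[OF li h[OF t]]]) (simp add: pw s t eq)
  qed
qed

text \<open>Currying the last variable leaves an arrow out of \<open>A \<otimes> B\<close> into an
  internal hom, so the two-variable test and \<open>ihom_pt_ext\<close> combine. It serves the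
  associativity axiom.\<close>

lemma tens3_pt_ext:
  assumes m: "m \<in> hom V ((A \<otimes> B) \<otimes> D) E" and m': "m' \<in> hom V ((A \<otimes> B) \<otimes> D) E"
    and A: "A \<in> Obj V" and B: "B \<in> Obj V" and D: "D \<in> Obj V"
    and eq: "\<And>a b d. a \<in> pt A \<Longrightarrow> b \<in> pt B \<Longrightarrow> d \<in> pt D \<Longrightarrow>
       ap m ((a \<odot> b) \<cdot> delta) d = ap m' ((a \<odot> b) \<cdot> delta) d"
  shows "m = m'"
proof -
  have E: "E \<in> Obj V" using m hom_cod_obj by auto
  have AB: "A \<otimes> B \<in> Obj V" using A B tens_obj by blast
  let ?g = "curry_arr V (A \<otimes> B) D E m" and ?g' = "curry_arr V (A \<otimes> B) D E m'"
  have g: "?g \<in> hom V (A \<otimes> B) (IHom V D E)" "Ev V D E \<cdot> (?g \<odot> \<iota> D) = m"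
    and g': "?g' \<in> hom V (A \<otimes> B) (IHom V D E)" "Ev V D E \<cdot> (?g' \<odot> \<iota> D) = m'"
    using curry_arr_hom ev_curry_arr AB D E m m' by blast+
  have "?g = ?g'"
  proof (rule tens_pt_ext[OF g(1) g'(1) A B])
    fix a b assume a: "a \<in> pt A" and b: "b \<in> pt B"
    note t = tens_pt[OF a b]
    have "?g \<cdot> (a \<odot> b) \<cdot> delta = ?g' \<cdot> (a \<odot> b) \<cdot> delta"
      by (rule ihom_pt_ext[OF D E cmp_pt[OF g(1) t] cmp_pt[OF g'(1) t]])
         (simp add: ap_ev_curry[OF AB D _ t] m m' eq a b)
    then show "ap ?g a b = ap ?g' a b" by (simp add: ap_def)
  qed
  then have "Ev V D E \<cdot> (?g \<odot> \<iota> D) = Ev V D E \<cdot> (?g' \<odot> \<iota> D)" by (rule arg_cong)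
  then show ?thesis unfolding g(2) g'(2) .
qed

section \<open>Enriched categories, functors and transformations computed on points\<close>

definition cc :: "('c, 'o, 'a) vcat \<Rightarrow> 'c \<Rightarrow> 'c \<Rightarrow> 'c \<Rightarrow> 'a \<Rightarrow> 'a \<Rightarrow> 'a" where
  "cc C x y z g f = ap (VComp C x y z) g f"

abbreviation cpt :: "('c, 'o, 'a) vcat \<Rightarrow> 'c \<Rightarrow> 'c \<Rightarrow> 'a set" where
  "cpt C x y \<equiv> pt (VHom C x y)"

lemma
  assumes "vcategory V C"
  shows vhom_obj: "x \<in> VObj C \<Longrightarrow> y \<in> VObj C \<Longrightarrow> VHom C x y \<in> Obj V"
    and vid_pt: "x \<in> VObj C \<Longrightarrow> VId C x \<in> cpt C x x"
    and vcomp_hom: "x \<in> VObj C \<Longrightarrow> y \<in> VObj C \<Longrightarrow> z \<in> VObj C \<Longrightarrow>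
      VComp C x y z \<in> hom V (VHom C y z \<otimes> VHom C x y) (VHom C x z)"
  using assms by (auto simp: vcategory_def)

lemma cc_pt:
  assumes "vcategory V C" "x \<in> VObj C" "y \<in> VObj C" "z \<in> VObj C" "g \<in> cpt C y z" "f \<in> cpt C x y"
  shows "cc C x y z g f \<in> cpt C x z"
  unfolding cc_def using ap_pt[OF vcomp_hom[OF assms(1-4)] assms(5,6)] .

lemma ap_assoc_left:
  assumes "m \<in> hom V (E \<otimes> D) F" "n \<in> hom V (A \<otimes> B) E"
    "a \<in> pt A" "b \<in> pt B" "d \<in> pt D"
  shows "ap (m \<cdot> (n \<odot> \<iota> D)) ((a \<odot> b) \<cdot> delta) d = ap m (ap n a b) d"
proof -
  have D: "D \<in> Obj V" using assms hom_cod_obj by auto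
  show ?thesis
    using ap_tensA[OF assms(1,2) idt_hom[OF D] tens_pt[OF assms(3,4)] assms(5)] idt_cmp[OF assms(5)]
    by (simp add: ap_def)
qed

text \<open>With \<open>ap_assoc_left\<close> this evaluates both bracketings of a triple composite
  at the same point of \<open>(A \<otimes> B) \<otimes> D\<close>, so the associator disappears from
  associativity.\<close>

lemma ap_assoc_right:
  assumes m: "m \<in> hom V (A \<otimes> E) F" and n: "n \<in> hom V (B \<otimes> D) E"
    and p: "a \<in> pt A" "b \<in> pt B" "d \<in> pt D"
  shows "ap (m \<cdot> (\<iota> A \<odot> n) \<cdot> Ass V A B D) ((a \<odot> b) \<cdot> delta) d = ap m a (ap n b d)"
proof -
  have o: "A \<in> Obj V" "B \<in> Obj V" "D \<in> Obj V" using p hom_cod_obj by auto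
  have t: "\<iota> A \<odot> n \<in> hom V (A \<otimes> (B \<otimes> D)) (A \<otimes> E)" by (rule tensA_hom[OF idt_hom[OF o(1)] n])
  have a: "Ass V A B D \<in> hom V ((A \<otimes> B) \<otimes> D) (A \<otimes> (B \<otimes> D))" using ass_hom o by blast
  have t2: "(((a \<odot> b) \<cdot> delta) \<odot> d) \<cdot> delta \<in> pt ((A \<otimes> B) \<otimes> D)"
    by (rule tens_pt[OF tens_pt[OF p(1,2)] p(3)])
  have "ap (m \<cdot> (\<iota> A \<odot> n) \<cdot> Ass V A B D) ((a \<odot> b) \<cdot> delta) d
      = m \<cdot> ((\<iota> A \<odot> n) \<cdot> Ass V A B D) \<cdot> (((a \<odot> b) \<cdot> delta) \<odot> d) \<cdot> delta"
    unfolding ap_def using cmp_assoc[OF t2 cmp_hom[OF a t] m] .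
  also have "\<dots> = m \<cdot> (\<iota> A \<odot> n) \<cdot> (a \<odot> ((b \<odot> d) \<cdot> delta)) \<cdot> delta"
    using cmp_assoc[OF t2 a t] ass_pt[OF p] by simp
  also have "\<dots> = (m \<cdot> (\<iota> A \<odot> n)) \<cdot> (a \<odot> ((b \<odot> d) \<cdot> delta)) \<cdot> delta"
    by (rule cmp_assoc[OF tens_pt[OF p(1) tens_pt[OF p(2,3)]] t m, symmetric])
  also have "\<dots> = ap (m \<cdot> (\<iota> A \<odot> n)) a ((b \<odot> d) \<cdot> delta)" by (simp add: ap_def)
  also have "\<dots> = ap m a (ap n b d)"
    using ap_tensA[OF m idt_hom[OF o(1)] n p(1) tens_pt[OF p(2,3)]] idt_cmp[OF p(1)]
    by (simp add: ap_def)
  finally show ?thesis .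
qed

lemma cc_assoc:
  assumes C: "vcategory V C" and o: "w \<in> VObj C" "x \<in> VObj C" "y \<in> VObj C" "z \<in> VObj C"
    and p: "h \<in> cpt C y z" "g \<in> cpt C x y" "f \<in> cpt C w x"
  shows "cc C w x z (cc C x y z h g) f = cc C w y z h (cc C w x y g f)"
proof -
  note vc = vcomp_hom[OF C]
  have ax: "VComp C w x z \<cdot> (VComp C x y z \<odot> \<iota> (VHom C w x)) =
          VComp C w y z \<cdot> (\<iota> (VHom C y z) \<odot> VComp C w x y)
            \<cdot> Ass V (VHom C y z) (VHom C x y) (VHom C w x)"
    using C o by (simp add: vcategory_def)
  show ?thesis
    unfolding cc_def
    using ap_assoc_left[OF vc[OF o(1,2,4)] vc[OF o(2-4)] p]
      ap_assoc_right[OF vc[OF o(1,3,4)] vc[OF o(1-3)] p] ax by simp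
qed

lemma ap_unit_left:
  assumes m: "m \<in> hom V (A \<otimes> B) D" and e: "e \<in> pt A" and b: "b \<in> pt B"
  shows "(m \<cdot> (e \<odot> \<iota> B) \<cdot> inv_arr V (LUnit V B)) \<cdot> b = ap m e b"
proof -
  have B: "B \<in> Obj V" using b hom_cod_obj by auto
  note l = inv_arr_hom[OF lunit_iso[OF B] lunit_hom[OF B]]
  have t: "e \<odot> \<iota> B \<in> hom V (\<one> \<otimes> B) (A \<otimes> B)" by (rule tensA_hom[OF e idt_hom[OF B]])
  have t2: "(\<iota> \<one> \<odot> b) \<cdot> delta \<in> pt (\<one> \<otimes> B)" by (rule tens_pt[OF idt_hom[OF unit_obj] b])
  have "(m \<cdot> (e \<odot> \<iota> B) \<cdot> inv_arr V (LUnit V B)) \<cdot> b = m \<cdot> (e \<odot> \<iota> B) \<cdot> (\<iota> \<one> \<odot> b) \<cdot> delta"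
    using cmp_assoc[OF b cmp_hom[OF l t] m] cmp_assoc[OF b l t] inv_lunit_pt[OF b] by simp
  also have "\<dots> = ap (m \<cdot> (e \<odot> \<iota> B)) (\<iota> \<one>) b"
    unfolding ap_def using cmp_assoc[OF t2 t m] by simp
  also have "\<dots> = ap m e b"
    using ap_tensA[OF m e idt_hom[OF B] idt_hom[OF unit_obj] b] cmp_idt[OF e] idt_cmp[OF b] by simp
  finally show ?thesis .
qed

lemma ap_unit_right:
  assumes m: "m \<in> hom V (B \<otimes> A) D" and e: "e \<in> pt A" and b: "b \<in> pt B"
  shows "(m \<cdot> (\<iota> B \<odot> e) \<cdot> inv_arr V (RUnit V B)) \<cdot> b = ap m b e"
proof -
  have B: "B \<in> Obj V" using b hom_cod_obj by auto
  note l = inv_arr_hom[OF runit_iso[OF B] runit_hom[OF B]]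
  have t: "\<iota> B \<odot> e \<in> hom V (B \<otimes> \<one>) (B \<otimes> A)" by (rule tensA_hom[OF idt_hom[OF B] e])
  have t2: "(b \<odot> \<iota> \<one>) \<cdot> delta \<in> pt (B \<otimes> \<one>)" by (rule tens_pt[OF b idt_hom[OF unit_obj]])
  have "(m \<cdot> (\<iota> B \<odot> e) \<cdot> inv_arr V (RUnit V B)) \<cdot> b = m \<cdot> (\<iota> B \<odot> e) \<cdot> (b \<odot> \<iota> \<one>) \<cdot> delta"
    using cmp_assoc[OF b cmp_hom[OF l t] m] cmp_assoc[OF b l t] inv_runit_pt[OF b] by simp
  also have "\<dots> = ap (m \<cdot> (\<iota> B \<odot> e)) b (\<iota> \<one>)"
    unfolding ap_def using cmp_assoc[OF t2 t m] by simp
  also have "\<dots> = ap m b e"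
    using ap_tensA[OF m idt_hom[OF B] e b idt_hom[OF unit_obj]] cmp_idt[OF e] idt_cmp[OF b] by simp
  finally show ?thesis .
qed

text \<open>Cancelling the invertible unitor turns the axiom into an equation between endomorphisms
  of \<open>B\<close>, which points detect. An equivalence is wanted because the axioms are both
  used (\<open>cc_idl\<close>) and established (\<open>vcategoryI\<close>).\<close>

lemma unit_law_left:
  assumes m: "m \<in> hom V (A \<otimes> B) B" and e: "e \<in> pt A" and B: "B \<in> Obj V"
  shows "m \<cdot> (e \<odot> \<iota> B) = LUnit V B \<longleftrightarrow> (\<forall>b \<in> pt B. ap m e b = b)"
proof -
  note l = lunit_iso[OF B] lunit_hom[OF B]
  note li = inv_arr_hom[OF l] inv_arr_cmp[OF l] cmp_inv_arr[OF l]
  have t: "e \<odot> \<iota> B \<in> hom V (\<one> \<otimes> B) (A \<otimes> B)" by (rule tensA_hom[OF e idt_hom[OF B]])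
  have i: "iso_arr V (inv_arr V (LUnit V B))" by (rule iso_arrI[OF li(1) l(2) li(3,2)])
  have "m \<cdot> (e \<odot> \<iota> B) = LUnit V B
      \<longleftrightarrow> (m \<cdot> (e \<odot> \<iota> B)) \<cdot> inv_arr V (LUnit V B) = LUnit V B \<cdot> inv_arr V (LUnit V B)"
    using iso_cancel_right[OF i li(1) cmp_hom[OF t m] l(2)] by metis
  also have "\<dots> \<longleftrightarrow> m \<cdot> (e \<odot> \<iota> B) \<cdot> inv_arr V (LUnit V B) = \<iota> B"
    using cmp_assoc[OF li(1) t m] li(3) by simp
  also have "\<dots> \<longleftrightarrow> (\<forall>b \<in> pt B. ap m e b = b)"
    (is "?f = _ \<longleftrightarrow> ?R")
  proof
    assume "?f = \<iota> B"
    then show ?R using ap_unit_left[OF m e] idt_cmp by fastforce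
  next
    assume ?R
    then show "?f = \<iota> B"
      using pt_ext[OF cmp_hom[OF cmp_hom[OF li(1) t] m] idt_hom[OF B]] ap_unit_left[OF m e]
      by (simp add: idt_cmp)
  qed
  finally show ?thesis .
qed

lemma unit_law_right:
  assumes m: "m \<in> hom V (B \<otimes> A) B" and e: "e \<in> pt A" and B: "B \<in> Obj V"
  shows "m \<cdot> (\<iota> B \<odot> e) = RUnit V B \<longleftrightarrow> (\<forall>b \<in> pt B. ap m b e = b)"
proof -
  note l = runit_iso[OF B] runit_hom[OF B]
  note li = inv_arr_hom[OF l] inv_arr_cmp[OF l] cmp_inv_arr[OF l]
  have t: "\<iota> B \<odot> e \<in> hom V (B \<otimes> \<one>) (B \<otimes> A)" by (rule tensA_hom[OF idt_hom[OF B] e])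
  have i: "iso_arr V (inv_arr V (RUnit V B))" by (rule iso_arrI[OF li(1) l(2) li(3,2)])
  have "m \<cdot> (\<iota> B \<odot> e) = RUnit V B
      \<longleftrightarrow> (m \<cdot> (\<iota> B \<odot> e)) \<cdot> inv_arr V (RUnit V B) = RUnit V B \<cdot> inv_arr V (RUnit V B)"
    using iso_cancel_right[OF i li(1) cmp_hom[OF t m] l(2)] by metis
  also have "\<dots> \<longleftrightarrow> m \<cdot> (\<iota> B \<odot> e) \<cdot> inv_arr V (RUnit V B) = \<iota> B"
    using cmp_assoc[OF li(1) t m] li(3) by simp
  also have "\<dots> \<longleftrightarrow> (\<forall>b \<in> pt B. ap m b e = b)"
    (is "?f = _ \<longleftrightarrow> ?R")
  proof
    assume "?f = \<iota> B"
    then show ?R using ap_unit_right[OF m e] idt_cmp by fastforce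
  next
    assume ?R
    then show "?f = \<iota> B"
      using pt_ext[OF cmp_hom[OF cmp_hom[OF li(1) t] m] idt_hom[OF B]] ap_unit_right[OF m e]
      by (simp add: idt_cmp)
  qed
  finally show ?thesis .
qed

lemma
  assumes C: "vcategory V C" and o: "x \<in> VObj C" "y \<in> VObj C" and f: "f \<in> cpt C x y"
  shows cc_idl: "cc C x y y (VId C y) f = f"
    and cc_idr: "cc C x x y f (VId C x) = f"
proof -
  have 1: "VComp C x y y \<cdot> (VId C y \<odot> \<iota> (VHom C x y)) = LUnit V (VHom C x y)"
    "VComp C x x y \<cdot> (\<iota> (VHom C x y) \<odot> VId C x) = RUnit V (VHom C x y)"
    using C o by (simp_all add: vcategory_def)
  show "cc C x y y (VId C y) f = f" "cc C x x y f (VId C x) = f"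
    unfolding cc_def
    using unit_law_left[OF vcomp_hom[OF C o(1,2,2)] vid_pt[OF C o(2)] vhom_obj[OF C o]]
      unit_law_right[OF vcomp_hom[OF C o(1,1,2)] vid_pt[OF C o(1)] vhom_obj[OF C o]] 1 f by auto
qed

text \<open>Extensionality on pairs and triples of points lifts the laws of an ordinary category to
  the enriched axioms, once composition is known to be an arrow of \<open>V\<close>.\<close>

lemma vcategoryI:
  assumes h: "\<And>x y. x \<in> VObj C \<Longrightarrow> y \<in> VObj C \<Longrightarrow> VHom C x y \<in> Obj V"
    and i: "\<And>x. x \<in> VObj C \<Longrightarrow> VId C x \<in> cpt C x x"
    and c: "\<And>x y z. x \<in> VObj C \<Longrightarrow> y \<in> VObj C \<Longrightarrow> z \<in> VObj C \<Longrightarrow>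
      VComp C x y z \<in> hom V (VHom C y z \<otimes> VHom C x y) (VHom C x z)"
    and ass: "\<And>w x y z h g f. w \<in> VObj C \<Longrightarrow> x \<in> VObj C \<Longrightarrow> y \<in> VObj C \<Longrightarrow> z \<in> VObj C \<Longrightarrow>
      h \<in> cpt C y z \<Longrightarrow> g \<in> cpt C x y \<Longrightarrow> f \<in> cpt C w x \<Longrightarrow>
      cc C w x z (cc C x y z h g) f = cc C w y z h (cc C w x y g f)"
    and l: "\<And>x y f. x \<in> VObj C \<Longrightarrow> y \<in> VObj C \<Longrightarrow> f \<in> cpt C x y \<Longrightarrow> cc C x y y (VId C y) f = f"
    and r: "\<And>x y f. x \<in> VObj C \<Longrightarrow> y \<in> VObj C \<Longrightarrow> f \<in> cpt C x y \<Longrightarrow> cc C x x y f (VId C x) = f"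
  shows "vcategory V C"
  unfolding vcategory_def
proof (intro conjI ballI)
  fix w x y z assume o: "w \<in> VObj C" "x \<in> VObj C" "y \<in> VObj C" "z \<in> VObj C"
  note H = h[OF o(3,4)] h[OF o(2,3)] h[OF o(1,2)]
  show "VComp C w x z \<cdot> (VComp C x y z \<odot> \<iota> (VHom C w x)) =
          VComp C w y z \<cdot> (\<iota> (VHom C y z) \<odot> VComp C w x y)
            \<cdot> Ass V (VHom C y z) (VHom C x y) (VHom C w x)"
  proof (rule tens3_pt_ext[OF _ _ H])
    show "VComp C w x z \<cdot> (VComp C x y z \<odot> \<iota> (VHom C w x))
       \<in> hom V ((VHom C y z \<otimes> VHom C x y) \<otimes> VHom C w x) (VHom C w z)"
      using cmp_hom[OF tensA_hom[OF c[OF o(2-4)] idt_hom[OF H(3)]] c[OF o(1,2,4)]] .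
    show "VComp C w y z \<cdot> (\<iota> (VHom C y z) \<odot> VComp C w x y)
            \<cdot> Ass V (VHom C y z) (VHom C x y) (VHom C w x)
       \<in> hom V ((VHom C y z \<otimes> VHom C x y) \<otimes> VHom C w x) (VHom C w z)"
      using cmp_hom[OF cmp_hom[OF ass_hom[OF H] tensA_hom[OF idt_hom[OF H(1)] c[OF o(1-3)]]]
        c[OF o(1,3,4)]] .
    fix k g f assume p: "k \<in> cpt C y z" "g \<in> cpt C x y" "f \<in> cpt C w x"
    show "ap (VComp C w x z \<cdot> (VComp C x y z \<odot> \<iota> (VHom C w x))) ((k \<odot> g) \<cdot> delta) f =
       ap (VComp C w y z \<cdot> (\<iota> (VHom C y z) \<odot> VComp C w x y)
            \<cdot> Ass V (VHom C y z) (VHom C x y) (VHom C w x)) ((k \<odot> g) \<cdot> delta) f"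
      using ap_assoc_left[OF c[OF o(1,2,4)] c[OF o(2-4)] p]
        ap_assoc_right[OF c[OF o(1,3,4)] c[OF o(1-3)] p] ass[OF o p] by (simp add: cc_def)
  qed
next
  fix x y assume o: "x \<in> VObj C" "y \<in> VObj C"
  show "VComp C x y y \<cdot> (VId C y \<odot> \<iota> (VHom C x y)) = LUnit V (VHom C x y)"
    using unit_law_left[OF c[OF o(1,2,2)] i[OF o(2)] h[OF o]] l[OF o] by (simp add: cc_def)
  show "VComp C x x y \<cdot> (\<iota> (VHom C x y) \<odot> VId C x) = RUnit V (VHom C x y)"
    using unit_law_right[OF c[OF o(1,1,2)] i[OF o(1)] h[OF o]] r[OF o] by (simp add: cc_def)
qed (rule h i c; assumption)+

lemma
  assumes "vfunctor V C D F"
  shows vf_obj: "x \<in> VObj C \<Longrightarrow> VFO F x \<in> VObj D"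
    and vf_hom: "x \<in> VObj C \<Longrightarrow> y \<in> VObj C \<Longrightarrow> VFH F x y \<in> hom V (VHom C x y) (VHom D (VFO F x) (VFO F y))"
    and vf_id: "x \<in> VObj C \<Longrightarrow> VFH F x x \<cdot> VId C x = VId D (VFO F x)"
  using assms by (auto simp: vfunctor_def)

lemma vf_pt:
  "vfunctor V C D F \<Longrightarrow> x \<in> VObj C \<Longrightarrow> y \<in> VObj C \<Longrightarrow> f \<in> cpt C x y \<Longrightarrow>
    VFH F x y \<cdot> f \<in> cpt D (VFO F x) (VFO F y)"
  using cmp_pt[OF vf_hom] .

lemma vf_cc:
  assumes C: "vcategory V C" and D: "vcategory V D" and F: "vfunctor V C D F"
    and o: "x \<in> VObj C" "y \<in> VObj C" "z \<in> VObj C"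
    and p: "g \<in> cpt C y z" "f \<in> cpt C x y"
  shows "VFH F x z \<cdot> cc C x y z g f =
    cc D (VFO F x) (VFO F y) (VFO F z) (VFH F y z \<cdot> g) (VFH F x y \<cdot> f)"
proof -
  note h = vf_hom[OF F]
  note O = vf_obj[OF F o(1)] vf_obj[OF F o(2)] vf_obj[OF F o(3)]
  have "VFH F x z \<cdot> VComp C x y z =
          VComp D (VFO F x) (VFO F y) (VFO F z) \<cdot> (VFH F y z \<odot> VFH F x y)"
    using F o unfolding vfunctor_def by blast
  then show ?thesis
    unfolding cc_def
    using ap_cmp[OF vcomp_hom[OF C o] h[OF o(1,3)] p]
      ap_tensA[OF vcomp_hom[OF D O] h[OF o(2,3)] h[OF o(1,2)] p] by simp
qed

lemma vfunctorI:
  assumes C: "vcategory V C" and D: "vcategory V D"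
    and o: "\<And>x. x \<in> VObj C \<Longrightarrow> VFO F x \<in> VObj D"
    and h: "\<And>x y. x \<in> VObj C \<Longrightarrow> y \<in> VObj C \<Longrightarrow> VFH F x y \<in> hom V (VHom C x y) (VHom D (VFO F x) (VFO F y))"
    and i: "\<And>x. x \<in> VObj C \<Longrightarrow> VFH F x x \<cdot> VId C x = VId D (VFO F x)"
    and c: "\<And>x y z g f. x \<in> VObj C \<Longrightarrow> y \<in> VObj C \<Longrightarrow> z \<in> VObj C \<Longrightarrow>
      g \<in> cpt C y z \<Longrightarrow> f \<in> cpt C x y \<Longrightarrow> VFH F x z \<cdot> cc C x y z g f =
    cc D (VFO F x) (VFO F y) (VFO F z) (VFH F y z \<cdot> g) (VFH F x y \<cdot> f)"
  shows "vfunctor V C D F"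
  unfolding vfunctor_def
proof (intro conjI ballI)
  fix x y z assume O: "x \<in> VObj C" "y \<in> VObj C" "z \<in> VObj C"
  note vD = vcomp_hom[OF D o[OF O(1)] o[OF O(2)] o[OF O(3)]] and vC = vcomp_hom[OF C O]
  show "VFH F x z \<cdot> VComp C x y z =
          VComp D (VFO F x) (VFO F y) (VFO F z) \<cdot> (VFH F y z \<odot> VFH F x y)"
  proof (rule tens_pt_ext[OF cmp_hom[OF vC h[OF O(1,3)]]
        cmp_hom[OF tensA_hom[OF h[OF O(2,3)] h[OF O(1,2)]] vD] vhom_obj[OF C O(2,3)] vhom_obj[OF C O(1,2)]])
    fix g f assume p: "g \<in> cpt C y z" "f \<in> cpt C x y"
    show "ap (VFH F x z \<cdot> VComp C x y z) g f =
      ap (VComp D (VFO F x) (VFO F y) (VFO F z) \<cdot> (VFH F y z \<odot> VFH F x y)) g f"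
      using c[OF O p] ap_cmp[OF vC h[OF O(1,3)] p] ap_tensA[OF vD h[OF O(2,3)] h[OF O(1,2)] p]
      by (simp add: cc_def)
  qed
qed (rule o h i; assumption)+

lemma post_comp_hom:
  assumes C: "vcategory V C" and o: "x \<in> VObj C" "y \<in> VObj C" "z \<in> VObj C" and f: "f \<in> cpt C x y"
  shows "post_comp V C z (x, f, y) \<in> hom V (VHom C z x) (VHom C z y)"
proof -
  note h = vhom_obj[OF C o(3,1)]
  show ?thesis
    unfolding post_comp_def
    using cmp_hom[OF cmp_hom[OF inv_arr_hom[OF lunit_iso[OF h] lunit_hom[OF h]]
      tensA_hom[OF f idt_hom[OF h]]] vcomp_hom[OF C o(3,1,2)]] by simp
qed

lemma pre_comp_hom:
  assumes C: "vcategory V C" and o: "x \<in> VObj C" "y \<in> VObj C" "z \<in> VObj C" and f: "f \<in> cpt C x y"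
  shows "pre_comp V C z (x, f, y) \<in> hom V (VHom C y z) (VHom C x z)"
proof -
  note h = vhom_obj[OF C o(2,3)]
  show ?thesis
    unfolding pre_comp_def
    using cmp_hom[OF cmp_hom[OF inv_arr_hom[OF runit_iso[OF h] runit_hom[OF h]]
      tensA_hom[OF idt_hom[OF h] f]] vcomp_hom[OF C o]] by simp
qed

lemma post_comp_pt:
  assumes C: "vcategory V C" and o: "x \<in> VObj C" "y \<in> VObj C" "z \<in> VObj C"
    and f: "f \<in> cpt C x y" and g: "g \<in> cpt C z x"
  shows "post_comp V C z (x, f, y) \<cdot> g = cc C z x y f g"
  unfolding post_comp_def cc_def using ap_unit_left[OF vcomp_hom[OF C o(3,1,2)] f g] by simp

lemma pre_comp_pt:
  assumes C: "vcategory V C" and o: "x \<in> VObj C" "y \<in> VObj C" "z \<in> VObj C"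
    and f: "f \<in> cpt C x y" and g: "g \<in> cpt C y z"
  shows "pre_comp V C z (x, f, y) \<cdot> g = cc C x y z g f"
  unfolding pre_comp_def cc_def using ap_unit_right[OF vcomp_hom[OF C o] f g] by simp

text \<open>Interchange splits off from \<open>\<eta> y \<odot> VFH F x y\<close> and
  \<open>VFH G x y \<odot> \<eta> x\<close> a factor of the form point tensor identity; with the
  inverse unitor this is insertion of a point, and both sides become arrows out of
  \<open>C(x, y)\<close> that can be compared on points.\<close>

lemma vnat_iff:
  assumes C: "vcategory V C" and D: "vcategory V D" and F: "vfunctor V C D F" and G: "vfunctor V C D G"
  shows "vnat V C D F G \<eta> \<longleftrightarrow>
    (\<forall>x \<in> VObj C. \<eta> x \<in> cpt D (VFO F x) (VFO G x)) \<and>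
    (\<forall>x \<in> VObj C. \<forall>y \<in> VObj C. \<forall>f \<in> cpt C x y.
       cc D (VFO F x) (VFO F y) (VFO G y) (\<eta> y) (VFH F x y \<cdot> f) =
       cc D (VFO F x) (VFO G x) (VFO G y) (VFH G x y \<cdot> f) (\<eta> x))"
proof -
  have "(VComp D (VFO F x) (VFO F y) (VFO G y) \<cdot> (\<eta> y \<odot> VFH F x y) \<cdot> inv_arr V (LUnit V (VHom C x y)) =
          VComp D (VFO F x) (VFO G x) (VFO G y) \<cdot> (VFH G x y \<odot> \<eta> x) \<cdot> inv_arr V (RUnit V (VHom C x y)))
     \<longleftrightarrow> (\<forall>f \<in> cpt C x y.
       cc D (VFO F x) (VFO F y) (VFO G y) (\<eta> y) (VFH F x y \<cdot> f) =
       cc D (VFO F x) (VFO G x) (VFO G y) (VFH G x y \<cdot> f) (\<eta> x))" (is "?l = ?r \<longleftrightarrow> _")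
    if o: "x \<in> VObj C" "y \<in> VObj C"
      and e: "\<eta> x \<in> cpt D (VFO F x) (VFO G x)" "\<eta> y \<in> cpt D (VFO F y) (VFO G y)" for x y
  proof -
    note O = vf_obj[OF F o(1)] vf_obj[OF F o(2)] vf_obj[OF G o(1)] vf_obj[OF G o(2)]
    note hC = vhom_obj[OF C o] and Fh = vf_hom[OF F o] and Gh = vf_hom[OF G o]
    have le: "(VComp D (VFO F x) (VFO F y) (VFO G y) \<cdot> (\<eta> y \<odot> VFH F x y)) =
       (VComp D (VFO F x) (VFO F y) (VFO G y) \<cdot> (\<iota> (VHom D (VFO F y) (VFO G y)) \<odot> VFH F x y)) \<cdot> (\<eta> y \<odot> \<iota> (VHom C x y))"
    proof -
      have "\<eta> y \<odot> VFH F x y = (\<iota> (VHom D (VFO F y) (VFO G y)) \<odot> VFH F x y) \<cdot> (\<eta> y \<odot> \<iota> (VHom C x y))"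
        using tensA_cmp[OF e(2) idt_hom[OF vhom_obj[OF D O(2,4)]] idt_hom[OF hC] Fh] idt_cmp[OF e(2)] cmp_idt[OF Fh] by simp
      then show ?thesis
        using cmp_assoc[OF tensA_hom[OF e(2) idt_hom[OF hC]] tensA_hom[OF idt_hom[OF vhom_obj[OF D O(2,4)]] Fh]
          vcomp_hom[OF D O(1,2,4)]] by simp
    qed
    have re: "(VComp D (VFO F x) (VFO G x) (VFO G y) \<cdot> (VFH G x y \<odot> \<eta> x)) =
       (VComp D (VFO F x) (VFO G x) (VFO G y) \<cdot> (VFH G x y \<odot> \<iota> (VHom D (VFO F x) (VFO G x)))) \<cdot> (\<iota> (VHom C x y) \<odot> \<eta> x)"
    proof -
      have "VFH G x y \<odot> \<eta> x = (VFH G x y \<odot> \<iota> (VHom D (VFO F x) (VFO G x))) \<cdot> (\<iota> (VHom C x y) \<odot> \<eta> x)"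
        using tensA_cmp[OF idt_hom[OF hC] Gh e(1) idt_hom[OF vhom_obj[OF D O(1,3)]]] idt_cmp[OF e(1)] cmp_idt[OF Gh] by simp
      then show ?thesis
        using cmp_assoc[OF tensA_hom[OF idt_hom[OF hC] e(1)] tensA_hom[OF Gh idt_hom[OF vhom_obj[OF D O(1,3)]]]
          vcomp_hom[OF D O(1,3,4)]] by simp
    qed
    note li = inv_arr_hom[OF lunit_iso[OF hC] lunit_hom[OF hC]]
    note ri = inv_arr_hom[OF runit_iso[OF hC] runit_hom[OF hC]]
    have ml: "VComp D (VFO F x) (VFO F y) (VFO G y) \<cdot> (\<iota> (VHom D (VFO F y) (VFO G y)) \<odot> VFH F x y)
       \<in> hom V (VHom D (VFO F y) (VFO G y) \<otimes> VHom C x y) (VHom D (VFO F x) (VFO G y))" (is "?ml \<in> _")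
      by (rule cmp_hom[OF tensA_hom[OF idt_hom[OF vhom_obj[OF D O(2,4)]] Fh] vcomp_hom[OF D O(1,2,4)]])
    have mr: "VComp D (VFO F x) (VFO G x) (VFO G y) \<cdot> (VFH G x y \<odot> \<iota> (VHom D (VFO F x) (VFO G x)))
       \<in> hom V (VHom C x y \<otimes> VHom D (VFO F x) (VFO G x)) (VHom D (VFO F x) (VFO G y))" (is "?mr \<in> _")
      by (rule cmp_hom[OF tensA_hom[OF Gh idt_hom[OF vhom_obj[OF D O(1,3)]]] vcomp_hom[OF D O(1,3,4)]])
    note tl = tensA_hom[OF e(2) idt_hom[OF hC]] and tr = tensA_hom[OF idt_hom[OF hC] e(1)]
    note tl0 = tensA_hom[OF e(2) Fh] and tr0 = tensA_hom[OF Gh e(1)]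
    have L: "?l = ?ml \<cdot> (\<eta> y \<odot> \<iota> (VHom C x y)) \<cdot> inv_arr V (LUnit V (VHom C x y))"
      using le cmp_assoc[OF li tl ml] cmp_assoc[OF li tl0 vcomp_hom[OF D O(1,2,4)]] by simp
    have R: "?r = ?mr \<cdot> (\<iota> (VHom C x y) \<odot> \<eta> x) \<cdot> inv_arr V (RUnit V (VHom C x y))"
      using re cmp_assoc[OF ri tr mr] cmp_assoc[OF ri tr0 vcomp_hom[OF D O(1,3,4)]] by simp
    have lh: "?l \<in> hom V (VHom C x y) (VHom D (VFO F x) (VFO G y))"
      by (rule cmp_hom[OF cmp_hom[OF li tl0] vcomp_hom[OF D O(1,2,4)]])
    have rh: "?r \<in> hom V (VHom C x y) (VHom D (VFO F x) (VFO G y))"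
      by (rule cmp_hom[OF cmp_hom[OF ri tr0] vcomp_hom[OF D O(1,3,4)]])
    have lp: "?l \<cdot> f = cc D (VFO F x) (VFO F y) (VFO G y) (\<eta> y) (VFH F x y \<cdot> f)" if f: "f \<in> cpt C x y" for f
      unfolding L cc_def using ap_unit_left[OF ml e(2) f] idt_cmp[OF e(2)]
        ap_tensA[OF vcomp_hom[OF D O(1,2,4)] idt_hom[OF vhom_obj[OF D O(2,4)]] Fh e(2) f] by simp
    have rp: "?r \<cdot> f = cc D (VFO F x) (VFO G x) (VFO G y) (VFH G x y \<cdot> f) (\<eta> x)" if f: "f \<in> cpt C x y" for f
      unfolding R cc_def using ap_unit_right[OF mr e(1) f] idt_cmp[OF e(1)]
        ap_tensA[OF vcomp_hom[OF D O(1,3,4)] Gh idt_hom[OF vhom_obj[OF D O(1,3)]] f e(1)] by simp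
    show ?thesis
    proof
      assume "?l = ?r" then show "\<forall>f \<in> cpt C x y.
       cc D (VFO F x) (VFO F y) (VFO G y) (\<eta> y) (VFH F x y \<cdot> f) =
       cc D (VFO F x) (VFO G x) (VFO G y) (VFH G x y \<cdot> f) (\<eta> x)" using lp rp by simp
    next
      assume "\<forall>f \<in> cpt C x y.
       cc D (VFO F x) (VFO F y) (VFO G y) (\<eta> y) (VFH F x y \<cdot> f) =
       cc D (VFO F x) (VFO G x) (VFO G y) (VFH G x y \<cdot> f) (\<eta> x)"
      then show "?l = ?r" using pt_ext[OF lh rh] lp rp by simp
    qed
  qed
  then show ?thesis unfolding vnat_def by auto
qed

section \<open>Isomorphisms in enriched categories, and composites of functors\<close>

definition viso :: "('c, 'o, 'a) vcat \<Rightarrow> 'c \<Rightarrow> 'c \<Rightarrow> 'a \<Rightarrow> 'a \<Rightarrow> bool" where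
  "viso C x y f g \<longleftrightarrow> f \<in> cpt C x y \<and> g \<in> cpt C y x \<and> cc C x y x g f = VId C x \<and> cc C y x y f g = VId C y"

lemma underlying_cmp: "(y, g, z) \<cdot>\<^bsub>underlying V C\<^esub> (x, f, y') = (x, cc C x y z g f, z)"
  by (simp add: underlying_def cc_def ap_def)

lemma iso_underlying_iff:
  assumes "x \<in> VObj C" "y \<in> VObj C"
  shows "iso_arr (underlying V C) (x, f, y) \<longleftrightarrow> (\<exists>g. viso C x y f g)"
proof -
  have "iso_arr (underlying V C) (x, f, y) \<longleftrightarrow>
     (\<exists>g. inverse_arrs (underlying V C) (x, f, y) (y, g, x))"
    unfolding iso_arr_def inverse_arrs_def by (auto simp: underlying_def hom_def)
  also have "\<dots> \<longleftrightarrow> (\<exists>g. viso C x y f g)"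
    unfolding inverse_arrs_def viso_def underlying_cmp
    by (rule ex_cong1) (use assms in \<open>auto simp: underlying_def hom_def\<close>)
  finally show ?thesis .
qed

lemma viso_sym: "viso C x y f g \<Longrightarrow> viso C y x g f"
  by (auto simp: viso_def)

lemma
  assumes C: "vcategory V C" and o: "x \<in> VObj C" "y \<in> VObj C" "z \<in> VObj C" and i: "viso C x y f g"
  shows viso_cancel_left: "h \<in> cpt C z x \<Longrightarrow> cc C z y x g (cc C z x y f h) = h"
    and viso_cancel_right: "h \<in> cpt C x z \<Longrightarrow> cc C x y z (cc C y x z h g) f = h"
proof -
  have p: "f \<in> cpt C x y" "g \<in> cpt C y x" using i by (auto simp: viso_def)
  show "cc C z y x g (cc C z x y f h) = h" if "h \<in> cpt C z x"
    using cc_assoc[OF C o(3,1,2,1) p(2,1) that] i cc_idl[OF C o(3,1) that] by (simp add: viso_def)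
  show "cc C x y z (cc C y x z h g) f = h" if "h \<in> cpt C x z"
    using cc_assoc[OF C o(1,2,1,3) that p(2,1)] i cc_idr[OF C o(1,3) that] by (simp add: viso_def)
qed

lemma viso_cc:
  assumes C: "vcategory V C" and o: "x \<in> VObj C" "y \<in> VObj C" "z \<in> VObj C"
    and i: "viso C x y f g" "viso C y z f' g'"
  shows "viso C x z (cc C x y z f' f) (cc C z y x g g')"
proof -
  have p: "f \<in> cpt C x y" "g \<in> cpt C y x" "f' \<in> cpt C y z" "g' \<in> cpt C z y" using i by (auto simp: viso_def)
  note q = cc_pt[OF C]
  have "cc C x z x (cc C z y x g g') (cc C x y z f' f) = cc C x y x g (cc C x z y g' (cc C x y z f' f))"
    using cc_assoc[OF C o(1,3,2,1) p(2,4) q[OF o p(3,1)]] .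
  also have "\<dots> = VId C x" using viso_cancel_left[OF C o(2,3,1) i(2) p(1)] i(1) by (simp add: viso_def)
  finally have 1: "cc C x z x (cc C z y x g g') (cc C x y z f' f) = VId C x" .
  have "cc C z x z (cc C x y z f' f) (cc C z y x g g') = cc C z y z f' (cc C z x y f (cc C z y x g g'))"
    using cc_assoc[OF C o(3,1,2,3) p(3,1) q[OF o(3,2,1) p(2,4)]] .
  also have "\<dots> = VId C z"
    using viso_cancel_left[OF C o(2,1,3) viso_sym[OF i(1)] p(4)] i(2) by (simp add: viso_def)
  finally show ?thesis using 1 q[OF o p(3,1)] q[OF o(3,2,1) p(2,4)] by (simp add: viso_def)
qed

lemma viso_id: "vcategory V C \<Longrightarrow> x \<in> VObj C \<Longrightarrow> viso C x x (VId C x) (VId C x)"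
  using cc_idl[of C x x "VId C x"] vid_pt[of C x] by (simp add: viso_def)

lemma vf_viso:
  assumes C: "vcategory V C" and D: "vcategory V D" and F: "vfunctor V C D F"
    and o: "x \<in> VObj C" "y \<in> VObj C" and i: "viso C x y f g"
  shows "viso D (VFO F x) (VFO F y) (VFH F x y \<cdot> f) (VFH F y x \<cdot> g)"
proof -
  have p: "f \<in> cpt C x y" "g \<in> cpt C y x" using i by (auto simp: viso_def)
  show ?thesis
    using vf_cc[OF C D F o(1,2,1) p(2,1)] vf_cc[OF C D F o(2,1,2) p] vf_pt[OF F o p(1)] vf_pt[OF F o(2,1) p(2)]
      vf_id[OF F o(1)] vf_id[OF F o(2)] i by (simp add: viso_def)
qed

lemma vfun_comp_vfunctor:
  assumes C: "vcategory V C" and D: "vcategory V D" and E: "vcategory V E"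
    and F: "vfunctor V C D F" and G: "vfunctor V D E G"
  shows "vfunctor V C E (vfun_comp V G F)"
proof (rule vfunctorI[OF C E])
  fix x assume x: "x \<in> VObj C"
  note X = vf_obj[OF F x]
  show "VFO (vfun_comp V G F) x \<in> VObj E" using vf_obj[OF G X] by (simp add: vfun_comp_def)
  show "VFH (vfun_comp V G F) x x \<cdot> VId C x = VId E (VFO (vfun_comp V G F) x)"
    using cmp_assoc[OF vid_pt[OF C x] vf_hom[OF F x x] vf_hom[OF G X X]] vf_id[OF F x] vf_id[OF G X]
    by (simp add: vfun_comp_def)
  fix y assume y: "y \<in> VObj C"
  note Y = vf_obj[OF F y]
  show "VFH (vfun_comp V G F) x y \<in> hom V (VHom C x y) (VHom E (VFO (vfun_comp V G F) x) (VFO (vfun_comp V G F) y))"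
    using cmp_hom[OF vf_hom[OF F x y] vf_hom[OF G X Y]] by (simp add: vfun_comp_def)
  fix z g f assume z: "z \<in> VObj C" and p: "g \<in> cpt C y z" "f \<in> cpt C x y"
  note Z = vf_obj[OF F z]
  have *: "VFH (vfun_comp V G F) x z \<cdot> cc C x y z g f = VFH G (VFO F x) (VFO F z) \<cdot> VFH F x z \<cdot> cc C x y z g f"
    "VFH (vfun_comp V G F) y z \<cdot> g = VFH G (VFO F y) (VFO F z) \<cdot> VFH F y z \<cdot> g"
    "VFH (vfun_comp V G F) x y \<cdot> f = VFH G (VFO F x) (VFO F y) \<cdot> VFH F x y \<cdot> f"
    using cmp_assoc[OF cc_pt[OF C x y z p] vf_hom[OF F x z] vf_hom[OF G X Z]]
      cmp_assoc[OF p(1) vf_hom[OF F y z] vf_hom[OF G Y Z]]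
      cmp_assoc[OF p(2) vf_hom[OF F x y] vf_hom[OF G X Y]] by (simp_all add: vfun_comp_def)
  show "VFH (vfun_comp V G F) x z \<cdot> cc C x y z g f =
       cc E (VFO (vfun_comp V G F) x) (VFO (vfun_comp V G F) y) (VFO (vfun_comp V G F) z)
        (VFH (vfun_comp V G F) y z \<cdot> g) (VFH (vfun_comp V G F) x y \<cdot> f)"
    unfolding * using vf_cc[OF C D F x y z p]
      vf_cc[OF D E G X Y Z vf_pt[OF F y z p(1)] vf_pt[OF F x y p(2)]] by (simp add: vfun_comp_def)
qed

lemma vfun_comp_pt:
  assumes "vfunctor V C D F" "vfunctor V D E G" "x \<in> VObj C" "y \<in> VObj C" "f \<in> cpt C x y"
  shows "VFH (vfun_comp V G F) x y \<cdot> f = VFH G (VFO F x) (VFO F y) \<cdot> VFH F x y \<cdot> f"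
  using cmp_assoc[OF assms(5) vf_hom[OF assms(1,3,4)] vf_hom[OF assms(2) vf_obj[OF assms(1,3)] vf_obj[OF assms(1,4)]]]
  by (simp add: vfun_comp_def)

lemma vfun_id_vfunctor: "vcategory V C \<Longrightarrow> vfunctor V C C (vfun_id V C)"
  by (rule vfunctorI) (auto simp: vfun_id_def idt_hom vhom_obj idt_cmp[OF vid_pt] idt_cmp[OF cc_pt] idt_cmp)

lemma vfun_pow_vfunctor: "vcategory V C \<Longrightarrow> vfunctor V C C F \<Longrightarrow> vfunctor V C C (vfun_pow V C F n)"
  by (induction n) (auto simp: vfun_id_vfunctor vfun_comp_vfunctor)

end


section \<open>The enriched ind-category\<close>

lemma op_cat_category:
  assumes "category J"
  shows "category (op_cat J)"
proof -
  interpret category J by (rule assms)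
  have h: "hom (op_cat J) x y = hom J y x" for x y by (auto simp: hom_def op_cat_def)
  show ?thesis
    by unfold_locales
      (use dom_obj cod_obj idt_hom cmp_hom cmp_idt idt_cmp cmp_assoc[symmetric] in
        \<open>auto simp: h\<close>, auto simp: op_cat_def dom_obj cod_obj idt_hom cmp_hom cmp_idt idt_cmp cmp_assoc)
qed

lemma set_cat_hom: "(A, f, B) \<in> hom set_cat A' B' \<longleftrightarrow> A = A' \<and> B = B' \<and> f \<in> A \<rightarrow>\<^sub>E B"
  by (auto simp: hom_def set_cat_def)

lemma set_cat_cmp: "(B, g, Z) \<cdot>\<^bsub>set_cat\<^esub> (A, f, B') = (A, \<lambda>x \<in> A. g (f x), Z)"
  by (simp add: set_cat_def)

section \<open>Points of filtered colimits\<close>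

locale ind_base = concrete_base V
  for V :: "('o, 'a) smc" (structure) +
  fixes C :: "('c, 'o, 'a) vcat" and U :: "'u itself"
  assumes inf: "(UNIV :: nat set) \<prec> (UNIV :: 'u set)"
    and bicomp: "bicomplete TYPE('u) V"
    and comp_unit: "compact_unit TYPE('u) V"
    and vcatC: "vcategory V C"
begin

abbreviation icol :: "'c \<Rightarrow> ('u, 'c, 'a) ind_obj \<Rightarrow> 'o" where
  "icol \<equiv> ind_col V C"

abbreviation coproj :: "'c \<Rightarrow> ('u, 'c, 'a) ind_obj \<Rightarrow> 'u \<Rightarrow> 'a" where
  "coproj \<equiv> ind_in V C"

abbreviation ihom :: "('u, 'c, 'a) ind_obj \<Rightarrow> ('u, 'c, 'a) ind_obj \<Rightarrow> 'o" where
  "ihom \<equiv> ind_hom V C"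

abbreviation proj :: "('u, 'c, 'a) ind_obj \<Rightarrow> ('u, 'c, 'a) ind_obj \<Rightarrow> 'u \<Rightarrow> 'a" where
  "proj \<equiv> ind_proj V C"

text \<open>
  The image of the coprojections is itself a cocone in sets, and the factorisation through it
  splits its inclusion; this needs no construction of colimits of sets.
\<close>

lemma filtered_colimit_pt:
  fixes J :: "('u, 'u) cat"
  assumes J: "small_category J" "filtered J" and D: "is_functor J V D" and L: "is_colimit J V D L p"
    and c: "c \<in> pt L"
  shows "\<exists>j \<in> Obj J. \<exists>a \<in> pt (FO D j). c = p j \<cdot> a"
proof -
  let ?H = "hom_functor V \<one>"
  have col: "is_colimit J set_cat (ftr_comp ?H D) (FO ?H L) (FA ?H \<circ> p)"
    using comp_unit J D L unfolding compact_unit_def preserves_filtered_colimits_def by blast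
  interpret J: category J using J by (simp add: small_category_def)
  have p: "\<And>j. j \<in> Obj J \<Longrightarrow> p j \<in> hom V (FO D j) L"
    and pc: "\<And>f. f \<in> Arr J \<Longrightarrow> p (Cod J f) \<cdot> FA D f = p (Dom J f)"
    using L by (auto simp: is_colimit_def is_cocone_def)
  have Da: "\<And>f. f \<in> Arr J \<Longrightarrow> FA D f \<in> hom V (FO D (Dom J f)) (FO D (Cod J f))"
    using D by (auto simp: is_functor_def)
  define T where "T = (\<Union>j \<in> Obj J. (\<lambda>a. p j \<cdot> a) ` pt (FO D j))"
  have TL: "T \<subseteq> pt L" using cmp_pt[OF p] by (auto simp: T_def)
  define q where "q j = (pt (FO D j), \<lambda>a \<in> pt (FO D j). p j \<cdot> a, T)" for j
  have FAp: "FA ?H (p j) = (pt (FO D j), \<lambda>a \<in> pt (FO D j). p j \<cdot> a, pt L)" if "j \<in> Obj J" for j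
    using p[OF that] by (simp add: hom_functor_def hom_dom hom_cod)
  have "is_cocone J set_cat (ftr_comp ?H D) T q"
    unfolding is_cocone_def
  proof (intro conjI ballI)
    show "T \<in> Obj set_cat" by (simp add: set_cat_def)
    show "q j \<in> hom set_cat (FO (ftr_comp ?H D) j) T" if "j \<in> Obj J" for j
      using that by (auto simp: q_def set_cat_hom ftr_comp_def hom_functor_def T_def)
    fix f assume f: "f \<in> Arr J"
    have e: "FA (ftr_comp ?H D) f = (pt (FO D (Dom J f)), \<lambda>a \<in> pt (FO D (Dom J f)). FA D f \<cdot> a, pt (FO D (Cod J f)))"
      using Da[OF f] by (simp add: ftr_comp_def hom_functor_def hom_dom hom_cod)
    have "p (Cod J f) \<cdot> (FA D f \<cdot> a) = p (Dom J f) \<cdot> a" if "a \<in> pt (FO D (Dom J f))" for a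
      using cmp_assoc[OF that Da[OF f] p[OF J.cod_obj[OF f]]] pc[OF f] by simp
    moreover have "FA D f \<cdot> a \<in> pt (FO D (Cod J f))" if "a \<in> pt (FO D (Dom J f))" for a
      using cmp_pt[OF Da[OF f] that] .
    ultimately show "q (Cod J f) \<cdot>\<^bsub>set_cat\<^esub> FA (ftr_comp ?H D) f = q (Dom J f)"
      unfolding e by (auto simp: q_def set_cat_cmp intro!: restrict_ext)
  qed
  then obtain h where h: "h \<in> hom set_cat (FO ?H L) T"
    "\<And>j. j \<in> Obj J \<Longrightarrow> h \<cdot>\<^bsub>set_cat\<^esub> (FA ?H \<circ> p) j = q j"
    using col unfolding is_colimit_def by blast
  have FOL: "FO ?H L = pt L" by (simp add: hom_functor_def)
  obtain k where k: "h = (pt L, k, T)" "k \<in> pt L \<rightarrow>\<^sub>E T"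
    using h(1) unfolding FOL by (cases h) (auto simp: set_cat_hom)
  have kp: "k (p j \<cdot> a) = p j \<cdot> a" if "j \<in> Obj J" "a \<in> pt (FO D j)" for j a
  proof -
    have "(\<lambda>x \<in> pt (FO D j). k ((\<lambda>a \<in> pt (FO D j). p j \<cdot> a) x)) = (\<lambda>a \<in> pt (FO D j). p j \<cdot> a)"
      using h(2)[OF that(1)] that(1) by (simp add: FAp k q_def set_cat_cmp)
    then have "(\<lambda>x \<in> pt (FO D j). k ((\<lambda>a \<in> pt (FO D j). p j \<cdot> a) x)) a = (\<lambda>a \<in> pt (FO D j). p j \<cdot> a) a"
      by (rule fun_cong)
    then show ?thesis using that by simp
  qed
  \<comment> \<open>Followed by the inclusion of \<open>T\<close>, the map \<open>k\<close> factors
    the colimit cocone through itself. So does the identity, hence they agree and every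
    \<open>c = k c\<close> lies in \<open>T\<close>.\<close>
  let ?c = "FA ?H \<circ> p" and ?k = "(pt L, k, pt L)" and ?i = "(pt L, \<lambda>x \<in> pt L. x, pt L)"
  have "is_cocone J set_cat (ftr_comp ?H D) (pt L) ?c"
    using col by (simp add: is_colimit_def hom_functor_def)
  then have u: "\<exists>!h. h \<in> hom set_cat (pt L) (pt L) \<and> (\<forall>j \<in> Obj J. h \<cdot>\<^bsub>set_cat\<^esub> ?c j = ?c j)"
    using col unfolding is_colimit_def FOL by blast
  have "?k \<in> hom set_cat (pt L) (pt L)" using k TL by (auto simp: set_cat_hom)
  moreover have "?k \<cdot>\<^bsub>set_cat\<^esub> ?c j = ?c j" if "j \<in> Obj J" for j
    using kp[OF that] that by (auto simp: FAp set_cat_cmp intro!: restrict_ext)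
  moreover have "?i \<in> hom set_cat (pt L) (pt L)" by (auto simp: set_cat_hom)
  moreover have "?i \<cdot>\<^bsub>set_cat\<^esub> ?c j = ?c j" if "j \<in> Obj J" for j
    using cmp_pt[OF p[OF that]] that by (auto simp: FAp set_cat_cmp intro!: restrict_ext)
  ultimately have "?k = ?i" using u by blast
  then have "k c = c" using c by (simp add: fun_eq_iff)
  then have "c \<in> T" using k(2) c by (metis PiE_mem)
  then show ?thesis by (auto simp: T_def)
qed


section \<open>Diagrams and the colimits of hom-objects into them\<close>

abbreviation ind :: "('u, 'c, 'a) ind_obj \<Rightarrow> bool" where
  "ind X \<equiv> is_ind_obj V C X"

definition tr :: "('u, 'c, 'a) ind_obj \<Rightarrow> 'u \<Rightarrow> 'a" where
  "tr X a = fst (snd (FA (Dia X) a))"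

lemma
  assumes "ind X"
  shows ind_category: "category (Idx X)"
    and ind_small: "small_category (Idx X)"
    and ind_filtered: "filtered (Idx X)"
    and ind_functor: "is_functor (Idx X) (underlying V C) (Dia X)"
  using assms by (auto simp: is_ind_obj_def small_category_def)

lemma ind_at_obj: "ind X \<Longrightarrow> i \<in> Obj (Idx X) \<Longrightarrow> ind_at X i \<in> VObj C"
  using ind_functor by (auto simp: is_functor_def underlying_def)

lemma ind_dom: "ind X \<Longrightarrow> a \<in> Arr (Idx X) \<Longrightarrow> Dom (Idx X) a \<in> Obj (Idx X)"
  and ind_cod: "ind X \<Longrightarrow> a \<in> Arr (Idx X) \<Longrightarrow> Cod (Idx X) a \<in> Obj (Idx X)"
  using ind_category category.dom_obj category.cod_obj by fast+

lemma
  assumes "ind X" "a \<in> Arr (Idx X)"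
  shows tr_pt: "tr X a \<in> cpt C (ind_at X (Dom (Idx X) a)) (ind_at X (Cod (Idx X) a))"
    and Dia_arr: "FA (Dia X) a = (ind_at X (Dom (Idx X) a), tr X a, ind_at X (Cod (Idx X) a))"
proof -
  have "FA (Dia X) a \<in> hom (underlying V C) (ind_at X (Dom (Idx X) a)) (ind_at X (Cod (Idx X) a))"
    using ind_functor assms by (auto simp: is_functor_def)
  then show "tr X a \<in> cpt C (ind_at X (Dom (Idx X) a)) (ind_at X (Cod (Idx X) a))"
    and "FA (Dia X) a = (ind_at X (Dom (Idx X) a), tr X a, ind_at X (Cod (Idx X) a))"
    unfolding hom_def[of "underlying V C"] tr_def by (auto simp: underlying_def)
qed

lemma tr_idt: "ind X \<Longrightarrow> i \<in> Obj (Idx X) \<Longrightarrow> tr X (\<iota>\<^bsub>Idx X\<^esub> i) = VId C (ind_at X i)"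
  using ind_functor[of X] by (auto simp: is_functor_def underlying_def tr_def)

lemma tr_cmp:
  assumes X: "ind X" and f: "f \<in> hom (Idx X) i j" and g: "g \<in> hom (Idx X) j k"
  shows "tr X (g \<cdot>\<^bsub>Idx X\<^esub> f) = cc C (ind_at X i) (ind_at X j) (ind_at X k) (tr X g) (tr X f)"
proof -
  have fg: "f \<in> Arr (Idx X)" "g \<in> Arr (Idx X)" "Dom (Idx X) f = i" "Cod (Idx X) f = j"
    "Dom (Idx X) g = j" "Cod (Idx X) g = k" using f g by (auto simp: hom_def)
  have "FA (Dia X) (g \<cdot>\<^bsub>Idx X\<^esub> f) = FA (Dia X) g \<cdot>\<^bsub>underlying V C\<^esub> FA (Dia X) f"
    using ind_functor[OF X] f g by (auto simp: is_functor_def)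
  also have "\<dots> = (ind_at X i, cc C (ind_at X i) (ind_at X j) (ind_at X k) (tr X g) (tr X f), ind_at X k)"
    unfolding Dia_arr[OF X fg(1)] Dia_arr[OF X fg(2)] fg(3-) underlying_cmp ..
  finally show ?thesis unfolding tr_def[of X "g \<cdot>\<^bsub>Idx X\<^esub> f"] by simp
qed

text \<open>Gives a name to the diagram written out in \<open>ind_col_pair\<close>, so that its
  functoriality can be stated.\<close>

definition col_diag :: "'c \<Rightarrow> ('u, 'c, 'a) ind_obj \<Rightarrow> ('u, 'u, 'o, 'a) ftr" where
  "col_diag x Y = \<lparr>FO = (\<lambda>j. VHom C x (ind_at Y j)), FA = (\<lambda>b. post_comp V C x (FA (Dia Y) b))\<rparr>"

lemma col_diag_hom:
  assumes "x \<in> VObj C" "ind Y" "b \<in> Arr (Idx Y)"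
  shows "FA (col_diag x Y) b \<in> hom V (VHom C x (ind_at Y (Dom (Idx Y) b))) (VHom C x (ind_at Y (Cod (Idx Y) b)))"
  using post_comp_hom[OF vcatC ind_at_obj ind_at_obj assms(1) tr_pt] ind_dom ind_cod assms Dia_arr
  by (simp add: col_diag_def)

lemma col_diag_pt:
  assumes "x \<in> VObj C" "ind Y" "b \<in> Arr (Idx Y)" "g \<in> cpt C x (ind_at Y (Dom (Idx Y) b))"
  shows "FA (col_diag x Y) b \<cdot> g = cc C x (ind_at Y (Dom (Idx Y) b)) (ind_at Y (Cod (Idx Y) b)) (tr Y b) g"
  using post_comp_pt[OF vcatC ind_at_obj ind_at_obj assms(1) tr_pt assms(4)] ind_dom ind_cod assms Dia_arr
  by (simp add: col_diag_def)

lemma col_diag_functor: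
  assumes x: "x \<in> VObj C" and Y: "ind Y"
  shows "is_functor (Idx Y) V (col_diag x Y)"
proof -
  interpret J: category "Idx Y" by (rule ind_category[OF Y])
  note hx = vhom_obj[OF vcatC x ind_at_obj[OF Y]]
  have FO: "FO (col_diag x Y) j = VHom C x (ind_at Y j)" for j by (simp add: col_diag_def)
  show ?thesis
    unfolding is_functor_def FO
  proof (intro conjI ballI allI)
    show "VHom C x (ind_at Y j) \<in> Obj V" if "j \<in> Obj (Idx Y)" for j by (rule hx[OF that])
    show "FA (col_diag x Y) f \<in> hom V (VHom C x (ind_at Y (Dom (Idx Y) f))) (VHom C x (ind_at Y (Cod (Idx Y) f)))"
      if "f \<in> Arr (Idx Y)" for f by (rule col_diag_hom[OF x Y that])
    fix j assume j: "j \<in> Obj (Idx Y)"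
    have ij: "\<iota>\<^bsub>Idx Y\<^esub> j \<in> Arr (Idx Y)" "Dom (Idx Y) (\<iota>\<^bsub>Idx Y\<^esub> j) = j" "Cod (Idx Y) (\<iota>\<^bsub>Idx Y\<^esub> j) = j"
      using J.idt_hom[OF j] by (auto simp: hom_def)
    show "FA (col_diag x Y) (\<iota>\<^bsub>Idx Y\<^esub> j) = \<iota> (VHom C x (ind_at Y j))"
    proof (rule pt_ext[OF _ idt_hom[OF hx[OF j]]])
      show "FA (col_diag x Y) (\<iota>\<^bsub>Idx Y\<^esub> j) \<in> hom V (VHom C x (ind_at Y j)) (VHom C x (ind_at Y j))"
        using col_diag_hom[OF x Y ij(1)] ij by simp
      fix g assume g: "g \<in> cpt C x (ind_at Y j)"
      show "FA (col_diag x Y) (\<iota>\<^bsub>Idx Y\<^esub> j) \<cdot> g = \<iota> (VHom C x (ind_at Y j)) \<cdot> g"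
        using col_diag_pt[OF x Y ij(1)] g ij tr_idt[OF Y j] cc_idl[OF vcatC x ind_at_obj[OF Y j] g]
          idt_cmp[OF g] by simp
    qed
  next
    fix i j k f g assume f: "f \<in> hom (Idx Y) i j" and g: "g \<in> hom (Idx Y) j k"
    have fg: "f \<in> Arr (Idx Y)" "g \<in> Arr (Idx Y)" "Dom (Idx Y) f = i" "Cod (Idx Y) f = j"
      "Dom (Idx Y) g = j" "Cod (Idx Y) g = k" using f g by (auto simp: hom_def)
    have gf: "g \<cdot>\<^bsub>Idx Y\<^esub> f \<in> Arr (Idx Y)" "Dom (Idx Y) (g \<cdot>\<^bsub>Idx Y\<^esub> f) = i" "Cod (Idx Y) (g \<cdot>\<^bsub>Idx Y\<^esub> f) = k"
      using J.cmp_hom[OF f g] by (auto simp: hom_def)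
    have ijk: "i \<in> Obj (Idx Y)" "j \<in> Obj (Idx Y)" "k \<in> Obj (Idx Y)"
      using f g J.hom_dom_obj J.hom_cod_obj by auto
    note o = ind_at_obj[OF Y ijk(1)] ind_at_obj[OF Y ijk(2)] ind_at_obj[OF Y ijk(3)]
    have F: "FA (col_diag x Y) f \<in> hom V (VHom C x (ind_at Y i)) (VHom C x (ind_at Y j))"
      and G: "FA (col_diag x Y) g \<in> hom V (VHom C x (ind_at Y j)) (VHom C x (ind_at Y k))"
      and GF: "FA (col_diag x Y) (g \<cdot>\<^bsub>Idx Y\<^esub> f) \<in> hom V (VHom C x (ind_at Y i)) (VHom C x (ind_at Y k))"
      using col_diag_hom[OF x Y fg(1)] col_diag_hom[OF x Y fg(2)] col_diag_hom[OF x Y gf(1)] fg gf by simp_all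
    have t: "tr Y f \<in> cpt C (ind_at Y i) (ind_at Y j)" "tr Y g \<in> cpt C (ind_at Y j) (ind_at Y k)"
      using tr_pt[OF Y fg(1)] tr_pt[OF Y fg(2)] fg by simp_all
    show "FA (col_diag x Y) (g \<cdot>\<^bsub>Idx Y\<^esub> f) = FA (col_diag x Y) g \<cdot> FA (col_diag x Y) f"
    proof (rule pt_ext[OF GF cmp_hom[OF F G]])
      fix h assume h: "h \<in> cpt C x (ind_at Y i)"
      have fh: "FA (col_diag x Y) f \<cdot> h = cc C x (ind_at Y i) (ind_at Y j) (tr Y f) h"
        using col_diag_pt[OF x Y fg(1)] h fg by simp
      have "FA (col_diag x Y) g \<cdot> (FA (col_diag x Y) f \<cdot> h)
         = cc C x (ind_at Y j) (ind_at Y k) (tr Y g) (cc C x (ind_at Y i) (ind_at Y j) (tr Y f) h)"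
        unfolding fh using col_diag_pt[OF x Y fg(2)] cc_pt[OF vcatC x o(1,2) t(1) h] fg by simp
      moreover have "FA (col_diag x Y) (g \<cdot>\<^bsub>Idx Y\<^esub> f) \<cdot> h
         = cc C x (ind_at Y i) (ind_at Y k) (tr Y (g \<cdot>\<^bsub>Idx Y\<^esub> f)) h"
        using col_diag_pt[OF x Y gf(1)] h gf by simp
      ultimately show "FA (col_diag x Y) (g \<cdot>\<^bsub>Idx Y\<^esub> f) \<cdot> h = (FA (col_diag x Y) g \<cdot> FA (col_diag x Y) f) \<cdot> h"
        using cc_assoc[OF vcatC x o t(2,1) h] tr_cmp[OF Y f g] cmp_assoc[OF h F G] by simp
    qed
  qed
qed

text \<open>Bicompleteness supplies some colimit of this diagram, hence the chosen pair is one.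
  Nothing else about the choice is used afterwards.\<close>

lemma ind_col_colimit:
  assumes "x \<in> VObj C" "ind Y"
  shows "is_colimit (Idx Y) V (col_diag x Y) (icol x Y) (coproj x Y)"
proof -
  have "\<exists>L p. is_colimit (Idx Y) V (col_diag x Y) L p"
    using bicomp ind_small[OF assms(2)] col_diag_functor[OF assms] unfolding bicomplete_def by blast
  then obtain L p where "is_colimit (Idx Y) V (col_diag x Y) L p" by blast
  then have "(\<lambda>(L, p). is_colimit (Idx Y) V (col_diag x Y) L p) (L, p)" by simp
  then have "(\<lambda>(L, p). is_colimit (Idx Y) V (col_diag x Y) L p) (colimit_of (Idx Y) V (col_diag x Y))"
    unfolding colimit_of_def by (rule someI)
  then show ?thesis
    by (simp add: ind_col_def ind_in_def ind_col_pair_def col_diag_def split_beta)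
qed

lemma
  assumes "x \<in> VObj C" "ind Y"
  shows ind_col_obj: "icol x Y \<in> Obj V"
    and ind_in_hom: "j \<in> Obj (Idx Y) \<Longrightarrow> coproj x Y j \<in> hom V (VHom C x (ind_at Y j)) (icol x Y)"
  using ind_col_colimit[OF assms] by (auto simp: is_colimit_def is_cocone_def col_diag_def)

lemma ind_in_pt:
  "x \<in> VObj C \<Longrightarrow> ind Y \<Longrightarrow> j \<in> Obj (Idx Y) \<Longrightarrow> g \<in> cpt C x (ind_at Y j) \<Longrightarrow>
    coproj x Y j \<cdot> g \<in> pt (icol x Y)"
  using cmp_pt[OF ind_in_hom] .

lemma ind_in_tr:
  assumes x: "x \<in> VObj C" and Y: "ind Y" and b: "b \<in> Arr (Idx Y)"
    and g: "g \<in> cpt C x (ind_at Y (Dom (Idx Y) b))"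
  shows "coproj x Y (Cod (Idx Y) b) \<cdot> cc C x (ind_at Y (Dom (Idx Y) b)) (ind_at Y (Cod (Idx Y) b)) (tr Y b) g
     = coproj x Y (Dom (Idx Y) b) \<cdot> g"
proof -
  have "coproj x Y (Cod (Idx Y) b) \<cdot> FA (col_diag x Y) b = coproj x Y (Dom (Idx Y) b)"
    using ind_col_colimit[OF x Y] b by (auto simp: is_colimit_def is_cocone_def)
  then show ?thesis
    using cmp_assoc[OF g col_diag_hom[OF x Y b] ind_in_hom[OF x Y ind_cod[OF Y b]]]
      col_diag_pt[OF x Y b g] by simp
qed

lemma ind_col_pt:
  assumes "x \<in> VObj C" "ind Y" "c \<in> pt (icol x Y)"
  obtains j g where "j \<in> Obj (Idx Y)" "g \<in> cpt C x (ind_at Y j)" "c = coproj x Y j \<cdot> g"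
  using filtered_colimit_pt[OF ind_small[OF assms(2)] ind_filtered[OF assms(2)]
      col_diag_functor[OF assms(1,2)] ind_col_colimit[OF assms(1,2)] assms(3)]
  by (auto simp: col_diag_def)

lemma ind_col_ex:
  assumes x: "x \<in> VObj C" and Y: "ind Y" and T: "T \<in> Obj V"
    and q: "\<And>j. j \<in> Obj (Idx Y) \<Longrightarrow> q j \<in> hom V (VHom C x (ind_at Y j)) T"
    and qc: "\<And>b g. b \<in> Arr (Idx Y) \<Longrightarrow> g \<in> cpt C x (ind_at Y (Dom (Idx Y) b)) \<Longrightarrow>
      q (Cod (Idx Y) b) \<cdot> cc C x (ind_at Y (Dom (Idx Y) b)) (ind_at Y (Cod (Idx Y) b)) (tr Y b) g
      = q (Dom (Idx Y) b) \<cdot> g"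
  shows "\<exists>!h. h \<in> hom V (icol x Y) T \<and> (\<forall>j \<in> Obj (Idx Y). h \<cdot> coproj x Y j = q j)"
proof -
  have "is_cocone (Idx Y) V (col_diag x Y) T q"
    unfolding is_cocone_def
  proof (intro conjI ballI T)
    show "q j \<in> hom V (FO (col_diag x Y) j) T" if "j \<in> Obj (Idx Y)" for j
      using q[OF that] by (simp add: col_diag_def)
    fix b assume b: "b \<in> Arr (Idx Y)"
    note h = col_diag_hom[OF x Y b] and qh = q[OF ind_cod[OF Y b]]
    show "q (Cod (Idx Y) b) \<cdot> FA (col_diag x Y) b = q (Dom (Idx Y) b)"
      by (rule pt_ext[OF cmp_hom[OF h qh] q[OF ind_dom[OF Y b]]])
         (simp add: cmp_assoc[OF _ h qh] col_diag_pt[OF x Y b] qc b)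
  qed
  then show ?thesis using ind_col_colimit[OF x Y] by (auto simp: is_colimit_def)
qed

text \<open>The tensor product preserves the colimit, so a compatible family is enough. On points
  its compatibility says that \<open>(t g) f\<close> and \<open>g f\<close> have the same class for
  a transition arrow \<open>t\<close>, which is associativity in \<open>C\<close>.\<close>

lemma ind_act_spec:
  assumes x: "x \<in> VObj C" and y: "y \<in> VObj C" and Z: "ind Z"
  shows "ind_act V C x y Z \<in> hom V (icol y Z \<otimes> VHom C x y) (icol x Z) \<and>
     (\<forall>k \<in> Obj (Idx Z). ind_act V C x y Z \<cdot> (coproj y Z k \<odot> \<iota> (VHom C x y)) =
        coproj x Z k \<cdot> VComp C x y (ind_at Z k))"
  unfolding ind_act_def
proof (rule theI', rule colimit_tens[OF col_diag_functor[OF y Z] ind_col_colimit[OF y Z]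
      vhom_obj[OF vcatC x y] ind_col_obj[OF x Z] ind_category[OF Z]])
  show "coproj x Z j \<cdot> VComp C x y (ind_at Z j) \<in> hom V (FO (col_diag y Z) j \<otimes> VHom C x y) (icol x Z)"
    if "j \<in> Obj (Idx Z)" for j
    using cmp_hom[OF vcomp_hom[OF vcatC x y ind_at_obj[OF Z that]] ind_in_hom[OF x Z that]]
    by (simp add: col_diag_def)
  fix b assume b: "b \<in> Arr (Idx Z)"
  let ?d = "Dom (Idx Z) b" and ?c = "Cod (Idx Z) b"
  note d = ind_dom[OF Z b] and c = ind_cod[OF Z b]
  note od = ind_at_obj[OF Z d] and oc = ind_at_obj[OF Z c]
  note vd = vcomp_hom[OF vcatC x y od] and vc = vcomp_hom[OF vcatC x y oc]
  note hd = cmp_hom[OF vd ind_in_hom[OF x Z d]] and hc = cmp_hom[OF vc ind_in_hom[OF x Z c]]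
  note i = idt_hom[OF vhom_obj[OF vcatC x y]]
  note D = col_diag_hom[OF y Z b]
  show "(coproj x Z ?c \<cdot> VComp C x y (ind_at Z ?c)) \<cdot> (FA (col_diag y Z) b \<odot> \<iota> (VHom C x y))
      = coproj x Z ?d \<cdot> VComp C x y (ind_at Z ?d)"
  proof (rule tens_pt_ext[OF cmp_hom[OF tensA_hom[OF D i] hc] hd vhom_obj[OF vcatC y od] vhom_obj[OF vcatC x y]])
    fix g f assume g: "g \<in> cpt C y (ind_at Z ?d)" and f: "f \<in> cpt C x y"
    have "ap ((coproj x Z ?c \<cdot> VComp C x y (ind_at Z ?c)) \<cdot> (FA (col_diag y Z) b \<odot> \<iota> (VHom C x y))) g f
        = coproj x Z ?c \<cdot> cc C x y (ind_at Z ?c) (cc C y (ind_at Z ?d) (ind_at Z ?c) (tr Z b) g) f"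
      using ap_tensA[OF hc D i g f] idt_cmp[OF f] col_diag_pt[OF y Z b g]
        ap_cmp[OF vc ind_in_hom[OF x Z c] cmp_pt[OF D g] f] by (simp add: cc_def)
    also have "\<dots> = coproj x Z ?d \<cdot> cc C x y (ind_at Z ?d) g f"
      using cc_assoc[OF vcatC x y od oc tr_pt[OF Z b] g f] ind_in_tr[OF x Z b cc_pt[OF vcatC x y od g f]]
      by simp
    also have "\<dots> = ap (coproj x Z ?d \<cdot> VComp C x y (ind_at Z ?d)) g f"
      using ap_cmp[OF vd ind_in_hom[OF x Z d] g f] by (simp add: cc_def)
    finally show "ap ((coproj x Z ?c \<cdot> VComp C x y (ind_at Z ?c)) \<cdot> (FA (col_diag y Z) b \<odot> \<iota> (VHom C x y))) g f
      = ap (coproj x Z ?d \<cdot> VComp C x y (ind_at Z ?d)) g f" .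
  qed
qed

text \<open>The right action of \<open>C\<close> on the presheaf
  \<open>x \<mapsto> icol x Z\<close>: restriction of a class along \<open>f\<close>.\<close>

definition act :: "'c \<Rightarrow> 'c \<Rightarrow> ('u, 'c, 'a) ind_obj \<Rightarrow> 'a \<Rightarrow> 'a \<Rightarrow> 'a" where
  "act x y Z c f = ap (ind_act V C x y Z) c f"

lemma ind_act_hom:
  "x \<in> VObj C \<Longrightarrow> y \<in> VObj C \<Longrightarrow> ind Z \<Longrightarrow>
    ind_act V C x y Z \<in> hom V (icol y Z \<otimes> VHom C x y) (icol x Z)"
  using ind_act_spec by blast

lemma act_pt:
  "x \<in> VObj C \<Longrightarrow> y \<in> VObj C \<Longrightarrow> ind Z \<Longrightarrow> c \<in> pt (icol y Z) \<Longrightarrow> f \<in> cpt C x y \<Longrightarrow>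
    act x y Z c f \<in> pt (icol x Z)"
  unfolding act_def using ap_pt[OF ind_act_hom] .

lemma act_in:
  assumes x: "x \<in> VObj C" and y: "y \<in> VObj C" and Z: "ind Z" and k: "k \<in> Obj (Idx Z)"
    and g: "g \<in> cpt C y (ind_at Z k)" and f: "f \<in> cpt C x y"
  shows "act x y Z (coproj y Z k \<cdot> g) f = coproj x Z k \<cdot> cc C x y (ind_at Z k) g f"
proof -
  have "act x y Z (coproj y Z k \<cdot> g) f = ap (ind_act V C x y Z \<cdot> (coproj y Z k \<odot> \<iota> (VHom C x y))) g f"
    using ap_tensA[OF ind_act_hom[OF x y Z] ind_in_hom[OF y Z k] idt_hom[OF vhom_obj[OF vcatC x y]] g f]
      idt_cmp[OF f] by (simp add: act_def)
  then show ?thesis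
    using ind_act_spec[OF x y Z] k ap_cmp[OF vcomp_hom[OF vcatC x y ind_at_obj[OF Z k]] ind_in_hom[OF x Z k] g f]
    by (simp add: cc_def)
qed

lemma act_act:
  assumes w: "w \<in> VObj C" and x: "x \<in> VObj C" and y: "y \<in> VObj C" and Z: "ind Z"
    and c: "c \<in> pt (icol y Z)" and f: "f \<in> cpt C x y" and e: "e \<in> cpt C w x"
  shows "act w x Z (act x y Z c f) e = act w y Z c (cc C w x y f e)"
proof -
  obtain k g where k: "k \<in> Obj (Idx Z)" and g: "g \<in> cpt C y (ind_at Z k)" "c = coproj y Z k \<cdot> g"
    using ind_col_pt[OF y Z c] .
  note ok = ind_at_obj[OF Z k]
  show ?thesis
    using act_in[OF x y Z k g(1) f] act_in[OF w x Z k cc_pt[OF vcatC x y ok g(1) f] e]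
      act_in[OF w y Z k g(1) cc_pt[OF vcatC w x y f e]] cc_assoc[OF vcatC w x y ok g(1) f e]
    by (simp add: g(2))
qed

lemma act_id:
  assumes x: "x \<in> VObj C" and Z: "ind Z" and c: "c \<in> pt (icol x Z)"
  shows "act x x Z c (VId C x) = c"
proof -
  obtain k g where k: "k \<in> Obj (Idx Z)" and g: "g \<in> cpt C x (ind_at Z k)" "c = coproj x Z k \<cdot> g"
    using ind_col_pt[OF x Z c] .
  show ?thesis
    using act_in[OF x x Z k g(1) vid_pt[OF vcatC x]] cc_idr[OF vcatC x ind_at_obj[OF Z k] g(1)]
    by (simp add: g(2))
qed

lemma ind_col_map_spec:
  assumes x: "x \<in> VObj C" and y: "y \<in> VObj C" and Z: "ind Z" and f: "f \<in> cpt C x y"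
  shows "ind_col_map V C (x, f, y) Z \<in> hom V (icol y Z) (icol x Z) \<and>
     (\<forall>j \<in> Obj (Idx Z). ind_col_map V C (x, f, y) Z \<cdot> coproj y Z j =
        coproj x Z j \<cdot> pre_comp V C (ind_at Z j) (x, f, y))"
  unfolding ind_col_map_def prod.case
proof (rule theI', rule ind_col_ex[OF y Z ind_col_obj[OF x Z]])
  fix j assume j: "j \<in> Obj (Idx Z)"
  show "coproj x Z j \<cdot> pre_comp V C (ind_at Z j) (x, f, y) \<in> hom V (VHom C y (ind_at Z j)) (icol x Z)"
    using cmp_hom[OF pre_comp_hom[OF vcatC x y ind_at_obj[OF Z j] f] ind_in_hom[OF x Z j]] .
next
  fix b g assume b: "b \<in> Arr (Idx Z)" and g: "g \<in> cpt C y (ind_at Z (Dom (Idx Z) b))"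
  let ?d = "Dom (Idx Z) b" and ?c = "Cod (Idx Z) b"
  note d = ind_dom[OF Z b] and c = ind_cod[OF Z b]
  note od = ind_at_obj[OF Z d] and oc = ind_at_obj[OF Z c]
  note tg = cc_pt[OF vcatC y od oc tr_pt[OF Z b] g]
  show "(coproj x Z ?c \<cdot> pre_comp V C (ind_at Z ?c) (x, f, y)) \<cdot> cc C y (ind_at Z ?d) (ind_at Z ?c) (tr Z b) g
     = (coproj x Z ?d \<cdot> pre_comp V C (ind_at Z ?d) (x, f, y)) \<cdot> g"
    using cmp_assoc[OF tg pre_comp_hom[OF vcatC x y oc f] ind_in_hom[OF x Z c]]
      cmp_assoc[OF g pre_comp_hom[OF vcatC x y od f] ind_in_hom[OF x Z d]]
      pre_comp_pt[OF vcatC x y oc f tg] pre_comp_pt[OF vcatC x y od f g]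
      cc_assoc[OF vcatC x y od oc tr_pt[OF Z b] g f] ind_in_tr[OF x Z b cc_pt[OF vcatC x y od g f]]
    by simp
qed

lemma ind_col_map_hom:
  "x \<in> VObj C \<Longrightarrow> y \<in> VObj C \<Longrightarrow> ind Z \<Longrightarrow> f \<in> cpt C x y \<Longrightarrow>
    ind_col_map V C (x, f, y) Z \<in> hom V (icol y Z) (icol x Z)"
  using ind_col_map_spec by blast

text \<open>\<open>ind_col_map\<close> and \<open>ind_act\<close> arise from different universal
  properties, but both send the class of \<open>g\<close> to that of \<open>g f\<close>. From here
  on cone conditions can be phrased with \<open>act\<close>.\<close>

lemma ind_col_map_pt:
  assumes x: "x \<in> VObj C" and y: "y \<in> VObj C" and Z: "ind Z" and f: "f \<in> cpt C x y"
    and c: "c \<in> pt (icol y Z)"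
  shows "ind_col_map V C (x, f, y) Z \<cdot> c = act x y Z c f"
proof -
  obtain k g where k: "k \<in> Obj (Idx Z)" and g: "g \<in> cpt C y (ind_at Z k)" "c = coproj y Z k \<cdot> g"
    using ind_col_pt[OF y Z c] .
  note ok = ind_at_obj[OF Z k]
  have "ind_col_map V C (x, f, y) Z \<cdot> coproj y Z k = coproj x Z k \<cdot> pre_comp V C (ind_at Z k) (x, f, y)"
    using ind_col_map_spec[OF x y Z f] k by blast
  then show ?thesis
    unfolding g(2)
    using cmp_assoc[OF g(1) ind_in_hom[OF y Z k] ind_col_map_hom[OF x y Z f]]
      cmp_assoc[OF g(1) pre_comp_hom[OF vcatC x y ok f] ind_in_hom[OF x Z k]]
      pre_comp_pt[OF vcatC x y ok f g(1)] act_in[OF x y Z k g(1) f] by simp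
qed

section \<open>Hom-objects of the ind-category as limits\<close>

definition hom_diag :: "('u, 'c, 'a) ind_obj \<Rightarrow> ('u, 'c, 'a) ind_obj \<Rightarrow> ('u, 'u, 'o, 'a) ftr" where
  "hom_diag X Y = \<lparr>FO = (\<lambda>i. icol (ind_at X i) Y), FA = (\<lambda>a. ind_col_map V C (FA (Dia X) a) Y)\<rparr>"

lemma hom_diag_hom:
  assumes "ind X" "ind Y" "a \<in> Arr (Idx X)"
  shows "FA (hom_diag X Y) a \<in> hom V (icol (ind_at X (Cod (Idx X) a)) Y) (icol (ind_at X (Dom (Idx X) a)) Y)"
  using ind_col_map_hom[OF ind_at_obj ind_at_obj assms(2) tr_pt] ind_dom ind_cod assms Dia_arr
  by (simp add: hom_diag_def)

lemma hom_diag_pt: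
  assumes "ind X" "ind Y" "a \<in> Arr (Idx X)" "c \<in> pt (icol (ind_at X (Cod (Idx X) a)) Y)"
  shows "FA (hom_diag X Y) a \<cdot> c = act (ind_at X (Dom (Idx X) a)) (ind_at X (Cod (Idx X) a)) Y c (tr X a)"
  using ind_col_map_pt[OF ind_at_obj ind_at_obj assms(2) tr_pt assms(4)] ind_dom ind_cod assms Dia_arr
  by (simp add: hom_diag_def)

lemma hom_op_cat: "hom (op_cat J) x y = hom J y x"
  by (auto simp: hom_def op_cat_def)

lemma hom_diag_functor:
  assumes X: "ind X" and Y: "ind Y"
  shows "is_functor (op_cat (Idx X)) V (hom_diag X Y)"
proof -
  interpret J: category "Idx X" by (rule ind_category[OF X])
  note co = ind_col_obj[OF ind_at_obj[OF X] Y]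
  have FO: "FO (hom_diag X Y) i = icol (ind_at X i) Y" for i by (simp add: hom_diag_def)
  have op: "Obj (op_cat (Idx X)) = Obj (Idx X)" "Arr (op_cat (Idx X)) = Arr (Idx X)"
    "Dom (op_cat (Idx X)) = Cod (Idx X)" "Cod (op_cat (Idx X)) = Dom (Idx X)"
    "Idt (op_cat (Idx X)) = Idt (Idx X)" "Cmp (op_cat (Idx X)) = (\<lambda>g f. f \<cdot>\<^bsub>Idx X\<^esub> g)"
    by (auto simp: op_cat_def)
  show ?thesis
    unfolding is_functor_def FO hom_op_cat op
  proof (intro conjI ballI allI)
    show "icol (ind_at X i) Y \<in> Obj V" if "i \<in> Obj (Idx X)" for i by (rule co[OF that])
    show "FA (hom_diag X Y) a \<in> hom V (icol (ind_at X (Cod (Idx X) a)) Y) (icol (ind_at X (Dom (Idx X) a)) Y)"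
      if "a \<in> Arr (Idx X)" for a by (rule hom_diag_hom[OF X Y that])
    fix j assume j: "j \<in> Obj (Idx X)"
    have ij: "\<iota>\<^bsub>Idx X\<^esub> j \<in> Arr (Idx X)" "Dom (Idx X) (\<iota>\<^bsub>Idx X\<^esub> j) = j" "Cod (Idx X) (\<iota>\<^bsub>Idx X\<^esub> j) = j"
      using J.idt_hom[OF j] by (auto simp: hom_def)
    show "FA (hom_diag X Y) (\<iota>\<^bsub>Idx X\<^esub> j) = \<iota> (icol (ind_at X j) Y)"
    proof (rule pt_ext[OF _ idt_hom[OF co[OF j]]])
      show "FA (hom_diag X Y) (\<iota>\<^bsub>Idx X\<^esub> j) \<in> hom V (icol (ind_at X j) Y) (icol (ind_at X j) Y)"
        using hom_diag_hom[OF X Y ij(1)] ij by simp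
      fix c assume c: "c \<in> pt (icol (ind_at X j) Y)"
      show "FA (hom_diag X Y) (\<iota>\<^bsub>Idx X\<^esub> j) \<cdot> c = \<iota> (icol (ind_at X j) Y) \<cdot> c"
        using hom_diag_pt[OF X Y ij(1)] c ij tr_idt[OF X j] act_id[OF ind_at_obj[OF X j] Y c] idt_cmp[OF c]
        by simp
    qed
  next
    fix k j i g f assume g: "g \<in> hom (Idx X) j k" and f: "f \<in> hom (Idx X) i j"
    have fg: "f \<in> Arr (Idx X)" "g \<in> Arr (Idx X)" "Dom (Idx X) f = i" "Cod (Idx X) f = j"
      "Dom (Idx X) g = j" "Cod (Idx X) g = k" using f g by (auto simp: hom_def)
    have gf: "g \<cdot>\<^bsub>Idx X\<^esub> f \<in> Arr (Idx X)" "Dom (Idx X) (g \<cdot>\<^bsub>Idx X\<^esub> f) = i" "Cod (Idx X) (g \<cdot>\<^bsub>Idx X\<^esub> f) = k"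
      using J.cmp_hom[OF f g] by (auto simp: hom_def)
    have ijk: "i \<in> Obj (Idx X)" "j \<in> Obj (Idx X)" "k \<in> Obj (Idx X)"
      using f g J.hom_dom_obj J.hom_cod_obj by auto
    note o = ind_at_obj[OF X ijk(1)] ind_at_obj[OF X ijk(2)] ind_at_obj[OF X ijk(3)]
    let ?c = "\<lambda>i. icol (ind_at X i) Y" and ?D = "FA (hom_diag X Y)"
    have F: "?D f \<in> hom V (?c j) (?c i)" and G: "?D g \<in> hom V (?c k) (?c j)"
      and GF: "?D (g \<cdot>\<^bsub>Idx X\<^esub> f) \<in> hom V (?c k) (?c i)"
      using hom_diag_hom[OF X Y fg(1)] hom_diag_hom[OF X Y fg(2)] hom_diag_hom[OF X Y gf(1)] fg gf by simp_all
    have t: "tr X f \<in> cpt C (ind_at X i) (ind_at X j)" "tr X g \<in> cpt C (ind_at X j) (ind_at X k)"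
      using tr_pt[OF X fg(1)] tr_pt[OF X fg(2)] fg by simp_all
    show "?D (g \<cdot>\<^bsub>Idx X\<^esub> f) = ?D f \<cdot> ?D g"
    proof (rule pt_ext[OF GF cmp_hom[OF G F]])
      fix h assume h: "h \<in> pt (?c k)"
      have gh: "?D g \<cdot> h = act (ind_at X j) (ind_at X k) Y h (tr X g)"
        using hom_diag_pt[OF X Y fg(2)] h fg by simp
      have "?D f \<cdot> (?D g \<cdot> h) = act (ind_at X i) (ind_at X j) Y (act (ind_at X j) (ind_at X k) Y h (tr X g)) (tr X f)"
        unfolding gh using hom_diag_pt[OF X Y fg(1)] act_pt[OF o(2,3) Y h t(2)] fg by simp
      moreover have "?D (g \<cdot>\<^bsub>Idx X\<^esub> f) \<cdot> h = act (ind_at X i) (ind_at X k) Y h (tr X (g \<cdot>\<^bsub>Idx X\<^esub> f))"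
        using hom_diag_pt[OF X Y gf(1)] h gf by simp
      ultimately show "?D (g \<cdot>\<^bsub>Idx X\<^esub> f) \<cdot> h = (?D f \<cdot> ?D g) \<cdot> h"
        using act_act[OF o Y h t(2,1)] tr_cmp[OF X f g] cmp_assoc[OF h G F] by simp
    qed
  qed
qed

lemma ind_hom_limit:
  assumes "ind X" "ind Y"
  shows "is_limit (op_cat (Idx X)) V (hom_diag X Y) (ihom X Y) (proj X Y)"
proof -
  have "small_category (op_cat (Idx X))"
    using ind_small[OF assms(1)] op_cat_category by (auto simp: small_category_def op_cat_def)
  then have "\<exists>L p. is_limit (op_cat (Idx X)) V (hom_diag X Y) L p"
    using bicomp hom_diag_functor[OF assms] unfolding bicomplete_def by blast
  then obtain L p where "is_limit (op_cat (Idx X)) V (hom_diag X Y) L p" by blast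
  then have "(\<lambda>(L, p). is_limit (op_cat (Idx X)) V (hom_diag X Y) L p) (L, p)" by simp
  then have "(\<lambda>(L, p). is_limit (op_cat (Idx X)) V (hom_diag X Y) L p) (limit_of (op_cat (Idx X)) V (hom_diag X Y))"
    unfolding limit_of_def by (rule someI)
  then show ?thesis
    by (simp add: ind_hom_def ind_proj_def ind_hom_pair_def hom_diag_def split_beta)
qed

lemma
  assumes "ind X" "ind Y"
  shows ind_hom_obj: "ihom X Y \<in> Obj V"
    and ind_proj_hom: "i \<in> Obj (Idx X) \<Longrightarrow> proj X Y i \<in> hom V (ihom X Y) (icol (ind_at X i) Y)"
  using ind_hom_limit[OF assms] by (auto simp: is_limit_def is_cone_def hom_diag_def op_cat_def)

lemma ind_proj_pt:
  "ind X \<Longrightarrow> ind Y \<Longrightarrow> i \<in> Obj (Idx X) \<Longrightarrow> u \<in> pt (ihom X Y) \<Longrightarrow>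
    proj X Y i \<cdot> u \<in> pt (icol (ind_at X i) Y)"
  using cmp_pt[OF ind_proj_hom] .

lemma ind_proj_tr:
  assumes X: "ind X" and Y: "ind Y" and a: "a \<in> Arr (Idx X)" and u: "u \<in> pt (ihom X Y)"
  shows "act (ind_at X (Dom (Idx X) a)) (ind_at X (Cod (Idx X) a)) Y (proj X Y (Cod (Idx X) a) \<cdot> u) (tr X a)
    = proj X Y (Dom (Idx X) a) \<cdot> u"
proof -
  note c = ind_cod[OF X a]
  have "FA (hom_diag X Y) a \<cdot> proj X Y (Cod (Idx X) a) = proj X Y (Dom (Idx X) a)"
    using ind_hom_limit[OF X Y] a by (auto simp: is_limit_def is_cone_def op_cat_def)
  then show ?thesis
    using cmp_assoc[OF u ind_proj_hom[OF X Y c] hom_diag_hom[OF X Y a]]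
      hom_diag_pt[OF X Y a ind_proj_pt[OF X Y c u]] by simp
qed

text \<open>Compatibility is kept as an equation of arrows because for \<open>T\<close> a tensor
  product it is checked on pairs of points, not on all points; \<open>ind_hom_ex_pt\<close> is the
  form for the remaining cases.\<close>

lemma ind_hom_ex:
  assumes X: "ind X" and Y: "ind Y" and T: "T \<in> Obj V"
    and p: "\<And>i. i \<in> Obj (Idx X) \<Longrightarrow> p i \<in> hom V T (icol (ind_at X i) Y)"
    and pc: "\<And>a t. a \<in> Arr (Idx X) \<Longrightarrow> 
      ind_col_map V C (ind_at X (Dom (Idx X) a), tr X a, ind_at X (Cod (Idx X) a)) Y \<cdot> p (Cod (Idx X) a) = p (Dom (Idx X) a)"
  shows "\<exists>!h. h \<in> hom V T (ihom X Y) \<and> (\<forall>i \<in> Obj (Idx X). proj X Y i \<cdot> h = p i)"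
proof -
  have "is_cone (op_cat (Idx X)) V (hom_diag X Y) T p"
    unfolding is_cone_def using T p pc Dia_arr[OF X] by (auto simp: op_cat_def hom_diag_def)
  then show ?thesis using ind_hom_limit[OF X Y] by (auto simp: is_limit_def op_cat_def)
qed

lemma ind_hom_ex_pt:
  assumes X: "ind X" and Y: "ind Y" and T: "T \<in> Obj V"
    and p: "\<And>i. i \<in> Obj (Idx X) \<Longrightarrow> p i \<in> hom V T (icol (ind_at X i) Y)"
    and pc: "\<And>a t. a \<in> Arr (Idx X) \<Longrightarrow> t \<in> pt T \<Longrightarrow>
      act (ind_at X (Dom (Idx X) a)) (ind_at X (Cod (Idx X) a)) Y (p (Cod (Idx X) a) \<cdot> t) (tr X a) = p (Dom (Idx X) a) \<cdot> t"
  shows "\<exists>!h. h \<in> hom V T (ihom X Y) \<and> (\<forall>i \<in> Obj (Idx X). proj X Y i \<cdot> h = p i)"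
proof (rule ind_hom_ex[OF X Y T p])
  fix a assume a: "a \<in> Arr (Idx X)"
  note d = ind_dom[OF X a] and c = ind_cod[OF X a]
  note m = ind_col_map_hom[OF ind_at_obj[OF X d] ind_at_obj[OF X c] Y tr_pt[OF X a]]
  show "ind_col_map V C (ind_at X (Dom (Idx X) a), tr X a, ind_at X (Cod (Idx X) a)) Y \<cdot> p (Cod (Idx X) a) = p (Dom (Idx X) a)"
  proof (rule pt_ext[OF cmp_hom[OF p[OF c] m] p[OF d]])
    fix t assume t: "t \<in> pt T"
    show "(ind_col_map V C (ind_at X (Dom (Idx X) a), tr X a, ind_at X (Cod (Idx X) a)) Y \<cdot> p (Cod (Idx X) a)) \<cdot> t = p (Dom (Idx X) a) \<cdot> t"
      using cmp_assoc[OF t p[OF c] m] pc[OF a t]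
        ind_col_map_pt[OF ind_at_obj[OF X d] ind_at_obj[OF X c] Y tr_pt[OF X a] cmp_pt[OF p[OF c] t]] by simp
  qed
qed

text \<open>The projections of a limit are jointly monic: \<open>h\<close> and \<open>h'\<close>
  both factor the cone of components of \<open>h'\<close>.\<close>

lemma ind_hom_ext:
  assumes X: "ind X" and Y: "ind Y" and h: "h \<in> hom V T (ihom X Y)" and h': "h' \<in> hom V T (ihom X Y)"
    and eq: "\<And>i. i \<in> Obj (Idx X) \<Longrightarrow> proj X Y i \<cdot> h = proj X Y i \<cdot> h'"
  shows "h = h'"
proof -
  let ?p = "\<lambda>i. proj X Y i \<cdot> h'"
  have "\<exists>!h. h \<in> hom V T (ihom X Y) \<and> (\<forall>i \<in> Obj (Idx X). proj X Y i \<cdot> h = ?p i)"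
  proof (rule ind_hom_ex_pt[OF X Y])
    show "T \<in> Obj V" using h hom_dom_obj by blast
    show "?p i \<in> hom V T (icol (ind_at X i) Y)" if "i \<in> Obj (Idx X)" for i
      using cmp_hom[OF h' ind_proj_hom[OF X Y that]] .
    fix a t assume a: "a \<in> Arr (Idx X)" and t: "t \<in> pt T"
    note d = ind_dom[OF X a] and c = ind_cod[OF X a]
    show "act (ind_at X (Dom (Idx X) a)) (ind_at X (Cod (Idx X) a)) Y (?p (Cod (Idx X) a) \<cdot> t) (tr X a) = ?p (Dom (Idx X) a) \<cdot> t"
      using cmp_assoc[OF t h' ind_proj_hom[OF X Y c]] cmp_assoc[OF t h' ind_proj_hom[OF X Y d]]
        ind_proj_tr[OF X Y a cmp_pt[OF h' t]] by simp
  qed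
  then show ?thesis using h h' eq by blast
qed

text \<open>The components are compatible because both sides are the class of the transition arrow:
  restricting the identity at its target gives it, and so does moving the identity at its source
  along the diagram.\<close>

lemma ind_id_spec:
  assumes X: "ind X"
  shows "ind_id V C X \<in> pt (ihom X X) \<and>
     (\<forall>i \<in> Obj (Idx X). proj X X i \<cdot> ind_id V C X = coproj (ind_at X i) X i \<cdot> VId C (ind_at X i))"
  unfolding ind_id_def
proof (rule theI', rule ind_hom_ex[OF X X unit_obj])
  note o = ind_at_obj[OF X]
  show "coproj (ind_at X i) X i \<cdot> VId C (ind_at X i) \<in> pt (icol (ind_at X i) X)" if "i \<in> Obj (Idx X)" for i
    using ind_in_pt[OF o[OF that] X that vid_pt[OF vcatC o[OF that]]] .
  fix a assume a: "a \<in> Arr (Idx X)"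
  let ?d = "Dom (Idx X) a" and ?c = "Cod (Idx X) a"
  note d = ind_dom[OF X a] and c = ind_cod[OF X a]
  note t = tr_pt[OF X a] and i = vid_pt[OF vcatC o[OF c]] and id = vid_pt[OF vcatC o[OF d]]
  have "ind_col_map V C (ind_at X ?d, tr X a, ind_at X ?c) X \<cdot> (coproj (ind_at X ?c) X ?c \<cdot> VId C (ind_at X ?c))
     = coproj (ind_at X ?d) X ?c \<cdot> tr X a"
    using ind_col_map_pt[OF o[OF d] o[OF c] X t ind_in_pt[OF o[OF c] X c i]]
      act_in[OF o[OF d] o[OF c] X c i t] cc_idl[OF vcatC o[OF d] o[OF c] t] by simp
  also have "\<dots> = coproj (ind_at X ?d) X ?d \<cdot> VId C (ind_at X ?d)"
    using ind_in_tr[OF o[OF d] X a id] cc_idr[OF vcatC o[OF d] o[OF c] t] by simp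
  finally show "ind_col_map V C (ind_at X ?d, tr X a, ind_at X ?c) X \<cdot> (coproj (ind_at X ?c) X ?c \<cdot> VId C (ind_at X ?c))
     = coproj (ind_at X ?d) X ?d \<cdot> VId C (ind_at X ?d)" .
qed

text \<open>On points, \<open>u\<close> sends the class of
  \<open>g : x \<rightarrow> Y\<^sub>j\<close> to its own component at \<open>j\<close> restricted
  along \<open>g\<close>. Another representative gives the same result since the components of
  \<open>u\<close> are compatible (\<open>ind_proj_tr\<close>).\<close>

lemma ind_act2_spec:
  assumes x: "x \<in> VObj C" and Y: "ind Y" and Z: "ind Z"
  shows "ind_act2 V C x Y Z \<in> hom V (ihom Y Z \<otimes> icol x Y) (icol x Z) \<and>
     (\<forall>j \<in> Obj (Idx Y). ind_act2 V C x Y Z \<cdot> (\<iota> (ihom Y Z) \<odot> coproj x Y j) =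
        ind_act V C x (ind_at Y j) Z \<cdot> (proj Y Z j \<odot> \<iota> (VHom C x (ind_at Y j))))"
  unfolding ind_act2_def
proof (rule theI', rule colimit_tens'[OF col_diag_functor[OF x Y] ind_col_colimit[OF x Y]
      ind_hom_obj[OF Y Z] ind_col_obj[OF x Z] ind_category[OF Y]])
  note o = ind_at_obj[OF Y] and P = ind_proj_hom[OF Y Z] and H = ind_hom_obj[OF Y Z]
  let ?q = "\<lambda>j. ind_act V C x (ind_at Y j) Z \<cdot> (proj Y Z j \<odot> \<iota> (VHom C x (ind_at Y j)))"
  have q: "?q j \<in> hom V (ihom Y Z \<otimes> VHom C x (ind_at Y j)) (icol x Z)" if j: "j \<in> Obj (Idx Y)" for j
    using cmp_hom[OF tensA_hom[OF P[OF j] idt_hom[OF vhom_obj[OF vcatC x o[OF j]]]] ind_act_hom[OF x o[OF j] Z]] .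
  then show "?q j \<in> hom V (ihom Y Z \<otimes> FO (col_diag x Y) j) (icol x Z)" if "j \<in> Obj (Idx Y)" for j
    using that by (simp add: col_diag_def)
  have qp: "ap (?q j) u g = act x (ind_at Y j) Z (proj Y Z j \<cdot> u) g"
    if j: "j \<in> Obj (Idx Y)" and u: "u \<in> pt (ihom Y Z)" and g: "g \<in> cpt C x (ind_at Y j)" for j u g
    using ap_tensA[OF ind_act_hom[OF x o[OF j] Z] P[OF j] idt_hom[OF vhom_obj[OF vcatC x o[OF j]]] u g]
      idt_cmp[OF g] by (simp add: act_def)
  fix b assume b: "b \<in> Arr (Idx Y)"
  let ?d = "Dom (Idx Y) b" and ?c = "Cod (Idx Y) b"
  note d = ind_dom[OF Y b] and c = ind_cod[OF Y b] and D = col_diag_hom[OF x Y b]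
  show "?q ?c \<cdot> (\<iota> (ihom Y Z) \<odot> FA (col_diag x Y) b) = ?q ?d"
  proof (rule tens_pt_ext[OF cmp_hom[OF tensA_hom[OF idt_hom[OF H] D] q[OF c]] q[OF d] H vhom_obj[OF vcatC x o[OF d]]])
    fix u g assume u: "u \<in> pt (ihom Y Z)" and g: "g \<in> cpt C x (ind_at Y ?d)"
    note tg = cc_pt[OF vcatC x o[OF d] o[OF c] tr_pt[OF Y b] g]
    have "ap (?q ?c \<cdot> (\<iota> (ihom Y Z) \<odot> FA (col_diag x Y) b)) u g = ap (?q ?c) u (cc C x (ind_at Y ?d) (ind_at Y ?c) (tr Y b) g)"
      using ap_tensA[OF q[OF c] idt_hom[OF H] D u g] idt_cmp[OF u] col_diag_pt[OF x Y b g] by simp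
    also have "\<dots> = act x (ind_at Y ?d) Z (proj Y Z ?d \<cdot> u) g"
      unfolding qp[OF c u tg] using act_act[OF x o[OF d] o[OF c] Z ind_proj_pt[OF Y Z c u] tr_pt[OF Y b] g]
        ind_proj_tr[OF Y Z b u] by simp
    also have "\<dots> = ap (?q ?d) u g" using qp[OF d u g] by simp
    finally show "ap (?q ?c \<cdot> (\<iota> (ihom Y Z) \<odot> FA (col_diag x Y) b)) u g = ap (?q ?d) u g" .
  qed
qed

text \<open>Postcomposition with an arrow \<open>u\<close> of ind-objects, acting on generalised
  elements of \<open>Y\<close> at \<open>x\<close>.\<close>

definition act2 :: "'c \<Rightarrow> ('u, 'c, 'a) ind_obj \<Rightarrow> ('u, 'c, 'a) ind_obj \<Rightarrow> 'a \<Rightarrow> 'a \<Rightarrow> 'a" where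
  "act2 x Y Z u c = ap (ind_act2 V C x Y Z) u c"

lemma ind_act2_hom:
  "x \<in> VObj C \<Longrightarrow> ind Y \<Longrightarrow> ind Z \<Longrightarrow>
    ind_act2 V C x Y Z \<in> hom V (ihom Y Z \<otimes> icol x Y) (icol x Z)"
  using ind_act2_spec by blast

lemma act2_pt:
  "x \<in> VObj C \<Longrightarrow> ind Y \<Longrightarrow> ind Z \<Longrightarrow> u \<in> pt (ihom Y Z) \<Longrightarrow> c \<in> pt (icol x Y) \<Longrightarrow>
    act2 x Y Z u c \<in> pt (icol x Z)"
  unfolding act2_def using ap_pt[OF ind_act2_hom] .

lemma act2_in:
  assumes x: "x \<in> VObj C" and Y: "ind Y" and Z: "ind Z" and u: "u \<in> pt (ihom Y Z)"
    and j: "j \<in> Obj (Idx Y)" and g: "g \<in> cpt C x (ind_at Y j)"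
  shows "act2 x Y Z u (coproj x Y j \<cdot> g) = act x (ind_at Y j) Z (proj Y Z j \<cdot> u) g"
proof -
  note o = ind_at_obj[OF Y j]
  have "act2 x Y Z u (coproj x Y j \<cdot> g) = ap (ind_act2 V C x Y Z \<cdot> (\<iota> (ihom Y Z) \<odot> coproj x Y j)) u g"
    using ap_tensA[OF ind_act2_hom[OF x Y Z] idt_hom[OF ind_hom_obj[OF Y Z]] ind_in_hom[OF x Y j] u g]
      idt_cmp[OF u] by (simp add: act2_def)
  also have "\<dots> = ap (ind_act V C x (ind_at Y j) Z \<cdot> (proj Y Z j \<odot> \<iota> (VHom C x (ind_at Y j)))) u g"
    using ind_act2_spec[OF x Y Z] j by simp
  also have "\<dots> = act x (ind_at Y j) Z (proj Y Z j \<cdot> u) g"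
    using ap_tensA[OF ind_act_hom[OF x o Z] ind_proj_hom[OF Y Z j] idt_hom[OF vhom_obj[OF vcatC x o]] u g]
      idt_cmp[OF g] by (simp add: act_def)
  finally show ?thesis .
qed

text \<open>Precomposition and postcomposition commute, i.e. \<open>u\<close> acts naturally in
  \<open>x\<close>; a representative reduces this to \<open>act_act\<close>. Both the existence of
  composition and its associativity rest on it.\<close>

lemma act_act2:
  assumes x: "x \<in> VObj C" and y: "y \<in> VObj C" and Y: "ind Y" and Z: "ind Z"
    and u: "u \<in> pt (ihom Y Z)" and c: "c \<in> pt (icol y Y)" and f: "f \<in> cpt C x y"
  shows "act x y Z (act2 y Y Z u c) f = act2 x Y Z u (act x y Y c f)"
proof -
  obtain j g where j: "j \<in> Obj (Idx Y)" and g: "g \<in> cpt C y (ind_at Y j)" "c = coproj y Y j \<cdot> g"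
    using ind_col_pt[OF y Y c] .
  note o = ind_at_obj[OF Y j]
  show ?thesis
    unfolding g(2) act2_in[OF y Y Z u j g(1)] act_in[OF x y Y j g(1) f]
      act2_in[OF x Y Z u j cc_pt[OF vcatC x y o g(1) f]]
    by (rule act_act[OF x y o Z ind_proj_pt[OF Y Z j u] g(1) f])
qed

text \<open>The components \<open>u v\<^sub>i\<close> form a cone because those of \<open>v\<close>
  do and \<open>u\<close> acts naturally.\<close>

lemma ind_comp_spec:
  assumes X: "ind X" and Y: "ind Y" and Z: "ind Z"
  shows "ind_comp V C X Y Z \<in> hom V (ihom Y Z \<otimes> ihom X Y) (ihom X Z) \<and>
     (\<forall>i \<in> Obj (Idx X). proj X Z i \<cdot> ind_comp V C X Y Z =
        ind_act2 V C (ind_at X i) Y Z \<cdot> (\<iota> (ihom Y Z) \<odot> proj X Y i))"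
  unfolding ind_comp_def
proof (rule theI', rule ind_hom_ex[OF X Z tens_obj[OF ind_hom_obj[OF Y Z] ind_hom_obj[OF X Y]]])
  note o = ind_at_obj[OF X] and P = ind_proj_hom[OF X Y] and H = ind_hom_obj[OF Y Z] and K = ind_hom_obj[OF X Y]
  let ?p = "\<lambda>i. ind_act2 V C (ind_at X i) Y Z \<cdot> (\<iota> (ihom Y Z) \<odot> proj X Y i)"
  show p: "?p i \<in> hom V (ihom Y Z \<otimes> ihom X Y) (icol (ind_at X i) Z)" if i: "i \<in> Obj (Idx X)" for i
    using cmp_hom[OF tensA_hom[OF idt_hom[OF H] P[OF i]] ind_act2_hom[OF o[OF i] Y Z]] .
  have pp: "ap (?p i) u v = act2 (ind_at X i) Y Z u (proj X Y i \<cdot> v)"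
    if i: "i \<in> Obj (Idx X)" and u: "u \<in> pt (ihom Y Z)" and v: "v \<in> pt (ihom X Y)" for i u v
    using ap_tensA[OF ind_act2_hom[OF o[OF i] Y Z] idt_hom[OF H] P[OF i] u v] idt_cmp[OF u]
    by (simp add: act2_def)
  fix a assume a: "a \<in> Arr (Idx X)"
  let ?d = "Dom (Idx X) a" and ?c = "Cod (Idx X) a"
  note d = ind_dom[OF X a] and c = ind_cod[OF X a]
  note t = tr_pt[OF X a]
  note m = ind_col_map_hom[OF o[OF d] o[OF c] Z t]
  show "ind_col_map V C (ind_at X ?d, tr X a, ind_at X ?c) Z \<cdot> ?p ?c = ?p ?d"
  proof (rule tens_pt_ext[OF cmp_hom[OF p[OF c] m] p[OF d] H K])
    fix u v assume u: "u \<in> pt (ihom Y Z)" and v: "v \<in> pt (ihom X Y)"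
    note vc = ind_proj_pt[OF X Y c v]
    show "ap (ind_col_map V C (ind_at X ?d, tr X a, ind_at X ?c) Z \<cdot> ?p ?c) u v = ap (?p ?d) u v"
      unfolding ap_cmp[OF p[OF c] m u v] pp[OF c u v] pp[OF d u v]
        ind_col_map_pt[OF o[OF d] o[OF c] Z t act2_pt[OF o[OF c] Y Z u vc]]
        act_act2[OF o[OF d] o[OF c] Y Z u vc t] ind_proj_tr[OF X Y a v] ..
  qed
qed

section \<open>The enriched category of ind-objects\<close>

abbreviation Ind :: "(('u, 'c, 'a) ind_obj, 'o, 'a) vcat" where
  "Ind \<equiv> ind_cat TYPE('u) V C"

lemma Ind_simps: "VObj Ind = {X. ind X}" "VHom Ind = ihom" "VId Ind = ind_id V C" "VComp Ind = ind_comp V C"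
  by (simp_all add: ind_cat_def)

lemma ind_proj_cc:
  assumes X: "ind X" and Y: "ind Y" and Z: "ind Z"
    and u: "u \<in> pt (ihom Y Z)" and v: "v \<in> pt (ihom X Y)" and i: "i \<in> Obj (Idx X)"
  shows "proj X Z i \<cdot> cc Ind X Y Z u v = act2 (ind_at X i) Y Z u (proj X Y i \<cdot> v)"
proof -
  note c = ind_comp_spec[OF X Y Z]
  have "proj X Z i \<cdot> cc Ind X Y Z u v = ap (proj X Z i \<cdot> ind_comp V C X Y Z) u v"
    using ap_cmp[OF conjunct1[OF c] ind_proj_hom[OF X Z i] u v] by (simp add: cc_def Ind_simps)
  also have "\<dots> = ap (ind_act2 V C (ind_at X i) Y Z \<cdot> (\<iota> (ihom Y Z) \<odot> proj X Y i)) u v"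
    using c i by simp
  also have "\<dots> = act2 (ind_at X i) Y Z u (proj X Y i \<cdot> v)"
    using ap_tensA[OF ind_act2_hom[OF ind_at_obj[OF X i] Y Z] idt_hom[OF ind_hom_obj[OF Y Z]] ind_proj_hom[OF X Y i] u v]
      idt_cmp[OF u] by (simp add: act2_def)
  finally show ?thesis .
qed

lemma Ind_cc_pt:
  assumes "ind X" "ind Y" "ind Z" "u \<in> pt (ihom Y Z)" "v \<in> pt (ihom X Y)"
  shows "cc Ind X Y Z u v \<in> pt (ihom X Z)"
  unfolding cc_def Ind_simps using ap_pt[OF conjunct1[OF ind_comp_spec[OF assms(1-3)]] assms(4,5)] .

lemma Ind_vcategory: "vcategory V Ind"
proof (rule vcategoryI, unfold Ind_simps mem_Collect_eq)
  show "ihom X Y \<in> Obj V" if "ind X" "ind Y" for X Y by (rule ind_hom_obj[OF that])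
  show "ind_id V C X \<in> pt (ihom X X)" if "ind X" for X using ind_id_spec[OF that] by blast
  show "ind_comp V C X Y Z \<in> hom V (ihom Y Z \<otimes> ihom X Y) (ihom X Z)"
    if "ind X" "ind Y" "ind Z" for X Y Z using ind_comp_spec[OF that] by blast
next
  fix W X Y Z w u v assume W: "ind W" and X: "ind X" and Y: "ind Y" and Z: "ind Z"
    and w: "w \<in> pt (ihom Y Z)" and u: "u \<in> pt (ihom X Y)" and v: "v \<in> pt (ihom W X)"
  note wu = Ind_cc_pt[OF X Y Z w u] and uv = Ind_cc_pt[OF W X Y u v]
  show "cc Ind W X Z (cc Ind X Y Z w u) v = cc Ind W Y Z w (cc Ind W X Y u v)"
  proof (rule ind_hom_ext[OF W Z Ind_cc_pt[OF W X Z wu v] Ind_cc_pt[OF W Y Z w uv]])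
    fix i assume i: "i \<in> Obj (Idx W)"
    note oi = ind_at_obj[OF W i]
    \<comment> \<open>A representative of the component of \<open>v\<close> replaces the innermost
      factor by an arrow of \<open>C\<close>; associativity then is the compatibility of the two
      actions.\<close>
    obtain j g where j: "j \<in> Obj (Idx X)" and g: "g \<in> cpt C (ind_at W i) (ind_at X j)"
        "proj W X i \<cdot> v = coproj (ind_at W i) X j \<cdot> g"
      using ind_col_pt[OF oi X ind_proj_pt[OF W X i v]] .
    note oj = ind_at_obj[OF X j]
    show "proj W Z i \<cdot> cc Ind W X Z (cc Ind X Y Z w u) v = proj W Z i \<cdot> cc Ind W Y Z w (cc Ind W X Y u v)"
      unfolding ind_proj_cc[OF W X Z wu v i] ind_proj_cc[OF W Y Z w uv i] ind_proj_cc[OF W X Y u v i] g(2)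
        act2_in[OF oi X Z wu j g(1)] act2_in[OF oi X Y u j g(1)] ind_proj_cc[OF X Y Z w u j]
      by (rule act_act2[OF oi oj Y Z w ind_proj_pt[OF X Y j u] g(1)])
  qed
next
  fix X Y u assume X: "ind X" and Y: "ind Y" and u: "u \<in> pt (ihom X Y)"
  have iX: "ind_id V C X \<in> pt (ihom X X)" and iY: "ind_id V C Y \<in> pt (ihom Y Y)"
    using ind_id_spec X Y by blast+
  show "cc Ind X Y Y (ind_id V C Y) u = u"
  proof (rule ind_hom_ext[OF X Y Ind_cc_pt[OF X Y Y iY u] u])
    fix i assume i: "i \<in> Obj (Idx X)"
    note oi = ind_at_obj[OF X i]
    obtain j g where j: "j \<in> Obj (Idx Y)" and g: "g \<in> cpt C (ind_at X i) (ind_at Y j)"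
        "proj X Y i \<cdot> u = coproj (ind_at X i) Y j \<cdot> g"
      using ind_col_pt[OF oi Y ind_proj_pt[OF X Y i u]] .
    note oj = ind_at_obj[OF Y j]
    have "proj Y Y j \<cdot> ind_id V C Y = coproj (ind_at Y j) Y j \<cdot> VId C (ind_at Y j)"
      using ind_id_spec[OF Y] j by blast
    then show "proj X Y i \<cdot> cc Ind X Y Y (ind_id V C Y) u = proj X Y i \<cdot> u"
      unfolding ind_proj_cc[OF X Y Y iY u i] g(2) act2_in[OF oi Y Y iY j g(1)]
      using act_in[OF oi oj Y j vid_pt[OF vcatC oj] g(1)] cc_idl[OF vcatC oi oj g(1)] by simp
  qed
  show "cc Ind X X Y u (ind_id V C X) = u"
  proof (rule ind_hom_ext[OF X Y Ind_cc_pt[OF X X Y u iX] u])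
    fix i assume i: "i \<in> Obj (Idx X)"
    note oi = ind_at_obj[OF X i]
    have "proj X X i \<cdot> ind_id V C X = coproj (ind_at X i) X i \<cdot> VId C (ind_at X i)"
      using ind_id_spec[OF X] i by blast
    then show "proj X Y i \<cdot> cc Ind X X Y u (ind_id V C X) = proj X Y i \<cdot> u"
      unfolding ind_proj_cc[OF X X Y u iX i]
      using act2_in[OF oi X Y u i vid_pt[OF vcatC oi]] act_id[OF oi Y ind_proj_pt[OF X Y i u]] by simp
  qed
qed

end

section \<open>The embedding of the base category\<close>

context ind_base begin

abbreviation K :: "'c \<Rightarrow> ('u, 'c, 'a) ind_obj" where
  "K x \<equiv> const_ind_obj C x"

lemma K_simps: "Obj (Idx (K x)) = {undefined}" "Arr (Idx (K x)) = {undefined}"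
    "Dom (Idx (K x)) a = undefined" "Cod (Idx (K x)) a = undefined" "ind_at (K x) i = x" "tr (K x) a = VId C x"
  by (simp_all add: const_ind_obj_def tr_def)

text \<open>The assumption \<open>inf\<close> makes the universe uncountable, so images of the
  naturals are small. The one-object index category and \<open>omega_cat\<close> are small for this
  reason.\<close>

lemma nat_small: "small (range (e :: nat \<Rightarrow> 'u))"
proof -
  have "range e \<lesssim> (UNIV :: nat set)" by (rule image_lepoll)
  then show ?thesis unfolding small_def using inf lepoll_iff_leqpoll by (meson lesspoll_trans1)
qed

lemma K_ind:
  assumes x: "x \<in> VObj C"
  shows "ind (K x)"
proof -
  have c: "category (Idx (K x))"
    by unfold_locales (auto simp: const_ind_obj_def hom_def)
  \<comment> \<open>A singleton is presented as the range of a constant sequence to obtain its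
    smallness from \<open>nat_small\<close>.\<close>
  have "{undefined :: 'u} = range (\<lambda>_ :: nat. undefined)" by auto
  then have s: "small {undefined :: 'u}" using nat_small by metis
  have f: "filtered (Idx (K x))" by (auto simp: filtered_def const_ind_obj_def hom_def)
  have "is_functor (Idx (K x)) (underlying V C) (Dia (K x))"
    using x vid_pt[OF vcatC x] cc_idl[OF vcatC x x vid_pt[OF vcatC x]]
    by (auto simp: is_functor_def const_ind_obj_def hom_def[of "underlying V C"] underlying_cmp)
       (auto simp: underlying_def)
  then show ?thesis
    using c f s by (auto simp: is_ind_obj_def small_category_def K_simps)
qed

lemma K_proj_hom:
  "x \<in> VObj C \<Longrightarrow> ind Z \<Longrightarrow> proj (K x) Z undefined \<in> hom V (ihom (K x) Z) (icol x Z)"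
  using ind_proj_hom[OF K_ind, of x Z undefined] by (simp add: K_simps)

text \<open>A limit over one object with its identity is that object, so the only projection
  identifies \<open>ihom (K x) Z\<close> with \<open>icol x Z\<close>. Arrows out of
  \<open>K x\<close> are handled through this identification.\<close>

lemma K_hom_ex:
  assumes x: "x \<in> VObj C" and Z: "ind Z" and p: "p \<in> hom V T (icol x Z)"
  shows "\<exists>!h. h \<in> hom V T (ihom (K x) Z) \<and> proj (K x) Z undefined \<cdot> h = p"
proof -
  have T: "T \<in> Obj V" using p hom_dom_obj by blast
  have "\<exists>!h. h \<in> hom V T (ihom (K x) Z) \<and> (\<forall>i \<in> Obj (Idx (K x)). proj (K x) Z i \<cdot> h = p)"
    by (rule ind_hom_ex_pt[OF K_ind[OF x] Z T]) (use p act_id[OF x Z cmp_pt[OF p]] in \<open>auto simp: K_simps\<close>)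
  then show ?thesis by (simp add: K_simps)
qed

lemma K_hom_ext:
  assumes x: "x \<in> VObj C" and Z: "ind Z" and h: "h \<in> hom V T (ihom (K x) Z)" "h' \<in> hom V T (ihom (K x) Z)"
    and eq: "proj (K x) Z undefined \<cdot> h = proj (K x) Z undefined \<cdot> h'"
  shows "h = h'"
  by (rule ind_hom_ext[OF K_ind[OF x] Z h]) (use eq in \<open>simp add: K_simps\<close>)

lemma K_proj_cc:
  assumes x: "x \<in> VObj C" and Y: "ind Y" and Z: "ind Z"
    and u: "u \<in> pt (ihom Y Z)" and v: "v \<in> pt (ihom (K x) Y)"
    and j: "j \<in> Obj (Idx Y)" and g: "g \<in> cpt C x (ind_at Y j)"
    and vg: "proj (K x) Y undefined \<cdot> v = coproj x Y j \<cdot> g"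
  shows "proj (K x) Z undefined \<cdot> cc Ind (K x) Y Z u v = act x (ind_at Y j) Z (proj Y Z j \<cdot> u) g"
  using ind_proj_cc[OF K_ind[OF x] Y Z u v, of undefined] act2_in[OF x Y Z u j g] vg by (simp add: K_simps)

abbreviation E :: "('c, ('u, 'c, 'a) ind_obj, 'a) vfun" where
  "E \<equiv> ind_embed TYPE('u) V C"

lemma E_VFO: "VFO E x = K x" by (simp add: ind_embed_def)

lemma E_spec:
  assumes x: "x \<in> VObj C" and y: "y \<in> VObj C"
  shows "VFH E x y \<in> hom V (VHom C x y) (ihom (K x) (K y)) \<and>
    proj (K x) (K y) undefined \<cdot> VFH E x y = coproj x (K y) undefined"
proof -
  have i: "coproj x (K y) undefined \<in> hom V (VHom C x y) (icol x (K y))"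
    using ind_in_hom[OF x K_ind[OF y], of undefined] by (simp add: K_simps)
  have "VFH E x y = (THE h. h \<in> hom V (VHom C x y) (ihom (K x) (K y)) \<and>
         proj (K x) (K y) undefined \<cdot> h = coproj x (K y) undefined)"
    by (simp add: ind_embed_def Let_def)
  then show ?thesis using theI'[OF K_hom_ex[OF x K_ind[OF y] i]] by simp
qed

lemma E_pt:
  assumes x: "x \<in> VObj C" and y: "y \<in> VObj C" and f: "f \<in> cpt C x y"
  shows "VFH E x y \<cdot> f \<in> pt (ihom (K x) (K y))"
    and "proj (K x) (K y) undefined \<cdot> (VFH E x y \<cdot> f) = coproj x (K y) undefined \<cdot> f"
  using cmp_pt[OF conjunct1[OF E_spec[OF x y]] f] conjunct2[OF E_spec[OF x y]]
    cmp_assoc[OF f conjunct1[OF E_spec[OF x y]] K_proj_hom[OF x K_ind[OF y]]] by simp_all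

text \<open>Under the identification of \<open>K_hom_ex\<close>, precomposing with an embedded arrow
  is the action of \<open>C\<close> on classes.\<close>

lemma cc_E:
  assumes x: "x \<in> VObj C" and y: "y \<in> VObj C" and Z: "ind Z" and f: "f \<in> cpt C x y"
    and u: "u \<in> pt (ihom (K y) Z)"
  shows "proj (K x) Z undefined \<cdot> cc Ind (K x) (K y) Z u (VFH E x y \<cdot> f)
    = act x y Z (proj (K y) Z undefined \<cdot> u) f"
  using K_proj_cc[OF x K_ind[OF y] Z u E_pt(1)[OF x y f], of undefined f] E_pt(2)[OF x y f] f
  by (simp add: K_simps)

lemma E_vfunctor: "vfunctor V C Ind E"
proof (rule vfunctorI[OF vcatC Ind_vcategory]; unfold E_VFO Ind_simps mem_Collect_eq)
  show "ind (K x)" if "x \<in> VObj C" for x by (rule K_ind[OF that])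
  show "VFH E x y \<in> hom V (VHom C x y) (ihom (K x) (K y))" if "x \<in> VObj C" "y \<in> VObj C" for x y
    using E_spec that by blast
  show "VFH E x x \<cdot> VId C x = ind_id V C (K x)" if x: "x \<in> VObj C" for x
  proof (rule K_hom_ext[OF x K_ind[OF x] E_pt(1)[OF x x vid_pt[OF vcatC x]]])
    show "ind_id V C (K x) \<in> pt (ihom (K x) (K x))" using ind_id_spec[OF K_ind[OF x]] by blast
    show "proj (K x) (K x) undefined \<cdot> (VFH E x x \<cdot> VId C x) = proj (K x) (K x) undefined \<cdot> ind_id V C (K x)"
      using E_pt(2)[OF x x vid_pt[OF vcatC x]] ind_id_spec[OF K_ind[OF x]] by (simp add: K_simps)
  qed
  fix x y z g f assume x: "x \<in> VObj C" and y: "y \<in> VObj C" and z: "z \<in> VObj C"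
    and g: "g \<in> cpt C y z" and f: "f \<in> cpt C x y"
  note gf = cc_pt[OF vcatC x y z g f]
  show "VFH E x z \<cdot> cc C x y z g f = cc Ind (K x) (K y) (K z) (VFH E y z \<cdot> g) (VFH E x y \<cdot> f)"
    by (rule K_hom_ext[OF x K_ind[OF z] E_pt(1)[OF x z gf]
          Ind_cc_pt[OF K_ind[OF x] K_ind[OF y] K_ind[OF z] E_pt(1)[OF y z g] E_pt(1)[OF x y f]]])
       (use cc_E[OF x y K_ind[OF z] f E_pt(1)[OF y z g]] E_pt(2)[OF y z g] E_pt(2)[OF x z gf]
          act_in[OF x y K_ind[OF z], of undefined g f] g f in \<open>simp add: K_simps\<close>)
qed

end


section \<open>The functor to the ind-category\<close>

locale omega_base = ind_base V C U
  for V :: "('o, 'a) smc" (structure) and C :: "('c, 'o, 'a) vcat" and U :: "'u itself" +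
  fixes \<Omega> :: "('c, 'c, 'a) vfun" and \<theta> :: "'c \<Rightarrow> 'a"
  assumes wp: "well_pointed V C \<Omega> \<theta>"
begin

abbreviation Om :: "nat \<Rightarrow> 'c \<Rightarrow> 'c" where
  "Om n x \<equiv> (VFO \<Omega> ^^ n) x"

lemma Omega_vfunctor: "vfunctor V C C \<Omega>"
  using wp by (simp add: well_pointed_def)

lemma Om_obj: "x \<in> VObj C \<Longrightarrow> Om n x \<in> VObj C"
  by (induction n) (auto simp: vf_obj[OF Omega_vfunctor])

lemma Omega_obj: "x \<in> VObj C \<Longrightarrow> VFO \<Omega> x \<in> VObj C"
  by (rule vf_obj[OF Omega_vfunctor])

lemma Om_shift: "Om n (VFO \<Omega> x) = VFO \<Omega> (Om n x)"
  by (simp add: funpow_swap1)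

lemma Om_Om: "Om k (Om j x) = Om (j + k) x"
  by (simp add: funpow_add add.commute[of j k])

lemma theta_pt: "x \<in> VObj C \<Longrightarrow> \<theta> x \<in> cpt C x (VFO \<Omega> x)"
  and theta_nat: "x \<in> VObj C \<Longrightarrow> y \<in> VObj C \<Longrightarrow> f \<in> cpt C x y \<Longrightarrow>
    cc C x y (VFO \<Omega> y) (\<theta> y) f = cc C x (VFO \<Omega> x) (VFO \<Omega> y) (VFH \<Omega> x y \<cdot> f) (\<theta> x)"
proof -
  have *: "vnat V C C (vfun_id V C) \<Omega> \<theta>" using wp by (simp add: well_pointed_def)
  note 1 = *[unfolded vnat_iff[OF vcatC vcatC vfun_id_vfunctor[OF vcatC] Omega_vfunctor]]
  show "x \<in> VObj C \<Longrightarrow> \<theta> x \<in> cpt C x (VFO \<Omega> x)" using 1 by (simp add: vfun_id_def)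
  show "x \<in> VObj C \<Longrightarrow> y \<in> VObj C \<Longrightarrow> f \<in> cpt C x y \<Longrightarrow>
    cc C x y (VFO \<Omega> y) (\<theta> y) f = cc C x (VFO \<Omega> x) (VFO \<Omega> y) (VFH \<Omega> x y \<cdot> f) (\<theta> x)"
    using 1[THEN conjunct2, THEN bspec, THEN bspec, THEN bspec, of x y f] idt_cmp[of f \<one> "VHom C x y"]
    by (simp add: vfun_id_def)
qed

lemma theta_wp: "x \<in> VObj C \<Longrightarrow> VFH \<Omega> x (VFO \<Omega> x) \<cdot> \<theta> x = \<theta> (VFO \<Omega> x)"
  using wp by (simp add: well_pointed_def)

lemma Omega_pt: "x \<in> VObj C \<Longrightarrow> y \<in> VObj C \<Longrightarrow> f \<in> cpt C x y \<Longrightarrow> VFH \<Omega> x y \<cdot> f \<in> cpt C (VFO \<Omega> x) (VFO \<Omega> y)"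
  by (rule vf_pt[OF Omega_vfunctor])

definition pw :: "nat \<Rightarrow> 'c \<Rightarrow> 'c \<Rightarrow> 'a \<Rightarrow> 'a" where
  "pw n x y f = VFH (vfun_pow V C \<Omega> n) x y \<cdot> f"

lemma pow_VFO: "VFO (vfun_pow V C \<Omega> n) x = Om n x"
  by (induction n) (auto simp: vfun_id_def vfun_comp_def)

lemma pow_vfunctor: "vfunctor V C C (vfun_pow V C \<Omega> n)"
  by (rule vfun_pow_vfunctor[OF vcatC Omega_vfunctor])

lemma pow_hom: "x \<in> VObj C \<Longrightarrow> y \<in> VObj C \<Longrightarrow> VFH (vfun_pow V C \<Omega> n) x y \<in> hom V (VHom C x y) (VHom C (Om n x) (Om n y))"
  using vf_hom[OF pow_vfunctor] by (simp add: pow_VFO)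

lemma pw_pt: "x \<in> VObj C \<Longrightarrow> y \<in> VObj C \<Longrightarrow> f \<in> cpt C x y \<Longrightarrow> pw n x y f \<in> cpt C (Om n x) (Om n y)"
  unfolding pw_def by (rule cmp_pt[OF pow_hom])

lemma pw_0: "f \<in> cpt C x y \<Longrightarrow> pw 0 x y f = f"
  by (simp add: pw_def vfun_id_def idt_cmp)

lemma pw_Suc:
  "x \<in> VObj C \<Longrightarrow> y \<in> VObj C \<Longrightarrow> f \<in> cpt C x y \<Longrightarrow> pw (Suc n) x y f = VFH \<Omega> (Om n x) (Om n y) \<cdot> pw n x y f"
  using vfun_comp_pt[OF pow_vfunctor[of n] Omega_vfunctor] by (simp add: pw_def pow_VFO)

lemma pw_id: "x \<in> VObj C \<Longrightarrow> pw n x x (VId C x) = VId C (Om n x)"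
  using vf_id[OF pow_vfunctor] by (simp add: pw_def pow_VFO)

lemma pw_cc:
  "x \<in> VObj C \<Longrightarrow> y \<in> VObj C \<Longrightarrow> z \<in> VObj C \<Longrightarrow> g \<in> cpt C y z \<Longrightarrow> f \<in> cpt C x y \<Longrightarrow>
    pw n x z (cc C x y z g f) = cc C (Om n x) (Om n y) (Om n z) (pw n y z g) (pw n x y f)"
  using vf_cc[OF vcatC vcatC pow_vfunctor] by (simp add: pw_def pow_VFO)

text \<open>Each further application of \<open>\<Omega>\<close> is absorbed by well-pointedness at
  \<open>Om n x\<close>. Consequently the components of \<open>\<Omega>\<^sup>\<infinity>\<close> on
  \<open>\<theta> x\<close> are represented by transition arrows of the sequence.\<close>

lemma pw_theta:
  assumes x: "x \<in> VObj C"
  shows "pw n x (VFO \<Omega> x) (\<theta> x) = \<theta> (Om n x)"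
proof (induction n)
  case 0 show ?case using pw_0[OF theta_pt[OF x]] by simp
next
  case (Suc n)
  then show ?case
    using pw_Suc[OF x Omega_obj[OF x] theta_pt[OF x]] theta_wp[OF Om_obj[OF x]] by (simp add: Om_shift)
qed

definition it :: "'c \<Rightarrow> nat \<Rightarrow> 'a" where
  "it y k = fst (snd (iter_arr V C \<Omega> \<theta> y k))"

lemma iter_arr_it: "iter_arr V C \<Omega> \<theta> y k = (y, it y k, Om k y)"
proof (induction k)
  case 0 show ?case by (simp add: it_def underlying_def)
next
  case (Suc k)
  have "iter_arr V C \<Omega> \<theta> y (Suc k) = (y, cc C y (Om k y) (VFO \<Omega> (Om k y)) (\<theta> (Om k y)) (it y k), VFO \<Omega> (Om k y))"
    by (simp add: Let_def Suc underlying_cmp)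
  then show ?case unfolding it_def[of y "Suc k"] by simp
qed

lemma it_0: "it y 0 = VId C y"
  by (simp add: it_def underlying_def)

lemma it_Suc: "it y (Suc k) = cc C y (Om k y) (VFO \<Omega> (Om k y)) (\<theta> (Om k y)) (it y k)"
proof -
  have "iter_arr V C \<Omega> \<theta> y (Suc k) = (y, cc C y (Om k y) (VFO \<Omega> (Om k y)) (\<theta> (Om k y)) (it y k), VFO \<Omega> (Om k y))"
    by (simp add: Let_def iter_arr_it underlying_cmp)
  then show ?thesis unfolding it_def[of y "Suc k"] by simp
qed

lemma it_pt: "y \<in> VObj C \<Longrightarrow> it y k \<in> cpt C y (Om k y)"
proof (induction k)
  case 0 then show ?case using vid_pt[OF vcatC] by (simp add: it_0)
next
  case (Suc k)
  then show ?case
    using cc_pt[OF vcatC Suc.prems Om_obj Omega_obj[OF Om_obj] theta_pt[OF Om_obj]] by (simp add: it_Suc)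
qed

lemma it_1: "y \<in> VObj C \<Longrightarrow> it y (Suc 0) = \<theta> y"
  using cc_idr[OF vcatC _ Omega_obj theta_pt] by (simp add: it_Suc it_0)

text \<open>Transitions concatenate; this gives functoriality of the sequence, whose arrows are
  indexed by differences \<open>n - m\<close>.\<close>

lemma it_add:
  assumes y: "y \<in> VObj C"
  shows "it y (j + k) = cc C y (Om j y) (Om (j + k) y) (it (Om j y) k) (it y j)"
proof (induction k)
  case 0 show ?case using cc_idl[OF vcatC y Om_obj[OF y] it_pt[OF y]] by (simp add: it_0)
next
  case (Suc k)
  note oj = Om_obj[OF y, of j] and ojk = Om_obj[OF y, of "j + k"]
  have t: "it (Om j y) k \<in> cpt C (Om j y) (Om (j + k) y)" using it_pt[OF oj, of k] by (simp add: Om_Om)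
  show ?case
    using Suc cc_assoc[OF vcatC y oj ojk Omega_obj[OF ojk] theta_pt[OF ojk] t it_pt[OF y]]
    by (simp add: it_Suc Om_Om)
qed

section \<open>The copy of the ordered naturals inside the universe\<close>

abbreviation N :: "nat \<Rightarrow> 'u" where "N \<equiv> nat_code"
abbreviation P :: "nat \<times> nat \<Rightarrow> 'u" where "P \<equiv> pair_code"
abbreviation OC :: "('u, 'u) cat" where "OC \<equiv> omega_cat"

lemma inj_N: "inj N"
proof -
  have "(UNIV :: nat set) \<lesssim> (UNIV :: 'u set)" using inf by (rule lesspoll_imp_lepoll)
  then have "\<exists>e :: nat \<Rightarrow> 'u. inj e" by (auto simp: lepoll_def)
  then show ?thesis unfolding nat_code_def by (rule someI_ex)
qed

lemma inj_P: "inj P"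
  unfolding pair_code_def by (rule injI) (blast dest: injD[OF inj_N] injD[OF inj_prod_encode])

lemma inv_N [simp]: "inv N (N n) = n"
  using inj_N by (rule inv_f_f)

lemma inv_P [simp]: "inv P (P p) = p"
  using inj_P by (rule inv_f_f)

lemma OC_simps: "Obj OC = range N" "Arr OC = {P (m, n) | m n. m \<le> n}"
    "Dom OC (P (m, n)) = N m" "Cod OC (P (m, n)) = N n" "\<iota>\<^bsub>OC\<^esub> (N n) = P (n, n)"
    "P (n, k) \<cdot>\<^bsub>OC\<^esub> P (m, n) = P (m, k)"
  by (auto simp: omega_cat_def nat_cat_def)

lemma N_eq [simp]: "N m = N n \<longleftrightarrow> m = n"
  using inj_N by (auto simp: inj_def)

lemma OC_hom: "f \<in> hom OC i j \<longleftrightarrow> (\<exists>m n. m \<le> n \<and> i = N m \<and> j = N n \<and> f = P (m, n))"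
  by (auto simp: hom_def OC_simps)

lemma OC_category: "category OC"
proof
  fix f assume "f \<in> Arr OC"
  then show "Dom OC f \<in> Obj OC" "Cod OC f \<in> Obj OC" by (auto simp: OC_simps)
next
  fix x assume "x \<in> Obj OC"
  then show "\<iota>\<^bsub>OC\<^esub> x \<in> hom OC x x" by (auto simp: OC_simps OC_hom)
qed (auto simp: OC_hom OC_simps)

lemma OC_small: "small_category OC"
proof -
  \<comment> \<open>Pairs are coded through \<open>prod_encode\<close> and then \<open>N\<close>, so
    the arrows too lie in the range of a sequence.\<close>
  have "Arr OC \<subseteq> range N"
  proof
    fix a assume "a \<in> Arr OC"
    then obtain m n where "a = N (prod_encode (m, n))" by (auto simp: OC_simps pair_code_def)
    then show "a \<in> range N" by blast
  qed
  then have "Arr OC \<lesssim> range N" by (rule subset_imp_lepoll)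
  then have "small (Arr OC)" using nat_small[of N] lesspoll_trans1 unfolding small_def by blast
  then show ?thesis using OC_category by (simp add: small_category_def)
qed

lemma OC_filtered: "filtered OC"
  unfolding filtered_def
proof (intro conjI ballI)
  show "Obj OC \<noteq> {}" by (simp add: OC_simps)
  fix i j assume "i \<in> Obj OC" "j \<in> Obj OC"
  then obtain m n where ij: "i = N m" "j = N n" by (auto simp: OC_simps)
  have "P (m, max m n) \<in> hom OC i (N (max m n))" "P (n, max m n) \<in> hom OC j (N (max m n))"
    by (auto simp: OC_hom ij)
  then show "\<exists>k \<in> Obj OC. hom OC i k \<noteq> {} \<and> hom OC j k \<noteq> {}" by (auto simp: OC_simps)
  fix f g assume "f \<in> hom OC i j" "g \<in> hom OC i j"
  then have "f = g" by (auto simp: OC_hom)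
  moreover have "P (n, n) \<in> hom OC j j" by (auto simp: OC_hom ij)
  ultimately show "\<exists>k \<in> Obj OC. \<exists>h \<in> hom OC j k. h \<cdot>\<^bsub>OC\<^esub> f = h \<cdot>\<^bsub>OC\<^esub> g"
    using ij by (auto simp: OC_simps)
qed

section \<open>The formal colimit of the iterates and its functoriality\<close>

abbreviation X :: "'c \<Rightarrow> ('u, 'c, 'a) ind_obj" where
  "X x \<equiv> Omega_inf_obj V C \<Omega> \<theta> x"

lemma X_simps: "Idx (X x) = OC" "ind_at (X x) (N n) = Om n x"
    "FA (Dia (X x)) (P (m, n)) = (Om m x, it (Om m x) (n - m), Om (n - m) (Om m x))"
    "tr (X x) (P (m, n)) = it (Om m x) (n - m)"
  by (simp_all add: Omega_inf_obj_def ftr_comp_def iter_seq_def tr_def iter_arr_it)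

lemma it_le: "x \<in> VObj C \<Longrightarrow> m \<le> n \<Longrightarrow> it (Om m x) (n - m) \<in> cpt C (Om m x) (Om n x)"
  using it_pt[OF Om_obj, of x m "n - m"] by (simp add: Om_Om)

lemma it_trans:
  assumes x: "x \<in> VObj C" and mn: "m \<le> n" "n \<le> k"
  shows "it (Om m x) (k - m) = cc C (Om m x) (Om n x) (Om k x) (it (Om n x) (k - n)) (it (Om m x) (n - m))"
  using it_add[OF Om_obj[OF x, of m], of "n - m" "k - n"] mn by (simp add: Om_Om)

lemma X_ind:
  assumes x: "x \<in> VObj C"
  shows "ind (X x)"
proof -
  have "is_functor OC (underlying V C) (Dia (X x))"
    unfolding is_functor_def
  proof (intro conjI ballI allI)
    show "ind_at (X x) j \<in> Obj (underlying V C)" if "j \<in> Obj OC" for j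
      using that Om_obj[OF x] by (auto simp: OC_simps X_simps underlying_def)
    show "FA (Dia (X x)) f \<in> hom (underlying V C) (ind_at (X x) (Dom OC f)) (ind_at (X x) (Cod OC f))"
      if "f \<in> Arr OC" for f
      using that Om_obj[OF x] it_le[OF x]
      by (auto simp: OC_simps X_simps hom_def[of "underlying V C"] Om_Om) (auto simp: underlying_def)
    show "FA (Dia (X x)) (\<iota>\<^bsub>OC\<^esub> j) = \<iota>\<^bsub>underlying V C\<^esub> (ind_at (X x) j)" if "j \<in> Obj OC" for j
      using that by (auto simp: OC_simps X_simps underlying_def it_0)
    fix i j k f g assume "f \<in> hom OC i j" "g \<in> hom OC j k"
    then obtain l m n where f: "f = P (l, m)" "g = P (m, n)" "l \<le> m" "m \<le> n" by (auto simp: OC_hom)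
    show "FA (Dia (X x)) (g \<cdot>\<^bsub>OC\<^esub> f) = FA (Dia (X x)) g \<cdot>\<^bsub>underlying V C\<^esub> FA (Dia (X x)) f"
      using it_trans[OF x f(3,4)] f(3,4) by (simp add: f(1,2) OC_simps X_simps underlying_cmp Om_Om)
  qed
  then show ?thesis using OC_small OC_filtered by (simp add: is_ind_obj_def X_simps)
qed

lemma X_obj [simp]: "N n \<in> Obj (Idx (X x))"
  by (simp add: X_simps OC_simps)

lemma X_in_hom:
  "x \<in> VObj C \<Longrightarrow> y \<in> VObj C \<Longrightarrow> coproj x (X y) (N n) \<in> hom V (VHom C x (Om n y)) (icol x (X y))"
  using ind_in_hom[OF _ X_ind X_obj[of n y]] by (simp add: X_simps)

lemma X_in_pt:
  "x \<in> VObj C \<Longrightarrow> y \<in> VObj C \<Longrightarrow> g \<in> cpt C x (Om n y) \<Longrightarrow> coproj x (X y) (N n) \<cdot> g \<in> pt (icol x (X y))"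
  by (rule cmp_pt[OF X_in_hom])

lemma X_in_it:
  assumes x: "x \<in> VObj C" and y: "y \<in> VObj C" and mn: "m \<le> n" and g: "g \<in> cpt C x (Om m y)"
  shows "coproj x (X y) (N n) \<cdot> cc C x (Om m y) (Om n y) (it (Om m y) (n - m)) g = coproj x (X y) (N m) \<cdot> g"
proof -
  have "P (m, n) \<in> Arr (Idx (X y))" using mn by (auto simp: X_simps OC_simps)
  from ind_in_tr[OF x X_ind[OF y] this] show ?thesis using g by (simp add: X_simps OC_simps)
qed

lemma X_in_theta:
  assumes x: "x \<in> VObj C" and y: "y \<in> VObj C" and g: "g \<in> cpt C x (Om n y)"
  shows "coproj x (X y) (N (Suc n)) \<cdot> cc C x (Om n y) (VFO \<Omega> (Om n y)) (\<theta> (Om n y)) g = coproj x (X y) (N n) \<cdot> g"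
  using X_in_it[OF x y, of n "Suc n" g] g it_1[OF Om_obj[OF y]] by simp

lemma X_col_pt:
  assumes "x \<in> VObj C" "y \<in> VObj C" "c \<in> pt (icol x (X y))"
  obtains n g where "g \<in> cpt C x (Om n y)" "c = coproj x (X y) (N n) \<cdot> g"
proof -
  obtain j g where j: "j \<in> Obj (Idx (X y))" and g: "g \<in> cpt C x (ind_at (X y) j)" "c = coproj x (X y) j \<cdot> g"
    using ind_col_pt[OF assms(1) X_ind[OF assms(2)] assms(3)] .
  obtain n where "j = N n" using j by (auto simp: X_simps OC_simps)
  then show ?thesis using that[of g n] g by (simp add: X_simps)
qed

text \<open>Every transition is a composite of single steps, so for a sequence compatibility has to
  be checked only from \<open>n\<close> to \<open>Suc n\<close>.\<close>

lemma X_col_ex: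
  assumes x: "x \<in> VObj C" and y: "y \<in> VObj C" and T: "T \<in> Obj V"
    and q: "\<And>n. q n \<in> hom V (VHom C x (Om n y)) T"
    and qc: "\<And>n g. g \<in> cpt C x (Om n y) \<Longrightarrow>
      q (Suc n) \<cdot> cc C x (Om n y) (VFO \<Omega> (Om n y)) (\<theta> (Om n y)) g = q n \<cdot> g"
  shows "\<exists>!h. h \<in> hom V (icol x (X y)) T \<and> (\<forall>n. h \<cdot> coproj x (X y) (N n) = q n)"
proof -
  have qit: "q (m + k) \<cdot> cc C x (Om m y) (Om (m + k) y) (it (Om m y) k) g = q m \<cdot> g"
    if g: "g \<in> cpt C x (Om m y)" for m k g
  proof (induction k)
    case 0 show ?case using cc_idl[OF vcatC x Om_obj[OF y] g] by (simp add: it_0)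
  next
    case (Suc k)
    note om = Om_obj[OF y, of m] and omk = Om_obj[OF y, of "m + k"]
    have t: "it (Om m y) k \<in> cpt C (Om m y) (Om (m + k) y)" using it_pt[OF om, of k] by (simp add: Om_Om)
    show ?case
      using Suc qc[OF cc_pt[OF vcatC x om omk t g]]
        cc_assoc[OF vcatC x om omk Omega_obj[OF omk] theta_pt[OF omk] t g] by (simp add: it_Suc Om_Om)
  qed
  \<comment> \<open>Objects of \<open>omega_cat\<close> are codes of naturals, so the family is read
    through \<open>inv N\<close>.\<close>
  have "\<exists>!h. h \<in> hom V (icol x (X y)) T \<and> (\<forall>j \<in> Obj (Idx (X y)). h \<cdot> coproj x (X y) j = q (inv N j))"
  proof (rule ind_col_ex[OF x X_ind[OF y] T])
    show "q (inv N j) \<in> hom V (VHom C x (ind_at (X y) j)) T" if "j \<in> Obj (Idx (X y))" for j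
      using that q by (auto simp: X_simps OC_simps)
    fix b g assume b: "b \<in> Arr (Idx (X y))" and g: "g \<in> cpt C x (ind_at (X y) (Dom (Idx (X y)) b))"
    obtain m k where "b = P (m, m + k)" using b by (auto simp: X_simps OC_simps dest: le_Suc_ex)
    then show "q (inv N (Cod (Idx (X y)) b)) \<cdot> cc C x (ind_at (X y) (Dom (Idx (X y)) b)) (ind_at (X y) (Cod (Idx (X y)) b)) (tr (X y) b) g
       = q (inv N (Dom (Idx (X y)) b)) \<cdot> g"
      using qit[of g m k] g by (simp add: X_simps OC_simps)
  qed
  then show ?thesis by (simp add: X_simps OC_simps)
qed

lemma X_proj_hom:
  "x \<in> VObj C \<Longrightarrow> ind Z \<Longrightarrow> proj (X x) Z (N n) \<in> hom V (ihom (X x) Z) (icol (Om n x) Z)"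
  using ind_proj_hom[OF X_ind _ X_obj[of n x]] by (simp add: X_simps)

lemma X_proj_pt:
  "x \<in> VObj C \<Longrightarrow> ind Z \<Longrightarrow> u \<in> pt (ihom (X x) Z) \<Longrightarrow> proj (X x) Z (N n) \<cdot> u \<in> pt (icol (Om n x) Z)"
  by (rule cmp_pt[OF X_proj_hom])

lemma X_proj_theta:
  assumes x: "x \<in> VObj C" and Z: "ind Z" and u: "u \<in> pt (ihom (X x) Z)"
  shows "act (Om n x) (VFO \<Omega> (Om n x)) Z (proj (X x) Z (N (Suc n)) \<cdot> u) (\<theta> (Om n x)) = proj (X x) Z (N n) \<cdot> u"
proof -
  have "P (n, Suc n) \<in> Arr (Idx (X x))" unfolding X_simps OC_simps by fastforce
  from ind_proj_tr[OF X_ind[OF x] Z this u] show ?thesis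
    by (simp add: X_simps OC_simps it_1[OF Om_obj[OF x]])
qed

text \<open>The dual reduction to single steps: restriction along \<open>it (Om m x) k\<close> is
  \<open>k\<close> successive restrictions along components of \<open>\<theta>\<close>, by
  \<open>act_act\<close>.\<close>

lemma X_hom_ex:
  assumes x: "x \<in> VObj C" and Z: "ind Z" and T: "T \<in> Obj V"
    and p: "\<And>n. p n \<in> hom V T (icol (Om n x) Z)"
    and pc: "\<And>n t. t \<in> pt T \<Longrightarrow> act (Om n x) (VFO \<Omega> (Om n x)) Z (p (Suc n) \<cdot> t) (\<theta> (Om n x)) = p n \<cdot> t"
  shows "\<exists>!h. h \<in> hom V T (ihom (X x) Z) \<and> (\<forall>n. proj (X x) Z (N n) \<cdot> h = p n)"
proof -
  have pit: "act (Om m x) (Om (m + k) x) Z (p (m + k) \<cdot> t) (it (Om m x) k) = p m \<cdot> t" if t: "t \<in> pt T" for m k t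
  proof (induction k)
    case 0 show ?case using act_id[OF Om_obj[OF x] Z cmp_pt[OF p t]] by (simp add: it_0)
  next
    case (Suc k)
    note om = Om_obj[OF x, of m] and omk = Om_obj[OF x, of "m + k"]
    have i: "it (Om m x) k \<in> cpt C (Om m x) (Om (m + k) x)" using it_pt[OF om, of k] by (simp add: Om_Om)
    have "p (Suc (m + k)) \<cdot> t \<in> pt (icol (VFO \<Omega> (Om (m + k) x)) Z)"
      using cmp_pt[OF p t, of "Suc (m + k)"] by simp
    from act_act[OF om omk Omega_obj[OF omk] Z this theta_pt[OF omk] i] show ?case
      using Suc pc[OF t, of "m + k"] by (simp add: it_Suc Om_Om)
  qed
  have "\<exists>!h. h \<in> hom V T (ihom (X x) Z) \<and> (\<forall>i \<in> Obj (Idx (X x)). proj (X x) Z i \<cdot> h = p (inv N i))"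
  proof (rule ind_hom_ex_pt[OF X_ind[OF x] Z T])
    show "p (inv N i) \<in> hom V T (icol (ind_at (X x) i) Z)" if "i \<in> Obj (Idx (X x))" for i
      using that p by (auto simp: X_simps OC_simps)
    fix a t assume a: "a \<in> Arr (Idx (X x))" and t: "t \<in> pt T"
    obtain m k where "a = P (m, m + k)" using a by (auto simp: X_simps OC_simps dest: le_Suc_ex)
    then show "act (ind_at (X x) (Dom (Idx (X x)) a)) (ind_at (X x) (Cod (Idx (X x)) a)) Z (p (inv N (Cod (Idx (X x)) a)) \<cdot> t) (tr (X x) a)
       = p (inv N (Dom (Idx (X x)) a)) \<cdot> t"
      using pit[OF t, of m k] by (simp add: X_simps OC_simps)
  qed
  then show ?thesis by (simp add: X_simps OC_simps)
qed

lemma X_hom_ext: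
  assumes x: "x \<in> VObj C" and Z: "ind Z" and h: "h \<in> hom V T (ihom (X x) Z)" "h' \<in> hom V T (ihom (X x) Z)"
    and eq: "\<And>n. proj (X x) Z (N n) \<cdot> h = proj (X x) Z (N n) \<cdot> h'"
  shows "h = h'"
  by (rule ind_hom_ext[OF X_ind[OF x] Z h]) (use eq in \<open>auto simp: X_simps OC_simps\<close>)

abbreviation G :: "('c, ('u, 'c, 'a) ind_obj, 'a) vfun" where
  "G \<equiv> Omega_inf TYPE('u) V C \<Omega> \<theta>"

lemma G_VFO: "VFO G x = X x" by (simp add: Omega_inf_def)

text \<open>The family is a cone by naturality of \<open>\<theta>\<close> at
  \<open>\<Omega>\<^sup>n t\<close>: restricting component \<open>n + 1\<close> along
  \<open>\<theta>\<close> gives \<open>\<Omega>\<^sup>n\<^sup>+\<^sup>1 t \<cdot> \<theta> =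
  \<theta> \<cdot> \<Omega>\<^sup>n t\<close>, and a \<open>\<theta>\<close> on the left is a
  transition, which returns the class to stage \<open>n\<close>.\<close>

lemma G_spec:
  assumes x: "x \<in> VObj C" and y: "y \<in> VObj C"
  shows "VFH G x y \<in> hom V (VHom C x y) (ihom (X x) (X y)) \<and>
    (\<forall>n. proj (X x) (X y) (N n) \<cdot> VFH G x y = coproj (Om n x) (X y) (N n) \<cdot> VFH (vfun_pow V C \<Omega> n) x y)"
proof -
  let ?p = "\<lambda>n. coproj (Om n x) (X y) (N n) \<cdot> VFH (vfun_pow V C \<Omega> n) x y"
  have 1: "VFH G x y = (THE h. h \<in> hom V (VHom C x y) (ihom (X x) (X y)) \<and>
         (\<forall>n. proj (X x) (X y) (N n) \<cdot> h = ?p n))"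
    by (simp add: Omega_inf_def Let_def)
  have 2: "\<exists>!h. h \<in> hom V (VHom C x y) (ihom (X x) (X y)) \<and> (\<forall>n. proj (X x) (X y) (N n) \<cdot> h = ?p n)"
  proof (rule X_hom_ex[OF x X_ind[OF y] vhom_obj[OF vcatC x y]])
    show "?p n \<in> hom V (VHom C x y) (icol (Om n x) (X y))" for n
      using cmp_hom[OF pow_hom[OF x y] X_in_hom[OF Om_obj[OF x] y]] .
    fix n t assume t: "t \<in> cpt C x y"
    note ox = Om_obj[OF x, of n] and oy = Om_obj[OF y, of n] and pt = pw_pt[OF x y t, of n]
    have p: "?p m \<cdot> t = coproj (Om m x) (X y) (N m) \<cdot> pw m x y t" for m
      using cmp_assoc[OF t pow_hom[OF x y] X_in_hom[OF Om_obj[OF x] y]] by (simp add: pw_def)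
    have "act (Om n x) (VFO \<Omega> (Om n x)) (X y) (?p (Suc n) \<cdot> t) (\<theta> (Om n x)) =
      coproj (Om n x) (X y) (N (Suc n)) \<cdot> cc C (Om n x) (VFO \<Omega> (Om n x)) (VFO \<Omega> (Om n y)) (VFH \<Omega> (Om n x) (Om n y) \<cdot> pw n x y t) (\<theta> (Om n x))"
      unfolding p pw_Suc[OF x y t]
      using act_in[OF ox Omega_obj[OF ox] X_ind[OF y] X_obj[of "Suc n"], of "VFH \<Omega> (Om n x) (Om n y) \<cdot> pw n x y t" "\<theta> (Om n x)"]
        Omega_pt[OF ox oy pt] theta_pt[OF ox] by (simp add: X_simps)
    also have "\<dots> = ?p n \<cdot> t"
      unfolding theta_nat[OF ox oy pt, symmetric] p using X_in_theta[OF ox y pt] .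
    finally show "act (Om n x) (VFO \<Omega> (Om n x)) (X y) (?p (Suc n) \<cdot> t) (\<theta> (Om n x)) = ?p n \<cdot> t" .
  qed
  show ?thesis unfolding 1 by (rule theI'[OF 2])
qed

lemma G_pt:
  assumes x: "x \<in> VObj C" and y: "y \<in> VObj C" and f: "f \<in> cpt C x y"
  shows "VFH G x y \<cdot> f \<in> pt (ihom (X x) (X y))"
    and "proj (X x) (X y) (N n) \<cdot> (VFH G x y \<cdot> f) = coproj (Om n x) (X y) (N n) \<cdot> pw n x y f"
proof -
  note g = G_spec[OF x y]
  show "VFH G x y \<cdot> f \<in> pt (ihom (X x) (X y))" using cmp_pt g f by blast
  show "proj (X x) (X y) (N n) \<cdot> (VFH G x y \<cdot> f) = coproj (Om n x) (X y) (N n) \<cdot> pw n x y f"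
    using cmp_assoc[OF f conjunct1[OF g] X_proj_hom[OF x X_ind[OF y]]] g
      cmp_assoc[OF f pow_hom[OF x y] X_in_hom[OF Om_obj[OF x] y]] by (simp add: pw_def)
qed

lemma X_act_in:
  "x \<in> VObj C \<Longrightarrow> y \<in> VObj C \<Longrightarrow> z \<in> VObj C \<Longrightarrow> g \<in> cpt C y (Om n z) \<Longrightarrow> f \<in> cpt C x y \<Longrightarrow>
    act x y (X z) (coproj y (X z) (N n) \<cdot> g) f = coproj x (X z) (N n) \<cdot> cc C x y (Om n z) g f"
  using act_in[OF _ _ X_ind X_obj[of n z]] by (simp add: X_simps)

text \<open>The stages \<open>m\<close> and \<open>n\<close> differ in general: component
  \<open>m\<close> of \<open>v\<close> may be represented only at a later stage of the target, and
  then component \<open>n\<close> of \<open>u\<close> is the one that matters.\<close>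

lemma X_proj_cc:
  assumes x: "x \<in> VObj C" and y: "y \<in> VObj C" and Z: "ind Z"
    and u: "u \<in> pt (ihom (X y) Z)" and v: "v \<in> pt (ihom (X x) (X y))"
    and g: "g \<in> cpt C (Om m x) (Om n y)"
    and vg: "proj (X x) (X y) (N m) \<cdot> v = coproj (Om m x) (X y) (N n) \<cdot> g"
  shows "proj (X x) Z (N m) \<cdot> cc Ind (X x) (X y) Z u v = act (Om m x) (Om n y) Z (proj (X y) Z (N n) \<cdot> u) g"
  using ind_proj_cc[OF X_ind[OF x] X_ind[OF y] Z u v X_obj[of m x]]
    act2_in[OF Om_obj[OF x] X_ind[OF y] Z u X_obj[of n y]] g vg by (simp add: X_simps)

lemma X_id: "x \<in> VObj C \<Longrightarrow> ind_id V C (X x) \<in> pt (ihom (X x) (X x))"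
    "x \<in> VObj C \<Longrightarrow> proj (X x) (X x) (N n) \<cdot> ind_id V C (X x) = coproj (Om n x) (X x) (N n) \<cdot> VId C (Om n x)"
  using ind_id_spec[OF X_ind] X_obj[of n x] by (auto simp: X_simps)

lemma G_vfunctor: "vfunctor V C Ind G"
proof (rule vfunctorI[OF vcatC Ind_vcategory]; unfold G_VFO Ind_simps mem_Collect_eq)
  show "ind (X x)" if "x \<in> VObj C" for x by (rule X_ind[OF that])
  show "VFH G x y \<in> hom V (VHom C x y) (ihom (X x) (X y))" if "x \<in> VObj C" "y \<in> VObj C" for x y
    using G_spec that by blast
  show "VFH G x x \<cdot> VId C x = ind_id V C (X x)" if x: "x \<in> VObj C" for x
    by (rule X_hom_ext[OF x X_ind[OF x] G_pt(1)[OF x x vid_pt[OF vcatC x]] X_id(1)[OF x]])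
       (simp add: G_pt(2)[OF x x vid_pt[OF vcatC x]] X_id(2)[OF x] pw_id[OF x])
  fix x y z g f assume x: "x \<in> VObj C" and y: "y \<in> VObj C" and z: "z \<in> VObj C"
    and g: "g \<in> cpt C y z" and f: "f \<in> cpt C x y"
  note gf = cc_pt[OF vcatC x y z g f]
  note Gg = G_pt(1)[OF y z g] and Gf = G_pt(1)[OF x y f]
  show "VFH G x z \<cdot> cc C x y z g f = cc Ind (X x) (X y) (X z) (VFH G y z \<cdot> g) (VFH G x y \<cdot> f)"
  proof (rule X_hom_ext[OF x X_ind[OF z] G_pt(1)[OF x z gf] Ind_cc_pt[OF X_ind[OF x] X_ind[OF y] X_ind[OF z] Gg Gf]])
    fix n
    note ox = Om_obj[OF x, of n] and oy = Om_obj[OF y, of n]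
    show "proj (X x) (X z) (N n) \<cdot> (VFH G x z \<cdot> cc C x y z g f) =
      proj (X x) (X z) (N n) \<cdot> cc Ind (X x) (X y) (X z) (VFH G y z \<cdot> g) (VFH G x y \<cdot> f)"
      unfolding X_proj_cc[OF x y X_ind[OF z] Gg Gf pw_pt[OF x y f] G_pt(2)[OF x y f]]
        G_pt(2)[OF x z gf] G_pt(2)[OF y z g] X_act_in[OF ox oy z pw_pt[OF y z g] pw_pt[OF x y f]]
        pw_cc[OF x y z g f] ..
  qed
qed

section \<open>The enriched colimit property of the sequence\<close>

lemma kappa_ex:
  assumes x: "x \<in> VObj C"
  shows "\<exists>!k. k \<in> pt (ihom (K (Om n x)) (X x)) \<and>
    proj (K (Om n x)) (X x) undefined \<cdot> k = coproj (Om n x) (X x) (N n) \<cdot> VId C (Om n x)"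
  by (rule K_hom_ex[OF Om_obj[OF x] X_ind[OF x] X_in_pt[OF Om_obj[OF x] x vid_pt[OF vcatC Om_obj[OF x]]]])

text \<open>The coprojection of stage \<open>n\<close> into the formal colimit, namely the class of
  the identity at that stage.\<close>

definition kappa :: "nat \<Rightarrow> 'c \<Rightarrow> 'a" where
  "kappa n x = (THE k. k \<in> pt (ihom (K (Om n x)) (X x)) \<and>
    proj (K (Om n x)) (X x) undefined \<cdot> k = coproj (Om n x) (X x) (N n) \<cdot> VId C (Om n x))"

lemma
  assumes x: "x \<in> VObj C"
  shows kappa_pt: "kappa n x \<in> pt (ihom (K (Om n x)) (X x))"
    and proj_kappa: "proj (K (Om n x)) (X x) undefined \<cdot> kappa n x = coproj (Om n x) (X x) (N n) \<cdot> VId C (Om n x)"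
  using theI'[OF kappa_ex[OF x, of n]] unfolding kappa_def by auto

text \<open>Restricting the class of an identity changes nothing. Hence precomposition with
  \<open>kappa n x\<close> is taking component \<open>n\<close>, which matches the colimit property
  with the limit defining \<open>ihom (X x) Z\<close>.\<close>

lemma proj_cc_kappa:
  assumes x: "x \<in> VObj C" and Z: "ind Z" and u: "u \<in> pt (ihom (X x) Z)"
  shows "proj (K (Om n x)) Z undefined \<cdot> cc Ind (K (Om n x)) (X x) Z u (kappa n x) = proj (X x) Z (N n) \<cdot> u"
  using K_proj_cc[OF Om_obj[OF x] X_ind[OF x] Z u kappa_pt[OF x] X_obj[of n x], of "VId C (Om n x)"]
    proj_kappa[OF x] vid_pt[OF vcatC Om_obj[OF x]] act_id[OF Om_obj[OF x] Z X_proj_pt[OF x Z u]]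
  by (simp add: X_simps)

lemma cc_kappa_E:
  assumes x: "x \<in> VObj C" and y: "y \<in> VObj C" and f: "f \<in> cpt C y (Om n x)"
  shows "proj (K y) (X x) undefined \<cdot> cc Ind (K y) (K (Om n x)) (X x) (kappa n x) (VFH E y (Om n x) \<cdot> f)
    = coproj y (X x) (N n) \<cdot> f"
  using cc_E[OF y Om_obj[OF x] X_ind[OF x] f kappa_pt[OF x]] proj_kappa[OF x]
    X_act_in[OF y Om_obj[OF x] x vid_pt[OF vcatC Om_obj[OF x]] f] cc_idl[OF vcatC y Om_obj[OF x] f]
  by simp

lemma kappa_vnat: "vnat V C Ind (vfun_comp V E (vfun_pow V C \<Omega> n)) G (kappa n)"
proof -
  have VFO: "VFO (vfun_comp V E (vfun_pow V C \<Omega> n)) x = K (Om n x)" for x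
    by (simp add: vfun_comp_def pow_VFO E_VFO)
  have eq: "cc Ind (K (Om n x)) (K (Om n y)) (X y) (kappa n y) (VFH (vfun_comp V E (vfun_pow V C \<Omega> n)) x y \<cdot> f)
     = cc Ind (K (Om n x)) (X x) (X y) (VFH G x y \<cdot> f) (kappa n x)"
    if x: "x \<in> VObj C" and y: "y \<in> VObj C" and f: "f \<in> cpt C x y" for x y f
  proof -
    note ox = Om_obj[OF x, of n] and oy = Om_obj[OF y, of n] and pf = pw_pt[OF x y f, of n]
    have "VFH (vfun_comp V E (vfun_pow V C \<Omega> n)) x y \<cdot> f = VFH E (Om n x) (Om n y) \<cdot> pw n x y f"
      using vfun_comp_pt[OF pow_vfunctor E_vfunctor x y f] by (simp add: pw_def pow_VFO)
    moreover have "cc Ind (K (Om n x)) (K (Om n y)) (X y) (kappa n y) (VFH E (Om n x) (Om n y) \<cdot> pw n x y f)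
      = cc Ind (K (Om n x)) (X x) (X y) (VFH G x y \<cdot> f) (kappa n x)"
      by (rule K_hom_ext[OF ox X_ind[OF y] Ind_cc_pt[OF K_ind[OF ox] K_ind[OF oy] X_ind[OF y] kappa_pt[OF y] E_pt(1)[OF ox oy pf]]
            Ind_cc_pt[OF K_ind[OF ox] X_ind[OF x] X_ind[OF y] G_pt(1)[OF x y f] kappa_pt[OF x]]])
         (simp add: cc_kappa_E[OF y ox pf] proj_cc_kappa[OF x X_ind[OF y] G_pt(1)[OF x y f]] G_pt(2)[OF x y f])
    ultimately show ?thesis by simp
  qed
  show ?thesis
    unfolding vnat_iff[OF vcatC Ind_vcategory vfun_comp_vfunctor[OF vcatC vcatC Ind_vcategory pow_vfunctor E_vfunctor] G_vfunctor]
      VFO G_VFO Ind_simps using kappa_pt eq by blast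
qed

text \<open>By definition \<open>ihom (X x) Z\<close> is the limit of the objects
  \<open>icol (Om n x) Z\<close>, and these are the hom-objects out of \<open>K (Om n x)\<close> by
  \<open>K_hom_ex\<close>. The proof transports the limit property across this
  identification.\<close>

lemma Omega_inf_conical_colimit:
  assumes x: "x \<in> VObj C"
  shows "is_conical_colimit V nat_cat Ind (ftr_comp (underlying_ftr V E) (iter_seq V C \<Omega> \<theta> x)) (X x)
     (\<lambda>n. (K (Om n x), kappa n x, X x))"
proof -
  let ?D = "ftr_comp (underlying_ftr V E) (iter_seq V C \<Omega> \<theta> x)"
  let ?e = "\<lambda>m n. VFH E (Om m x) (Om n x) \<cdot> it (Om m x) (n - m)"
  note o = Om_obj[OF x] and KI = K_ind[OF Om_obj[OF x]] and XI = X_ind[OF x]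
  have FO: "FO ?D n = K (Om n x)" for n by (simp add: ftr_comp_def underlying_ftr_def iter_seq_def E_VFO)
  have FA: "FA ?D (m, n) = (K (Om m x), ?e m n, K (Om n x))" if "m \<le> n" for m n
    using that by (simp add: ftr_comp_def underlying_ftr_def iter_seq_def E_VFO iter_arr_it Om_Om)
  have e: "?e m n \<in> pt (ihom (K (Om m x)) (K (Om n x)))" if "m \<le> n" for m n
    using E_pt(1)[OF o o it_le[OF x that]] .
  have nc: "Obj nat_cat = UNIV" "Arr nat_cat = {(m, n). m \<le> n}" "Dom nat_cat = fst" "Cod nat_cat = snd"
    "\<iota>\<^bsub>nat_cat\<^esub> n = (n, n)" "(b \<cdot>\<^bsub>nat_cat\<^esub> a) = (fst a, snd b)" for a b n by (auto simp: nat_cat_def)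
  have nh: "f \<in> hom nat_cat i j \<longleftrightarrow> f = (i, j) \<and> i \<le> j" for f i j by (auto simp: hom_def nc)
  \<comment> \<open>Precomposing the class of an identity with a transition gives the class of the
    transition at the later stage, which is the class of the identity at the earlier one.\<close>
  have ce: "cc Ind (K (Om m x)) (K (Om n x)) (X x) (kappa n x) (?e m n) = kappa m x" if mn: "m \<le> n" for m n
    by (rule K_hom_ext[OF o XI Ind_cc_pt[OF KI KI XI kappa_pt[OF x] e[OF mn]] kappa_pt[OF x]])
       (use X_in_it[OF o x mn vid_pt[OF vcatC o]] cc_idr[OF vcatC o o it_le[OF x mn]] in
         \<open>simp add: cc_kappa_E[OF x o it_le[OF x mn]] proj_kappa[OF x]\<close>)
  have "is_functor nat_cat (underlying V Ind) ?D"
    unfolding is_functor_def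
  proof (intro conjI ballI allI)
    show "FO ?D j \<in> Obj (underlying V Ind)" for j using KI by (simp add: FO underlying_def Ind_simps)
    show "FA ?D f \<in> hom (underlying V Ind) (FO ?D (Dom nat_cat f)) (FO ?D (Cod nat_cat f))" if "f \<in> Arr nat_cat" for f
      using that e KI by (auto simp: FO FA nc hom_def[of "underlying V Ind"]) (auto simp: underlying_def Ind_simps)
    show "FA ?D (\<iota>\<^bsub>nat_cat\<^esub> j) = \<iota>\<^bsub>underlying V Ind\<^esub> (FO ?D j)" for j
      using vf_id[OF E_vfunctor o] by (simp add: nc FO FA underlying_def it_0 E_VFO)
    fix i j k f g assume "f \<in> hom nat_cat i j" "g \<in> hom nat_cat j k"
    then have fg: "f = (i, j)" "g = (j, k)" "i \<le> j" "j \<le> k" by (auto simp: nh)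
    show "FA ?D (g \<cdot>\<^bsub>nat_cat\<^esub> f) = FA ?D g \<cdot>\<^bsub>underlying V Ind\<^esub> FA ?D f"
      using vf_cc[OF vcatC Ind_vcategory E_vfunctor o o o it_le[OF x fg(4)] it_le[OF x fg(3)]] it_trans[OF x fg(3,4)] fg(3,4)
      by (simp add: fg(1,2) nc FA underlying_cmp E_VFO)
  qed
  moreover have "is_cocone nat_cat (underlying V Ind) ?D (X x) (\<lambda>n. (K (Om n x), kappa n x, X x))"
    unfolding is_cocone_def
  proof (intro conjI ballI)
    show "X x \<in> Obj (underlying V Ind)" using XI by (simp add: underlying_def Ind_simps)
    show "(K (Om n x), kappa n x, X x) \<in> hom (underlying V Ind) (FO ?D n) (X x)" for n
      using KI XI kappa_pt[OF x] by (simp add: FO hom_def[of "underlying V Ind"]) (simp add: underlying_def Ind_simps)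
    fix f assume "f \<in> Arr nat_cat"
    then obtain m n where f: "f = (m, n)" "m \<le> n" by (auto simp: nc)
    show "(K (Om (Cod nat_cat f) x), kappa (Cod nat_cat f) x, X x) \<cdot>\<^bsub>underlying V Ind\<^esub> FA ?D f
      = (K (Om (Dom nat_cat f) x), kappa (Dom nat_cat f) x, X x)"
      using ce[OF f(2)] by (simp add: f(1) nc FA[OF f(2)] underlying_cmp)
  qed
  moreover have "is_limit (op_cat nat_cat) V
        \<lparr>FO = (\<lambda>j. VHom Ind (FO ?D j) Z), FA = (\<lambda>f. pre_comp V Ind Z (FA ?D f))\<rparr>
        (VHom Ind (X x) Z) (\<lambda>j. pre_comp V Ind Z (K (Om j x), kappa j x, X x))"
    if "Z \<in> VObj Ind" for Z
  proof -
    have Z: "ind Z" using that by (simp add: Ind_simps)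
    note IC = Ind_vcategory
    have io: "Z \<in> VObj Ind" "X x \<in> VObj Ind" "K (Om n x) \<in> VObj Ind" for n using Z XI KI by (auto simp: Ind_simps)
    note kp = kappa_pt[OF x, folded Ind_simps(2)] and ep = e[folded Ind_simps(2)]
    let ?k = "\<lambda>n. pre_comp V Ind Z (K (Om n x), kappa n x, X x)"
    let ?a = "\<lambda>m n. pre_comp V Ind Z (K (Om m x), ?e m n, K (Om n x))"
    let ?pr = "\<lambda>n. proj (K (Om n x)) Z undefined"
    have kh: "?k n \<in> hom V (ihom (X x) Z) (ihom (K (Om n x)) Z)" for n
      using pre_comp_hom[OF IC io(3,2,1) kp] by (simp add: Ind_simps)
    have ah: "?a m n \<in> hom V (ihom (K (Om n x)) Z) (ihom (K (Om m x)) Z)" if "m \<le> n" for m n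
      using pre_comp_hom[OF IC io(3,3,1) ep[OF that]] by (simp add: Ind_simps)
    have kpt: "?k n \<cdot> u = cc Ind (K (Om n x)) (X x) Z u (kappa n x)" if "u \<in> pt (ihom (X x) Z)" for n u
      using pre_comp_pt[OF IC io(3,2,1) kp] that by (simp add: Ind_simps)
    have apt: "?a m n \<cdot> u = cc Ind (K (Om m x)) (K (Om n x)) Z u (?e m n)"
      if "m \<le> n" "u \<in> pt (ihom (K (Om n x)) Z)" for m n u
      using pre_comp_pt[OF IC io(3,3,1) ep[OF that(1)]] that by (simp add: Ind_simps)
    have prk: "?pr n \<cdot> ?k n = proj (X x) Z (N n)" for n
      by (rule pt_ext[OF cmp_hom[OF kh K_proj_hom[OF o Z]] X_proj_hom[OF x Z]])
         (simp add: cmp_assoc[OF _ kh K_proj_hom[OF o Z]] kpt proj_cc_kappa[OF x Z])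
    have aik: "?a m n \<cdot> ?k n = ?k m" if mn: "m \<le> n" for m n
    proof (rule pt_ext[OF cmp_hom[OF kh ah[OF mn]] kh])
      fix u assume u: "u \<in> pt (ihom (X x) Z)"
      note ku = Ind_cc_pt[OF KI XI Z u kappa_pt[OF x]]
      show "(?a m n \<cdot> ?k n) \<cdot> u = ?k m \<cdot> u"
        using cmp_assoc[OF u kh ah[OF mn]] kpt[OF u] apt[OF mn ku]
          cc_assoc[OF IC io(3,3,2,1) _ kp ep[OF mn], of u] u ce[OF mn] by (simp add: Ind_simps)
    qed
    show ?thesis
      unfolding is_limit_def
    proof (intro conjI allI impI)
      show "is_cone (op_cat nat_cat) V \<lparr>FO = (\<lambda>j. VHom Ind (FO ?D j) Z), FA = (\<lambda>f. pre_comp V Ind Z (FA ?D f))\<rparr> (VHom Ind (X x) Z) ?k"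
        unfolding is_cone_def using ind_hom_obj[OF XI Z] kh aik
        by (auto simp: op_cat_def nc FO FA Ind_simps)
      fix T q assume "is_cone (op_cat nat_cat) V \<lparr>FO = (\<lambda>j. VHom Ind (FO ?D j) Z), FA = (\<lambda>f. pre_comp V Ind Z (FA ?D f))\<rparr> T q"
      then have T: "T \<in> Obj V" and q: "\<And>n. q n \<in> hom V T (ihom (K (Om n x)) Z)"
        and qc: "\<And>m n. m \<le> n \<Longrightarrow> ?a m n \<cdot> q n = q m"
        unfolding is_cone_def using FA by (auto simp: op_cat_def nc FO Ind_simps)
      let ?p = "\<lambda>n. ?pr n \<cdot> q n"
      have "\<exists>!h. h \<in> hom V T (ihom (X x) Z) \<and> (\<forall>n. proj (X x) Z (N n) \<cdot> h = ?p n)"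
      proof (rule X_hom_ex[OF x Z T])
        show "?p n \<in> hom V T (icol (Om n x) Z)" for n using cmp_hom[OF q K_proj_hom[OF o Z]] .
        fix n t assume t: "t \<in> pt T"
        have le: "n \<le> Suc n" by simp
        have qt: "q m \<cdot> t \<in> pt (ihom (K (Om m x)) Z)" for m using cmp_pt[OF q t] .
        have "q n \<cdot> t = cc Ind (K (Om n x)) (K (Om (Suc n) x)) Z (q (Suc n) \<cdot> t) (VFH E (Om n x) (Om (Suc n) x) \<cdot> \<theta> (Om n x))"
          using qc[OF le] cmp_assoc[OF t q ah[OF le]] apt[OF le qt] it_1[OF o, of n] by simp
        then have st: "?pr n \<cdot> (q n \<cdot> t) = act (Om n x) (Om (Suc n) x) Z (?pr (Suc n) \<cdot> (q (Suc n) \<cdot> t)) (\<theta> (Om n x))"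
          using cc_E[OF o[of n] o[of "Suc n"] Z _ qt, of "\<theta> (Om n x)"] theta_pt[OF o, of n] by simp
        have as: "?p m \<cdot> t = ?pr m \<cdot> (q m \<cdot> t)" for m
          by (rule cmp_assoc[OF t q K_proj_hom[OF o Z]])
        show "act (Om n x) (VFO \<Omega> (Om n x)) Z (?p (Suc n) \<cdot> t) (\<theta> (Om n x)) = ?p n \<cdot> t"
          unfolding as st by simp
      qed
      \<comment> \<open>Composition with \<open>?pr n\<close> loses nothing by
        \<open>K_hom_ext\<close>, so factoring the given cone and factoring its image in the objects
        \<open>icol\<close> are the same condition on \<open>h\<close>.\<close>
      moreover have "(\<forall>n. ?k n \<cdot> h = q n) \<longleftrightarrow> (\<forall>n. proj (X x) Z (N n) \<cdot> h = ?p n)"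
        if h: "h \<in> hom V T (ihom (X x) Z)" for h
      proof -
        have "?k n \<cdot> h = q n \<longleftrightarrow> proj (X x) Z (N n) \<cdot> h = ?p n" for n
          using K_hom_ext[OF o Z cmp_hom[OF h kh] q] cmp_assoc[OF h kh K_proj_hom[OF o Z]] prk[of n] by metis
        then show ?thesis by simp
      qed
      ultimately show "\<exists>!h. h \<in> hom V T (VHom Ind (X x) Z) \<and> (\<forall>j \<in> Obj (op_cat nat_cat). ?k j \<cdot> h = q j)"
        by (simp add: op_cat_def nc Ind_simps cong: conj_cong)
    qed
  qed
  ultimately show ?thesis unfolding is_conical_colimit_def by blast
qed

lemma Omega_inf_seq_colimit: "is_seq_colimit_functor TYPE('u) V C \<Omega> \<theta> G"
  unfolding is_seq_colimit_functor_def G_VFO using kappa_vnat Omega_inf_conical_colimit by blast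

section \<open>Arrows between the formal colimits\<close>

lemma G_theta:
  assumes x: "x \<in> VObj C"
  shows "VFH G x (VFO \<Omega> x) \<cdot> \<theta> x \<in> pt (ihom (X x) (X (VFO \<Omega> x)))"
    and "proj (X x) (X (VFO \<Omega> x)) (N n) \<cdot> (VFH G x (VFO \<Omega> x) \<cdot> \<theta> x) = coproj (Om n x) (X (VFO \<Omega> x)) (N n) \<cdot> \<theta> (Om n x)"
  using G_pt[OF x Omega_obj[OF x] theta_pt[OF x]] pw_theta[OF x] by auto

text \<open>Both composites with the shift have as component \<open>n\<close> the class of a
  \<open>\<theta>\<close> at stage \<open>n + 1\<close>. That \<open>\<theta>\<close> is the
  transition from stage \<open>n\<close>, so the class is that of the identity at stage
  \<open>n\<close>.\<close>

lemma G_theta_viso: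
  assumes x: "x \<in> VObj C"
  shows "\<exists>v. viso Ind (X x) (X (VFO \<Omega> x)) (VFH G x (VFO \<Omega> x) \<cdot> \<theta> x) v"
proof -
  let ?y = "VFO \<Omega> x" and ?t = "VFH G x (VFO \<Omega> x) \<cdot> \<theta> x"
  note y = Omega_obj[OF x] and o = Om_obj[OF x] and s = Om_shift[of _ x]
  have oy: "Om n ?y = Om (Suc n) x" for n by (simp add: s)
  \<comment> \<open>Stage \<open>n\<close> of the sequence of \<open>\<Omega> x\<close> is stage
    \<open>n + 1\<close> of the sequence of \<open>x\<close>; the shift is therefore given by
    identities placed one stage later.\<close>
  let ?p = "\<lambda>n. coproj (Om (Suc n) x) (X x) (N (Suc n)) \<cdot> VId C (Om (Suc n) x)"
  have p: "?p n \<in> pt (icol (Om n ?y) (X x))" for n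
    unfolding oy by (rule X_in_pt[OF o x vid_pt[OF vcatC o]])
  have "\<exists>!v. v \<in> pt (ihom (X ?y) (X x)) \<and> (\<forall>n. proj (X ?y) (X x) (N n) \<cdot> v = ?p n)"
  proof (rule X_hom_ex[OF y X_ind[OF x] unit_obj p])
    fix n t assume t: "t \<in> pt \<one>"
    let ?m = "Om (Suc n) x"
    have "act ?m (VFO \<Omega> ?m) (X x) (?p (Suc n)) (\<theta> ?m) = ?p n"
      using X_act_in[OF o[of "Suc n"] o[of "Suc (Suc n)"] x vid_pt[OF vcatC o], of "\<theta> ?m"]
        cc_idl[OF vcatC o o, of "\<theta> ?m" "Suc n" "Suc (Suc n)"] theta_pt[OF o, of "Suc n"]
        X_in_theta[OF o x vid_pt[OF vcatC o], of "Suc n"] cc_idr[OF vcatC o o, of "\<theta> ?m" "Suc n" "Suc (Suc n)"]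
      by simp
    moreover have pS: "?p (Suc n) \<in> pt (icol (VFO \<Omega> ?m) (X x))" using p[of "Suc n"] by (simp add: oy)
    moreover have om: "?m \<in> VObj C" "VFO \<Omega> ?m \<in> VObj C" using o[of "Suc n"] Omega_obj by auto
    moreover note th = theta_pt[OF om(1)]
    ultimately have e: "ind_col_map V C (?m, \<theta> ?m, VFO \<Omega> ?m) (X x) \<cdot> ?p (Suc n) = ?p n"
      using ind_col_map_pt[OF om X_ind[OF x] th pS] by simp
    \<comment> \<open>\<open>X_hom_ex\<close> tests at all points \<open>t\<close> of
      \<open>\<one>\<close>, that is at all endomorphisms of the unit. The arrow form of the action
      lets \<open>t\<close> be split off by associativity.\<close>
    have "act ?m (VFO \<Omega> ?m) (X x) (?p (Suc n) \<cdot> t) (\<theta> ?m)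
        = ind_col_map V C (?m, \<theta> ?m, VFO \<Omega> ?m) (X x) \<cdot> (?p (Suc n) \<cdot> t)"
      by (rule ind_col_map_pt[OF om X_ind[OF x] th cmp_pt[OF pS t], symmetric])
    also have "\<dots> = (ind_col_map V C (?m, \<theta> ?m, VFO \<Omega> ?m) (X x) \<cdot> ?p (Suc n)) \<cdot> t"
      by (rule cmp_assoc[OF t pS ind_col_map_hom[OF om X_ind[OF x] th], symmetric])
    finally have "act ?m (VFO \<Omega> ?m) (X x) (?p (Suc n) \<cdot> t) (\<theta> ?m) = ?p n \<cdot> t" unfolding e .
    then show "act (Om n ?y) (VFO \<Omega> (Om n ?y)) (X x) (?p (Suc n) \<cdot> t) (\<theta> (Om n ?y)) = ?p n \<cdot> t"
      unfolding oy by simp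
  qed
  then obtain v where v: "v \<in> pt (ihom (X ?y) (X x))" "\<And>n. proj (X ?y) (X x) (N n) \<cdot> v = ?p n" by blast
  note t = G_theta[OF x]
  have th: "\<theta> (Om n x) \<in> cpt C (Om n x) (Om n ?y)" for n using theta_pt[OF o] by (simp add: s)
  have "cc Ind (X x) (X ?y) (X x) v ?t = VId Ind (X x)"
    unfolding Ind_simps
  proof (rule X_hom_ext[OF x X_ind[OF x] Ind_cc_pt[OF X_ind[OF x] X_ind[OF y] X_ind[OF x] v(1) t(1)] X_id(1)[OF x]])
    fix n
    have "proj (X x) (X x) (N n) \<cdot> cc Ind (X x) (X ?y) (X x) v ?t = act (Om n x) (Om n ?y) (X x) (?p n) (\<theta> (Om n x))"
      using X_proj_cc[OF x y X_ind[OF x] v(1) t(1) th t(2)] v(2) by simp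
    also have "\<dots> = coproj (Om n x) (X x) (N (Suc n)) \<cdot> \<theta> (Om n x)"
      using X_act_in[OF o[of n] o[of "Suc n"] x vid_pt[OF vcatC o], of "\<theta> (Om n x)"] theta_pt[OF o, of n]
        cc_idl[OF vcatC o o, of "\<theta> (Om n x)" n "Suc n"] by (simp add: s)
    also have "\<dots> = proj (X x) (X x) (N n) \<cdot> ind_id V C (X x)"
      using X_in_theta[OF o x vid_pt[OF vcatC o], of n] cc_idr[OF vcatC o o, of "\<theta> (Om n x)" n "Suc n"] theta_pt[OF o, of n]
      by (simp add: X_id(2)[OF x])
    finally show "proj (X x) (X x) (N n) \<cdot> cc Ind (X x) (X ?y) (X x) v ?t = proj (X x) (X x) (N n) \<cdot> ind_id V C (X x)" .
  qed
  moreover have "cc Ind (X ?y) (X x) (X ?y) ?t v = VId Ind (X ?y)"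
    unfolding Ind_simps
  proof (rule X_hom_ext[OF y X_ind[OF y] Ind_cc_pt[OF X_ind[OF y] X_ind[OF x] X_ind[OF y] t(1) v(1)] X_id(1)[OF y]])
    fix n
    have i: "VId C (Om (Suc n) x) \<in> cpt C (Om n ?y) (Om (Suc n) x)" unfolding oy by (rule vid_pt[OF vcatC o])
    have "proj (X ?y) (X ?y) (N n) \<cdot> cc Ind (X ?y) (X x) (X ?y) ?t v
       = act (Om n ?y) (Om (Suc n) x) (X ?y) (coproj (Om (Suc n) x) (X ?y) (N (Suc n)) \<cdot> \<theta> (Om (Suc n) x)) (VId C (Om (Suc n) x))"
      using X_proj_cc[OF y x X_ind[OF y] t(1) v(1) i] v(2) t(2)[of "Suc n"] oy by simp
    also have "\<dots> = coproj (Om n ?y) (X ?y) (N (Suc n)) \<cdot> \<theta> (Om (Suc n) x)"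
      using act_id[OF o[of "Suc n"] X_ind[OF y] X_in_pt[OF o[of "Suc n"] y th]] by (simp add: oy)
    also have "\<dots> = coproj (Om n ?y) (X ?y) (N n) \<cdot> VId C (Om n ?y)"
      using X_in_theta[OF o[of "Suc n"] y, of "VId C (Om (Suc n) x)" n] i
        cc_idr[OF vcatC o[of "Suc n"] o[of "Suc (Suc n)"], of "\<theta> (Om (Suc n) x)"] theta_pt[OF o, of "Suc n"]
        vid_pt[OF vcatC o, of "Suc n"] by (simp add: oy)
    finally show "proj (X ?y) (X ?y) (N n) \<cdot> cc Ind (X ?y) (X x) (X ?y) ?t v = proj (X ?y) (X ?y) (N n) \<cdot> ind_id V C (X ?y)"
      using X_id(2)[OF y] by simp
  qed
  ultimately have "viso Ind (X x) (X ?y) ?t v" using t(1) v(1) by (simp add: viso_def Ind_simps)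
  then show ?thesis by blast
qed

text \<open>
  Well-pointedness gives \<open>g \<mapsto> \<Omega> g\<close> as a left inverse of precomposition with \<open>\<theta> x\<close>.
\<close>

lemma act_theta_inj:
  assumes x: "x \<in> VObj C" and y: "y \<in> VObj C"
    and c: "c \<in> pt (icol (VFO \<Omega> x) (X y))" "c' \<in> pt (icol (VFO \<Omega> x) (X y))"
    and eq: "act x (VFO \<Omega> x) (X y) c (\<theta> x) = act x (VFO \<Omega> x) (X y) c' (\<theta> x)"
  shows "c = c'"
proof -
  note ox = Omega_obj[OF x] and o = Om_obj[OF y] and oo = Omega_obj[OF Om_obj[OF y]]
  \<comment> \<open>\<open>\<Omega>\<close> takes \<open>C(x, \<Omega>\<^sup>n y)\<close> to
    \<open>C(\<Omega> x, \<Omega>\<^sup>n\<^sup>+\<^sup>1 y)\<close>, hence the stage goes up by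
    one.\<close>
  let ?q = "\<lambda>n. coproj (VFO \<Omega> x) (X y) (N (Suc n)) \<cdot> VFH \<Omega> x (Om n y)"
  have Oh: "VFH \<Omega> x (Om n y) \<in> hom V (VHom C x (Om n y)) (VHom C (VFO \<Omega> x) (Om (Suc n) y))" for n
    using vf_hom[OF Omega_vfunctor x o] by simp
  have qp: "?q n \<cdot> g = coproj (VFO \<Omega> x) (X y) (N (Suc n)) \<cdot> (VFH \<Omega> x (Om n y) \<cdot> g)" if "g \<in> cpt C x (Om n y)" for n g
    using cmp_assoc[OF that Oh X_in_hom[OF ox y]] .
  have "\<exists>!h. h \<in> hom V (icol x (X y)) (icol (VFO \<Omega> x) (X y)) \<and> (\<forall>n. h \<cdot> coproj x (X y) (N n) = ?q n)"
  proof (rule X_col_ex[OF x y ind_col_obj[OF ox X_ind[OF y]]])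
    show "?q n \<in> hom V (VHom C x (Om n y)) (icol (VFO \<Omega> x) (X y))" for n
      using cmp_hom[OF Oh X_in_hom[OF ox y]] .
    fix n g assume g: "g \<in> cpt C x (Om n y)"
    note t = theta_pt[OF o, of n]
    have Og: "VFH \<Omega> x (Om n y) \<cdot> g \<in> cpt C (VFO \<Omega> x) (Om (Suc n) y)" using Omega_pt[OF x o g] by simp
    have tg: "cc C x (Om n y) (VFO \<Omega> (Om n y)) (\<theta> (Om n y)) g \<in> cpt C x (Om (Suc n) y)"
      using cc_pt[OF vcatC x o oo t g] by simp
    \<comment> \<open>Well-pointedness rewrites \<open>\<Omega> (\<theta> g)\<close> as
      \<open>\<theta> (\<Omega> g)\<close>, whose outer \<open>\<theta>\<close> is a
      transition.\<close>
    show "?q (Suc n) \<cdot> cc C x (Om n y) (VFO \<Omega> (Om n y)) (\<theta> (Om n y)) g = ?q n \<cdot> g"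
      unfolding qp[OF g] qp[OF tg]
      using vf_cc[OF vcatC vcatC Omega_vfunctor x o oo t g] theta_wp[OF o, of n] X_in_theta[OF ox y Og] by simp
  qed
  then obtain h where h: "h \<in> hom V (icol x (X y)) (icol (VFO \<Omega> x) (X y))"
    "\<And>n. h \<cdot> coproj x (X y) (N n) = ?q n" by blast
  \<comment> \<open>On the class of \<open>g\<close> this is \<open>\<Omega> (g \<theta>) = \<Omega>
    g \<cdot> \<theta> = \<theta> \<cdot> g\<close>, by well-pointedness at \<open>x\<close> and
    naturality, and the last \<open>\<theta>\<close> is again a transition.\<close>
  have l: "h \<cdot> act x (VFO \<Omega> x) (X y) d (\<theta> x) = d" if d: "d \<in> pt (icol (VFO \<Omega> x) (X y))" for d
  proof -
    obtain n g where g: "g \<in> cpt C (VFO \<Omega> x) (Om n y)" "d = coproj (VFO \<Omega> x) (X y) (N n) \<cdot> g"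
      using X_col_pt[OF ox y d] .
    note t = theta_pt[OF x] and gt = cc_pt[OF vcatC x ox o g(1) theta_pt[OF x]]
    have "h \<cdot> act x (VFO \<Omega> x) (X y) d (\<theta> x) = ?q n \<cdot> cc C x (VFO \<Omega> x) (Om n y) g (\<theta> x)"
      unfolding g(2) X_act_in[OF x ox y g(1) t] using cmp_assoc[OF gt X_in_hom[OF x y] h(1)] h(2) by simp
    also have "\<dots> = coproj (VFO \<Omega> x) (X y) (N (Suc n)) \<cdot> cc C (VFO \<Omega> x) (VFO \<Omega> (VFO \<Omega> x)) (VFO \<Omega> (Om n y)) (VFH \<Omega> (VFO \<Omega> x) (Om n y) \<cdot> g) (\<theta> (VFO \<Omega> x))"
      unfolding qp[OF gt] vf_cc[OF vcatC vcatC Omega_vfunctor x ox o g(1) t] theta_wp[OF x] ..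
    also have "\<dots> = d"
      unfolding theta_nat[OF ox o g(1), symmetric] g(2) by (rule X_in_theta[OF ox y g(1)])
    finally show ?thesis .
  qed
  have "c = h \<cdot> act x (VFO \<Omega> x) (X y) c (\<theta> x)" by (rule l[OF c(1), symmetric])
  also have "\<dots> = c'" unfolding eq by (rule l[OF c(2)])
  finally show ?thesis .
qed

text \<open>Component \<open>n\<close> is component \<open>n + 1\<close> restricted along
  \<open>\<theta>\<close>, and this restriction is injective; so agreement climbs from stage 0 to
  all stages.\<close>

lemma X_hom_ext0:
  assumes x: "x \<in> VObj C" and y: "y \<in> VObj C"
    and u: "u \<in> pt (ihom (X x) (X y))" and v: "v \<in> pt (ihom (X x) (X y))"
    and eq: "proj (X x) (X y) (N 0) \<cdot> u = proj (X x) (X y) (N 0) \<cdot> v"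
  shows "u = v"
proof (rule X_hom_ext[OF x X_ind[OF y] u v])
  fix n show "proj (X x) (X y) (N n) \<cdot> u = proj (X x) (X y) (N n) \<cdot> v"
  proof (induction n)
    case 0 show ?case by (rule eq)
  next
    case (Suc n)
    note p = X_proj_pt[OF x X_ind[OF y] _, of _ "Suc n"]
    show ?case
      by (rule act_theta_inj[OF Om_obj[OF x, of n] y])
         (use p[OF u] p[OF v] Suc X_proj_theta[OF x X_ind[OF y] u, of n] X_proj_theta[OF x X_ind[OF y] v, of n] in simp_all)
  qed
qed

text \<open>
  Every arrow between objects in the image of \<open>\<Omega>\<^sup>\<infinity>\<close> becomes an image of an arrow of \<open>C\<close> after
  composition with finitely many of the arrows \<open>\<Omega>\<^sup>\<infinity> (\<theta> y)\<close>.
\<close>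

lemma X_hom_induct:
  assumes x: "x \<in> VObj C" and y: "y \<in> VObj C" and u: "u \<in> pt (ihom (X x) (X y))"
    and base: "\<And>y f. y \<in> VObj C \<Longrightarrow> f \<in> cpt C x y \<Longrightarrow> Q y (VFH G x y \<cdot> f)"
    and step: "\<And>y u. y \<in> VObj C \<Longrightarrow> u \<in> pt (ihom (X x) (X y)) \<Longrightarrow>
       Q (VFO \<Omega> y) (cc Ind (X x) (X y) (X (VFO \<Omega> y)) (VFH G y (VFO \<Omega> y) \<cdot> \<theta> y) u) \<Longrightarrow> Q y u"
  shows "Q y u"
proof -
  \<comment> \<open>Induction on the stage \<open>n\<close> representing component 0. Composition
    with the image of \<open>\<theta> y\<close> changes the target to \<open>\<Omega> y\<close>,
    where the same \<open>g\<close> sits one stage lower because \<open>\<Omega>\<^sup>n (\<Omega>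
    y) = \<Omega>\<^sup>n\<^sup>+\<^sup>1 y\<close>; hence \<open>y\<close> and \<open>u\<close>
    must vary.\<close>
  have *: "Q y u" if "y \<in> VObj C" "u \<in> pt (ihom (X x) (X y))" "g \<in> cpt C x (Om n y)"
    "proj (X x) (X y) (N 0) \<cdot> u = coproj x (X y) (N n) \<cdot> g" for n y u g
    using that
  proof (induction n arbitrary: y u)
    case (0 y u)
    then have g: "g \<in> cpt C x y" by simp
    \<comment> \<open>At stage 0 both arrows have the class of \<open>g\<close> as component 0,
      which determines them.\<close>
    have "u = VFH G x y \<cdot> g"
      by (rule X_hom_ext0[OF x 0(1,2) G_pt(1)[OF x 0(1) g]])
         (use 0(4) G_pt(2)[OF x 0(1) g, of 0] pw_0[OF g] in simp)
    then show ?case using base[OF 0(1) g] by simp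
  next
    case (Suc n y u)
    note y = Suc.prems(1) and u = Suc.prems(2) and Oy = Omega_obj[OF Suc.prems(1)]
    have g: "g \<in> cpt C x (Om n (VFO \<Omega> y))" using Suc.prems(3) by (simp add: Om_shift)
    let ?w = "cc Ind (X x) (X y) (X (VFO \<Omega> y)) (VFH G y (VFO \<Omega> y) \<cdot> \<theta> y) u"
    have w: "?w \<in> pt (ihom (X x) (X (VFO \<Omega> y)))"
      by (rule Ind_cc_pt[OF X_ind[OF x] X_ind[OF y] X_ind[OF Oy] G_theta(1)[OF y] u])
    have th: "\<theta> (Om (Suc n) y) \<in> cpt C (Om (Suc n) y) (Om (Suc n) (VFO \<Omega> y))"
      using theta_pt[OF Om_obj[OF y], of "Suc n"] by (simp add: Om_shift)
    have "proj (X x) (X (VFO \<Omega> y)) (N 0) \<cdot> ?w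
       = act x (Om (Suc n) y) (X (VFO \<Omega> y)) (coproj (Om (Suc n) y) (X (VFO \<Omega> y)) (N (Suc n)) \<cdot> \<theta> (Om (Suc n) y)) g"
      using X_proj_cc[OF x y X_ind[OF Oy] G_theta(1)[OF y] u, of g 0 "Suc n"] Suc.prems(3,4) G_theta(2)[OF y, of "Suc n"] by simp
    also have "\<dots> = coproj x (X (VFO \<Omega> y)) (N (Suc n)) \<cdot> cc C x (Om (Suc n) y) (Om (Suc n) (VFO \<Omega> y)) (\<theta> (Om (Suc n) y)) g"
      by (rule X_act_in[OF x Om_obj[OF y] Oy th Suc.prems(3)])
    also have "\<dots> = coproj x (X (VFO \<Omega> y)) (N n) \<cdot> g"
      using X_in_theta[OF x Oy g] by (simp add: Om_shift)
    finally have "Q (VFO \<Omega> y) ?w" using Suc.IH[OF Oy w g] by blast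
    then show ?case by (rule step[OF y u])
  qed
  have "proj (X x) (X y) (N 0) \<cdot> u \<in> pt (icol x (X y))"
    using X_proj_pt[OF x X_ind[OF y] u, of 0] by simp
  then obtain n g where "g \<in> cpt C x (Om n y)" "proj (X x) (X y) (N 0) \<cdot> u = coproj x (X y) (N n) \<cdot> g"
    using X_col_pt[OF x y] by blast
  then show ?thesis using * y u by blast
qed

end

section \<open>The localisation\<close>

context concrete_base begin

lemma full_vsub_simps:
  "VObj (full_vsub C S) = S" "VHom (full_vsub C S) = VHom C" "VId (full_vsub C S) = VId C"
  "cc (full_vsub C S) = cc C" "viso (full_vsub C S) = viso C"
  by (auto simp: full_vsub_def cc_def viso_def fun_eq_iff)

lemma full_vsub_vcategory:
  assumes C: "vcategory V C" and S: "S \<subseteq> VObj C"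
  shows "vcategory V (full_vsub C S)"
proof (rule vcategoryI)
  fix x y z assume "x \<in> VObj (full_vsub C S)" "y \<in> VObj (full_vsub C S)" "z \<in> VObj (full_vsub C S)"
  then have "x \<in> VObj C" "y \<in> VObj C" "z \<in> VObj C" using S by (auto simp: full_vsub_simps)
  then show "VComp (full_vsub C S) x y z \<in> hom V (VHom (full_vsub C S) y z \<otimes> VHom (full_vsub C S) x y) (VHom (full_vsub C S) x z)"
    using vcomp_hom[OF C] by (simp add: full_vsub_def)
qed (insert S, unfold full_vsub_simps,
  (blast intro: vhom_obj[OF C] vid_pt[OF C] cc_assoc[OF C] cc_idl[OF C] cc_idr[OF C])+)

end


section \<open>The essential image and its representatives\<close>

context omega_base begin

abbreviation L :: "(('u, 'c, 'a) ind_obj, 'o, 'a) vcat" where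
  "L \<equiv> L_Omega TYPE('u) V C \<Omega> \<theta>"

lemma L_obj: "VObj L = {Y. ind Y \<and> (\<exists>x \<in> VObj C. \<exists>s t. viso Ind (X x) Y s t)}"
proof -
  have "iso_objs (underlying V Ind) (X x) Y \<longleftrightarrow> (\<exists>s t. viso Ind (X x) Y s t)" if "x \<in> VObj C" "ind Y" for x Y
  proof -
    have o: "X x \<in> VObj Ind" "Y \<in> VObj Ind" using X_ind that by (auto simp: Ind_simps)
    have "iso_objs (underlying V Ind) (X x) Y \<longleftrightarrow> (\<exists>s. iso_arr (underlying V Ind) (X x, s, Y))"
      unfolding iso_objs_def iso_arr_def inverse_arrs_def by (auto simp: underlying_def hom_def)
    then show ?thesis using iso_underlying_iff[OF o] by blast
  qed
  then show ?thesis
    unfolding L_Omega_def ess_image_def full_vsub_simps G_VFO Ind_simps by blast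
qed

lemma L_simps: "VHom L = ihom" "VId L = VId Ind" "cc L = cc Ind" "viso L = viso Ind"
  unfolding L_Omega_def ess_image_def by (simp_all add: full_vsub_simps Ind_simps)

lemma L_vcategory: "vcategory V L"
  unfolding L_Omega_def ess_image_def by (rule full_vsub_vcategory[OF Ind_vcategory]) auto

lemma X_L: "x \<in> VObj C \<Longrightarrow> X x \<in> VObj L"
  using X_ind viso_id[OF Ind_vcategory, of "X x"] by (auto simp: L_obj Ind_simps)

lemma G_L_vfunctor: "vfunctor V C L G"
proof (rule vfunctorI[OF vcatC L_vcategory]; unfold L_simps G_VFO)
  fix x y z g f assume x: "x \<in> VObj C" and y: "y \<in> VObj C"
  show "X x \<in> VObj L" by (rule X_L[OF x])
  show "VFH G x x \<cdot> VId C x = VId Ind (X x)" using vf_id[OF G_vfunctor x] by (simp add: G_VFO)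
  show "VFH G x y \<in> hom V (VHom C x y) (ihom (X x) (X y))" using G_spec[OF x y] by blast
  assume z: "z \<in> VObj C" and "g \<in> cpt C y z" "f \<in> cpt C x y"
  then show "VFH G x z \<cdot> cc C x y z g f = cc Ind (X x) (X y) (X z) (VFH G y z \<cdot> g) (VFH G x y \<cdot> f)"
    using vf_cc[OF vcatC Ind_vcategory G_vfunctor x y z] by (simp add: G_VFO)
qed

lemma inverts_iff:
  fixes D :: "('d, 'o, 'a) vcat"
  assumes F: "vfunctor V C D F"
  shows "inverts V C \<Omega> \<theta> D F \<longleftrightarrow>
    (\<forall>x \<in> VObj C. \<exists>g. viso D (VFO F x) (VFO F (VFO \<Omega> x)) (VFH F x (VFO \<Omega> x) \<cdot> \<theta> x) g)"
  unfolding inverts_def underlying_ftr_def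
  using iso_underlying_iff[OF vf_obj[OF F] vf_obj[OF F Omega_obj]] by simp

lemma G_inverts: "inverts V C \<Omega> \<theta> L G"
  unfolding inverts_iff[OF G_L_vfunctor] L_simps G_VFO using G_theta_viso by blast

text \<open>Stage 0 of the sequence returns \<open>x\<close>. Without injectivity, identities could
  not be prescribed as the chosen isomorphisms at all objects of the image.\<close>

lemma X_inj: "X x = X y \<Longrightarrow> x = y"
  by (drule arg_cong[where f = "\<lambda>Z. ind_at Z (N 0)"]) (simp add: X_simps)

text \<open>
  Taking identities at the objects \<open>\<Omega>\<^sup>\<infinity> x\<close> makes the factorisation below strict.
\<close>

lemma L_representatives:
  obtains r s t where
    "\<And>Y. Y \<in> VObj L \<Longrightarrow> r Y \<in> VObj C" "\<And>Y. Y \<in> VObj L \<Longrightarrow> viso Ind (X (r Y)) Y (s Y) (t Y)"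
    "\<And>x. x \<in> VObj C \<Longrightarrow> r (X x) = x" "\<And>x. x \<in> VObj C \<Longrightarrow> s (X x) = VId Ind (X x)"
    "\<And>x. x \<in> VObj C \<Longrightarrow> t (X x) = VId Ind (X x)"
proof -
  let ?R = "\<lambda>Y (x, s, t). x \<in> VObj C \<and> viso Ind (X x) Y s t \<and>
    (\<forall>x' \<in> VObj C. Y = X x' \<longrightarrow> x = x' \<and> s = VId Ind Y \<and> t = VId Ind Y)"
  have "\<exists>a. ?R Y a" if Y: "Y \<in> VObj L" for Y
  proof (cases "\<exists>x \<in> VObj C. Y = X x")
    case True
    then obtain x where x: "x \<in> VObj C" "Y = X x" by blast
    then have "?R Y (x, VId Ind Y, VId Ind Y)"
      using viso_id[OF Ind_vcategory, of "X x"] X_ind X_inj by (auto simp: Ind_simps)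
    then show ?thesis by blast
  next
    case False
    obtain x s t where "x \<in> VObj C" "viso Ind (X x) Y s t" using Y by (auto simp: L_obj)
    then have "?R Y (x, s, t)" using False by auto
    then show ?thesis by blast
  qed
  then have "\<forall>Y \<in> VObj L. \<exists>a. ?R Y a" by blast
  from bchoice[OF this] obtain w where w: "\<forall>Y \<in> VObj L. ?R Y (w Y)" by blast
  show ?thesis
    by (rule that[of "\<lambda>Y. fst (w Y)" "\<lambda>Y. fst (snd (w Y))" "\<lambda>Y. snd (snd (w Y))"])
       (use w X_L in \<open>force simp: split_beta\<close>)+
qed

section \<open>The factorisation of a functor inverting the point\<close>

context
  fixes D :: "('d, 'o, 'a) vcat" and F :: "('c, 'd, 'a) vfun"
  assumes D: "vcategory V D" and F: "vfunctor V C D F" and inv: "inverts V C \<Omega> \<theta> D F"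
begin

definition theta_inv :: "'c \<Rightarrow> 'a" where
  "theta_inv y = (SOME g. viso D (VFO F y) (VFO F (VFO \<Omega> y)) (VFH F y (VFO \<Omega> y) \<cdot> \<theta> y) g)"

lemma theta_inv: "y \<in> VObj C \<Longrightarrow> viso D (VFO F y) (VFO F (VFO \<Omega> y)) (VFH F y (VFO \<Omega> y) \<cdot> \<theta> y) (theta_inv y)"
  unfolding theta_inv_def using inv[unfolded inverts_iff[OF F]] by (metis someI_ex)

text \<open>The inverse of the image of \<open>it y n\<close> under \<open>F\<close>, assembled from
  inverses of single steps so that passing from \<open>n\<close> to \<open>n + 1\<close> cancels one
  factor.\<close>

primrec iter_inv :: "'c \<Rightarrow> nat \<Rightarrow> 'a" where
  "iter_inv y 0 = VId D (VFO F y)"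
| "iter_inv y (Suc n) = cc D (VFO F (VFO \<Omega> (Om n y))) (VFO F (Om n y)) (VFO F y) (iter_inv y n) (theta_inv (Om n y))"

lemma theta_inv_pt: "y \<in> VObj C \<Longrightarrow> theta_inv y \<in> cpt D (VFO F (VFO \<Omega> y)) (VFO F y)"
  using theta_inv by (auto simp: viso_def)

lemma F_obj: "y \<in> VObj C \<Longrightarrow> VFO F y \<in> VObj D" by (rule vf_obj[OF F])

lemma F_Om_obj: "y \<in> VObj C \<Longrightarrow> VFO F (Om n y) \<in> VObj D" by (rule F_obj[OF Om_obj])

lemma F_Omega_Om_obj: "y \<in> VObj C \<Longrightarrow> VFO F (VFO \<Omega> (Om n y)) \<in> VObj D" by (rule F_obj[OF Omega_obj[OF Om_obj]])

lemma iter_inv_pt: "y \<in> VObj C \<Longrightarrow> iter_inv y n \<in> cpt D (VFO F (Om n y)) (VFO F y)"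
proof (induction n)
  case 0 then show ?case using vid_pt[OF D F_obj] by simp
next
  case (Suc n)
  then show ?case
    using cc_pt[OF D F_Omega_Om_obj[OF Suc.prems] F_Om_obj[OF Suc.prems] F_obj[OF Suc.prems] _ theta_inv_pt[OF Om_obj[OF Suc.prems]]] by simp
qed

text \<open>On classes this is \<open>[g]\<^sub>n \<mapsto> F(\<theta>\<^sup>n)\<^sup>-\<^sup>1
  \<cdot> F g\<close>. The universal property of the colimit makes it an arrow of
  \<open>V\<close>.\<close>

definition lift0 :: "'c \<Rightarrow> 'c \<Rightarrow> 'a" where
  "lift0 x y = (THE h. h \<in> hom V (icol x (X y)) (VHom D (VFO F x) (VFO F y)) \<and>
    (\<forall>n. h \<cdot> coproj x (X y) (N n) = post_comp V D (VFO F x) (VFO F (Om n y), iter_inv y n, VFO F y) \<cdot> VFH F x (Om n y)))"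

lemma post_iter_inv:
  assumes x: "x \<in> VObj C" and y: "y \<in> VObj C"
  shows "post_comp V D (VFO F x) (VFO F (Om n y), iter_inv y n, VFO F y) \<cdot> VFH F x (Om n y)
      \<in> hom V (VHom C x (Om n y)) (VHom D (VFO F x) (VFO F y))"
    and "g \<in> cpt C x (Om n y) \<Longrightarrow>
      (post_comp V D (VFO F x) (VFO F (Om n y), iter_inv y n, VFO F y) \<cdot> VFH F x (Om n y)) \<cdot> g
      = cc D (VFO F x) (VFO F (Om n y)) (VFO F y) (iter_inv y n) (VFH F x (Om n y) \<cdot> g)"
proof -
  note Fh = vf_hom[OF F x Om_obj[OF y]]
  note p = post_comp_hom[OF D F_Om_obj[OF y] F_obj[OF y] F_obj[OF x] iter_inv_pt[OF y]]
  show "post_comp V D (VFO F x) (VFO F (Om n y), iter_inv y n, VFO F y) \<cdot> VFH F x (Om n y)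
      \<in> hom V (VHom C x (Om n y)) (VHom D (VFO F x) (VFO F y))"
    by (rule cmp_hom[OF Fh p])
  show "(post_comp V D (VFO F x) (VFO F (Om n y), iter_inv y n, VFO F y) \<cdot> VFH F x (Om n y)) \<cdot> g
      = cc D (VFO F x) (VFO F (Om n y)) (VFO F y) (iter_inv y n) (VFH F x (Om n y) \<cdot> g)" if g: "g \<in> cpt C x (Om n y)"
    using cmp_assoc[OF g Fh p] post_comp_pt[OF D F_Om_obj[OF y] F_obj[OF y] F_obj[OF x] iter_inv_pt[OF y] cmp_pt[OF Fh g]] by simp
qed

text \<open>Replacing \<open>g\<close> by \<open>\<theta> g\<close> adds a factor
  \<open>F \<theta>\<close> on the right of the new inverse factor, and the two cancel.\<close>

lemma lift0_spec:
  assumes x: "x \<in> VObj C" and y: "y \<in> VObj C"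
  shows "lift0 x y \<in> hom V (icol x (X y)) (VHom D (VFO F x) (VFO F y)) \<and>
    (\<forall>n. lift0 x y \<cdot> coproj x (X y) (N n) = post_comp V D (VFO F x) (VFO F (Om n y), iter_inv y n, VFO F y) \<cdot> VFH F x (Om n y))"
  unfolding lift0_def
proof (rule theI', rule X_col_ex[OF x y vhom_obj[OF D F_obj[OF x] F_obj[OF y]] post_iter_inv(1)[OF x y]])
  fix n g assume g: "g \<in> cpt C x (Om n y)"
  note o = Om_obj[OF y, of n] and t = theta_pt[OF Om_obj[OF y], of n]
  have tg: "cc C x (Om n y) (VFO \<Omega> (Om n y)) (\<theta> (Om n y)) g \<in> cpt C x (Om (Suc n) y)"
    using cc_pt[OF vcatC x o Omega_obj[OF o] t g] by simp
  note Fg = vf_pt[OF F x o g] and Ft = vf_pt[OF F o Omega_obj[OF o] t]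
  note o3 = F_obj[OF x] F_Om_obj[OF y, of n] F_Omega_Om_obj[OF y, of n] F_obj[OF y]
  have FtFg: "cc D (VFO F x) (VFO F (Om n y)) (VFO F (VFO \<Omega> (Om n y))) (VFH F (Om n y) (VFO \<Omega> (Om n y)) \<cdot> \<theta> (Om n y)) (VFH F x (Om n y) \<cdot> g)
      \<in> cpt D (VFO F x) (VFO F (VFO \<Omega> (Om n y)))"
    by (rule cc_pt[OF D o3(1-3) Ft Fg])
  show "(post_comp V D (VFO F x) (VFO F (Om (Suc n) y), iter_inv y (Suc n), VFO F y) \<cdot> VFH F x (Om (Suc n) y)) \<cdot>
      cc C x (Om n y) (VFO \<Omega> (Om n y)) (\<theta> (Om n y)) g =
    (post_comp V D (VFO F x) (VFO F (Om n y), iter_inv y n, VFO F y) \<cdot> VFH F x (Om n y)) \<cdot> g"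
    unfolding post_iter_inv(2)[OF x y g] post_iter_inv(2)[OF x y tg]
    using vf_cc[OF vcatC D F x o Omega_obj[OF o] t g]
      cc_assoc[OF D o3(1,3,2,4) iter_inv_pt[OF y] theta_inv_pt[OF o] FtFg]
      viso_cancel_left[OF D o3(2,3,1) theta_inv[OF o] Fg] by simp
qed

lemma lift0_hom: "x \<in> VObj C \<Longrightarrow> y \<in> VObj C \<Longrightarrow> lift0 x y \<in> hom V (icol x (X y)) (VHom D (VFO F x) (VFO F y))"
  using lift0_spec by blast

lemma lift0_in:
  assumes x: "x \<in> VObj C" and y: "y \<in> VObj C" and g: "g \<in> cpt C x (Om n y)"
  shows "lift0 x y \<cdot> (coproj x (X y) (N n) \<cdot> g) = cc D (VFO F x) (VFO F (Om n y)) (VFO F y) (iter_inv y n) (VFH F x (Om n y) \<cdot> g)"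
proof -
  have "lift0 x y \<cdot> coproj x (X y) (N n) = post_comp V D (VFO F x) (VFO F (Om n y), iter_inv y n, VFO F y) \<cdot> VFH F x (Om n y)"
    using lift0_spec[OF x y] by blast
  then show ?thesis
    using cmp_assoc[OF g X_in_hom[OF x y] lift0_hom[OF x y]] post_iter_inv(2)[OF x y g] by simp
qed

text \<open>Naturality of \<open>lift0\<close> in its source; on a representative it is
  functoriality of \<open>F\<close> and associativity.\<close>

lemma lift0_act:
  assumes w: "w \<in> VObj C" and x: "x \<in> VObj C" and y: "y \<in> VObj C"
    and c: "c \<in> pt (icol x (X y))" and f: "f \<in> cpt C w x"
  shows "lift0 w y \<cdot> act w x (X y) c f = cc D (VFO F w) (VFO F x) (VFO F y) (lift0 x y \<cdot> c) (VFH F w x \<cdot> f)"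
proof -
  obtain n g where g: "g \<in> cpt C x (Om n y)" "c = coproj x (X y) (N n) \<cdot> g" using X_col_pt[OF x y c] .
  note o = Om_obj[OF y, of n]
  show ?thesis
    unfolding g(2) X_act_in[OF w x y g(1) f] lift0_in[OF x y g(1)] lift0_in[OF w y cc_pt[OF vcatC w x o g(1) f]]
      vf_cc[OF vcatC D F w x o g(1) f]
    by (rule cc_assoc[OF D F_obj[OF w] F_obj[OF x] F_Om_obj[OF y] F_obj[OF y] iter_inv_pt[OF y] vf_pt[OF F x o g(1)] vf_pt[OF F w x f], symmetric])
qed

text \<open>Component 0 suffices because it determines the arrow (\<open>X_hom_ext0\<close>), and it
  already has its source at \<open>x\<close>.\<close>

definition lift :: "'c \<Rightarrow> 'c \<Rightarrow> 'a" where
  "lift x y = lift0 x y \<cdot> proj (X x) (X y) (N 0)"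

lemma proj0_hom:
  "x \<in> VObj C \<Longrightarrow> y \<in> VObj C \<Longrightarrow> proj (X x) (X y) (N 0) \<in> hom V (ihom (X x) (X y)) (icol x (X y))"
  using X_proj_hom[OF _ X_ind, of x y 0] by simp

lemma lift_hom: "x \<in> VObj C \<Longrightarrow> y \<in> VObj C \<Longrightarrow> lift x y \<in> hom V (ihom (X x) (X y)) (VHom D (VFO F x) (VFO F y))"
  unfolding lift_def by (rule cmp_hom[OF proj0_hom lift0_hom])

lemma lift_pt:
  "x \<in> VObj C \<Longrightarrow> y \<in> VObj C \<Longrightarrow> u \<in> pt (ihom (X x) (X y)) \<Longrightarrow>
    lift x y \<cdot> u = lift0 x y \<cdot> (proj (X x) (X y) (N 0) \<cdot> u)"
  unfolding lift_def by (rule cmp_assoc[OF _ proj0_hom lift0_hom])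

text \<open>Composites involve later components of \<open>u\<close>, which \<open>lift\<close> does
  not see. Restriction along \<open>\<theta>\<close> becomes precomposition with the invertible
  \<open>F \<theta>\<close>, so component \<open>n\<close> is recovered from component 0 by
  inverting \<open>n\<close> such arrows.\<close>

lemma lift0_proj:
  assumes x: "x \<in> VObj C" and y: "y \<in> VObj C" and u: "u \<in> pt (ihom (X x) (X y))"
  shows "lift0 (Om n x) y \<cdot> (proj (X x) (X y) (N n) \<cdot> u) = cc D (VFO F (Om n x)) (VFO F x) (VFO F y) (lift x y \<cdot> u) (iter_inv x n)"
proof (induction n)
  case 0 show ?case
    using cc_idr[OF D F_obj[OF x] F_obj[OF y] cmp_pt[OF lift_hom[OF x y] u]] lift_pt[OF x y u] by simp
next
  case (Suc n)
  note o = Om_obj[OF x, of n]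
  let ?c = "proj (X x) (X y) (N (Suc n)) \<cdot> u"
  have c: "?c \<in> pt (icol (VFO \<Omega> (Om n x)) (X y))" using X_proj_pt[OF x X_ind[OF y] u, of "Suc n"] by simp
  note l = cmp_pt[OF lift0_hom[OF Omega_obj[OF o] y] c]
  have "lift0 (Om n x) y \<cdot> (proj (X x) (X y) (N n) \<cdot> u)
    = cc D (VFO F (Om n x)) (VFO F (VFO \<Omega> (Om n x))) (VFO F y) (lift0 (VFO \<Omega> (Om n x)) y \<cdot> ?c) (VFH F (Om n x) (VFO \<Omega> (Om n x)) \<cdot> \<theta> (Om n x))"
    using lift0_act[OF o Omega_obj[OF o] y c theta_pt[OF o]] X_proj_theta[OF x X_ind[OF y] u, of n] by simp
  then have "lift0 (VFO \<Omega> (Om n x)) y \<cdot> ?c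
     = cc D (VFO F (VFO \<Omega> (Om n x))) (VFO F (Om n x)) (VFO F y)
        (cc D (VFO F (Om n x)) (VFO F x) (VFO F y) (lift x y \<cdot> u) (iter_inv x n)) (theta_inv (Om n x))"
    using viso_cancel_right[OF D F_Omega_Om_obj[OF x] F_Om_obj[OF x] F_obj[OF y] viso_sym[OF theta_inv[OF o]] l] Suc by simp
  then show ?case
    using cc_assoc[OF D F_Omega_Om_obj[OF x] F_Om_obj[OF x] F_obj[OF x] F_obj[OF y] cmp_pt[OF lift_hom[OF x y] u] iter_inv_pt[OF x] theta_inv_pt[OF o]]
    by simp
qed

text \<open>If component 0 of \<open>v\<close> is the class of \<open>g\<close> at stage
  \<open>n\<close>, that of the composite is component \<open>n\<close> of \<open>u\<close>
  restricted along \<open>g\<close>. By \<open>lift0_proj\<close> its image is \<open>lift u \<cdot>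
  F(\<theta>\<^sup>n)\<^sup>-\<^sup>1 \<cdot> F g\<close>, and the last two factors are the image of
  \<open>v\<close>.\<close>

lemma lift_cc:
  assumes x: "x \<in> VObj C" and y: "y \<in> VObj C" and z: "z \<in> VObj C"
    and u: "u \<in> pt (ihom (X y) (X z))" and v: "v \<in> pt (ihom (X x) (X y))"
  shows "lift x z \<cdot> cc Ind (X x) (X y) (X z) u v = cc D (VFO F x) (VFO F y) (VFO F z) (lift y z \<cdot> u) (lift x y \<cdot> v)"
proof -
  note uv = Ind_cc_pt[OF X_ind[OF x] X_ind[OF y] X_ind[OF z] u v]
  have "proj (X x) (X y) (N 0) \<cdot> v \<in> pt (icol x (X y))" by (rule cmp_pt[OF proj0_hom[OF x y] v])
  then obtain n g where g: "g \<in> cpt C x (Om n y)" "proj (X x) (X y) (N 0) \<cdot> v = coproj x (X y) (N n) \<cdot> g"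
    using X_col_pt[OF x y] by blast
  note o = Om_obj[OF y, of n]
  have "lift x z \<cdot> cc Ind (X x) (X y) (X z) u v = lift0 x z \<cdot> act x (Om n y) (X z) (proj (X y) (X z) (N n) \<cdot> u) g"
    unfolding lift_pt[OF x z uv] using X_proj_cc[OF x y X_ind[OF z] u v, of g 0 n] g by simp
  also have "\<dots> = cc D (VFO F x) (VFO F (Om n y)) (VFO F z)
      (cc D (VFO F (Om n y)) (VFO F y) (VFO F z) (lift y z \<cdot> u) (iter_inv y n)) (VFH F x (Om n y) \<cdot> g)"
    unfolding lift0_act[OF x o z X_proj_pt[OF y X_ind[OF z] u] g(1)] lift0_proj[OF y z u] ..
  also have "\<dots> = cc D (VFO F x) (VFO F y) (VFO F z) (lift y z \<cdot> u)
      (cc D (VFO F x) (VFO F (Om n y)) (VFO F y) (iter_inv y n) (VFH F x (Om n y) \<cdot> g))"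
    by (rule cc_assoc[OF D F_obj[OF x] F_Om_obj[OF y] F_obj[OF y] F_obj[OF z] cmp_pt[OF lift_hom[OF y z] u] iter_inv_pt[OF y] vf_pt[OF F x o g(1)]])
  also have "cc D (VFO F x) (VFO F (Om n y)) (VFO F y) (iter_inv y n) (VFH F x (Om n y) \<cdot> g) = lift x y \<cdot> v"
    unfolding lift_pt[OF x y v] g(2) lift0_in[OF x y g(1)] ..
  finally show ?thesis .
qed

text \<open>Component 0 of the image of \<open>f\<close> is the class of \<open>f\<close> at stage
  0, where no \<open>\<theta>\<close> has to be inverted.\<close>

lemma lift_G:
  assumes x: "x \<in> VObj C" and y: "y \<in> VObj C" and f: "f \<in> cpt C x y"
  shows "lift x y \<cdot> (VFH G x y \<cdot> f) = VFH F x y \<cdot> f"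
  using lift_pt[OF x y G_pt(1)[OF x y f]] G_pt(2)[OF x y f, of 0] pw_0[OF f] lift0_in[OF x y, of f 0] f
    cc_idl[OF D F_obj[OF x] F_obj[OF y] vf_pt[OF F x y f]] by simp

lemma lift_id: "x \<in> VObj C \<Longrightarrow> lift x x \<cdot> VId Ind (X x) = VId D (VFO F x)"
  using lift_G[of x x "VId C x"] vid_pt[OF vcatC, of x] vf_id[OF G_vfunctor, of x] vf_id[OF F, of x] by (simp add: G_VFO)

text \<open>An arrow of the essential image is conjugated into one between sequences and then
  lifted. Conjugation is functorial, and it is trivial on objects \<open>X x\<close>, so the
  factorisation holds on the nose.\<close>

lemma factorisation_exists:
  "\<exists>F'. vfunctor V L D F' \<and> vfun_eq C F (vfun_comp V F' G)"
proof -
  obtain r s t where r: "\<And>Y. Y \<in> VObj L \<Longrightarrow> r Y \<in> VObj C"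
    and st: "\<And>Y. Y \<in> VObj L \<Longrightarrow> viso Ind (X (r Y)) Y (s Y) (t Y)"
    and rX: "\<And>x. x \<in> VObj C \<Longrightarrow> r (X x) = x" "\<And>x. x \<in> VObj C \<Longrightarrow> s (X x) = VId Ind (X x)"
      "\<And>x. x \<in> VObj C \<Longrightarrow> t (X x) = VId Ind (X x)"
    using L_representatives by blast
  note I = Ind_vcategory
  have o: "X (r Y) \<in> VObj Ind" "Y \<in> VObj Ind" if "Y \<in> VObj L" for Y
    using that X_ind[OF r[OF that]] by (auto simp: L_obj Ind_simps)
  have s: "s Y \<in> cpt Ind (X (r Y)) Y" and t: "t Y \<in> cpt Ind Y (X (r Y))" if "Y \<in> VObj L" for Y
    using st[OF that] by (auto simp: viso_def)
  define k where "k Y Z u = cc Ind (X (r Y)) Y (X (r Z)) (cc Ind Y Z (X (r Z)) (t Z) u) (s Y)" for Y Z u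
  \<comment> \<open>The same conjugation as an arrow of \<open>V\<close>; \<open>k\<close> alone is
    only a function on points.\<close>
  define p where "p Y Z = pre_comp V Ind (X (r Z)) (X (r Y), s Y, Y) \<cdot> post_comp V Ind Y (Z, t Z, X (r Z))" for Y Z
  have ph: "p Y Z \<in> hom V (ihom Y Z) (ihom (X (r Y)) (X (r Z)))"
    and pk: "u \<in> pt (ihom Y Z) \<Longrightarrow> p Y Z \<cdot> u = k Y Z u"
    if Y: "Y \<in> VObj L" and Z: "Z \<in> VObj L" for Y Z u
  proof -
    note h1 = post_comp_hom[OF I o(2)[OF Z] o(1)[OF Z] o(2)[OF Y] t[OF Z]]
    note h2 = pre_comp_hom[OF I o(1)[OF Y] o(2)[OF Y] o(1)[OF Z] s[OF Y]]
    show "p Y Z \<in> hom V (ihom Y Z) (ihom (X (r Y)) (X (r Z)))"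
      using cmp_hom[OF h1 h2] by (simp add: p_def Ind_simps)
    show "p Y Z \<cdot> u = k Y Z u" if "u \<in> pt (ihom Y Z)"
    proof -
      have u: "u \<in> cpt Ind Y Z" using that by (simp add: Ind_simps)
      show ?thesis
        unfolding p_def k_def cmp_assoc[OF u h1 h2] post_comp_pt[OF I o(2)[OF Z] o(1)[OF Z] o(2)[OF Y] t[OF Z] u]
        by (rule pre_comp_pt[OF I o(1)[OF Y] o(2)[OF Y] o(1)[OF Z] s[OF Y] cc_pt[OF I o(2)[OF Y] o(2)[OF Z] o(1)[OF Z] t[OF Z] u]])
    qed
  qed
  have k_id: "k Y Y (VId Ind Y) = VId Ind (X (r Y))" if Y: "Y \<in> VObj L" for Y
    unfolding k_def cc_idr[OF I o(2)[OF Y] o(1)[OF Y] t[OF Y]] using st[OF Y] by (simp add: viso_def)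
  have k_pt: "k Y Z u \<in> pt (ihom (X (r Y)) (X (r Z)))"
    if "Y \<in> VObj L" "Z \<in> VObj L" "u \<in> pt (ihom Y Z)" for Y Z u
    using cmp_pt[OF ph that(3)] pk that by simp
  have k_cc: "k W Z (cc Ind W Y Z u v) = cc Ind (X (r W)) (X (r Y)) (X (r Z)) (k Y Z u) (k W Y v)"
    if W: "W \<in> VObj L" and Y: "Y \<in> VObj L" and Z: "Z \<in> VObj L" and u: "u \<in> cpt Ind Y Z" and v: "v \<in> cpt Ind W Y" for W Y Z u v
  proof -
    note W' = o[OF W] and Y' = o[OF Y] and Z' = o[OF Z]
    have tu: "cc Ind Y Z (X (r Z)) (t Z) u \<in> cpt Ind Y (X (r Z))" by (rule cc_pt[OF I Y'(2) Z'(2,1) t[OF Z] u])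
    have vs: "cc Ind (X (r W)) W Y v (s W) \<in> cpt Ind (X (r W)) Y" by (rule cc_pt[OF I W' Y'(2) v s[OF W]])
    have kv: "k W Y v \<in> cpt Ind (X (r W)) (X (r Y))"
      unfolding k_def by (rule cc_pt[OF I W' Y'(1) cc_pt[OF I W'(2) Y'(2,1) t[OF Y] v] s[OF W]])
    have "k W Y v = cc Ind (X (r W)) Y (X (r Y)) (t Y) (cc Ind (X (r W)) W Y v (s W))"
      unfolding k_def by (rule cc_assoc[OF I W' Y'(2,1) t[OF Y] v s[OF W]])
    \<comment> \<open>In a composite of conjugates \<open>s Y\<close> meets \<open>t Y\<close> in
      the middle, and they cancel.\<close>
    then have svs: "cc Ind (X (r W)) (X (r Y)) Y (s Y) (k W Y v) = cc Ind (X (r W)) W Y v (s W)"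
      using viso_cancel_left[OF I Y'(2,1) W'(1) viso_sym[OF st[OF Y]] vs] by simp
    have "cc Ind (X (r W)) (X (r Y)) (X (r Z)) (k Y Z u) (k W Y v)
       = cc Ind (X (r W)) Y (X (r Z)) (cc Ind Y Z (X (r Z)) (t Z) u) (cc Ind (X (r W)) W Y v (s W))"
      unfolding svs[symmetric] unfolding k_def[of Y Z u] by (rule cc_assoc[OF I W'(1) Y' Z'(1) tu s[OF Y] kv])
    also have "\<dots> = cc Ind (X (r W)) W (X (r Z)) (cc Ind W Y (X (r Z)) (cc Ind Y Z (X (r Z)) (t Z) u) v) (s W)"
      by (rule cc_assoc[OF I W' Y'(2) Z'(1) tu v s[OF W], symmetric])
    also have "\<dots> = k W Z (cc Ind W Y Z u v)"
      unfolding k_def cc_assoc[OF I W'(2) Y'(2) Z'(2,1) t[OF Z] u v] ..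
    finally show ?thesis by simp
  qed
  let ?F = "\<lparr>VFO = \<lambda>Y. VFO F (r Y), VFH = \<lambda>Y Z. lift (r Y) (r Z) \<cdot> p Y Z\<rparr>"
  have Fk: "VFH ?F Y Z \<cdot> u = lift (r Y) (r Z) \<cdot> k Y Z u"
    if "Y \<in> VObj L" "Z \<in> VObj L" "u \<in> pt (ihom Y Z)" for Y Z u
    using cmp_assoc[OF that(3) ph lift_hom[OF r r]] that pk by simp
  have "vfunctor V L D ?F"
  proof (rule vfunctorI[OF L_vcategory D], unfold L_simps)
    fix Y Z W u v assume Y: "Y \<in> VObj L"
    show "VFO ?F Y \<in> VObj D" using F_obj[OF r[OF Y]] by simp
    show "VFH ?F Y Y \<cdot> VId Ind Y = VId D (VFO ?F Y)"
      using Fk[OF Y Y, of "VId Ind Y"] vid_pt[OF I o(2)[OF Y]] k_id[OF Y] lift_id[OF r[OF Y]] by (simp add: Ind_simps)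
    assume Z: "Z \<in> VObj L"
    show "VFH ?F Y Z \<in> hom V (ihom Y Z) (VHom D (VFO ?F Y) (VFO ?F Z))"
      using cmp_hom[OF ph[OF Y Z] lift_hom[OF r[OF Y] r[OF Z]]] by simp
    assume W: "W \<in> VObj L" and u: "u \<in> pt (ihom Z W)" and v: "v \<in> pt (ihom Y Z)"
    have uv: "cc Ind Y Z W u v \<in> pt (ihom Y W)"
      using Ind_cc_pt[OF _ _ _ u v] o(2)[OF Y] o(2)[OF Z] o(2)[OF W] by (simp add: Ind_simps)
    show "VFH ?F Y W \<cdot> cc Ind Y Z W u v = cc D (VFO ?F Y) (VFO ?F Z) (VFO ?F W) (VFH ?F Z W \<cdot> u) (VFH ?F Y Z \<cdot> v)"
      unfolding Fk[OF Y W uv] Fk[OF Z W u] Fk[OF Y Z v] k_cc[OF Y Z W, unfolded Ind_simps, OF u v]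
      using lift_cc[OF r[OF Y] r[OF Z] r[OF W] k_pt[OF Z W u] k_pt[OF Y Z v]] by (simp add: Ind_simps)
  qed
  moreover have "VFH F x y = VFH ?F (X x) (X y) \<cdot> VFH G x y" if x: "x \<in> VObj C" and y: "y \<in> VObj C" for x y
  proof -
    note X = X_L[OF x] X_L[OF y] and g = conjunct1[OF G_spec[OF x y]]
    have h: "VFH ?F (X x) (X y) \<in> hom V (ihom (X x) (X y)) (VHom D (VFO F x) (VFO F y))"
      using cmp_hom[OF ph[OF X] lift_hom[OF r[OF X(1)] r[OF X(2)]]] rX x y by simp
    show ?thesis
    proof (rule pt_ext[OF vf_hom[OF F x y] cmp_hom[OF g h]])
      fix f assume f: "f \<in> cpt C x y"
      note Gf = G_pt(1)[OF x y f]
      have Gf': "VFH G x y \<cdot> f \<in> cpt Ind (X x) (X y)" using Gf by (simp add: Ind_simps)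
      \<comment> \<open>The chosen isomorphisms at \<open>X x\<close> and \<open>X y\<close> are
        identities, so nothing is conjugated.\<close>
      have "k (X x) (X y) (VFH G x y \<cdot> f) = VFH G x y \<cdot> f"
        unfolding k_def rX(1)[OF x] rX(1)[OF y] rX(2)[OF x] rX(3)[OF y]
        using cc_idl[OF I o(2)[OF X(1)] o(2)[OF X(2)] Gf'] cc_idr[OF I o(2)[OF X(1)] o(2)[OF X(2)] Gf'] by simp
      then have "VFH ?F (X x) (X y) \<cdot> (VFH G x y \<cdot> f) = VFH F x y \<cdot> f"
        using Fk[OF X Gf] lift_G[OF x y f] rX(1)[OF x] rX(1)[OF y] by simp
      then show "VFH F x y \<cdot> f = (VFH ?F (X x) (X y) \<cdot> VFH G x y) \<cdot> f"
        using cmp_assoc[OF f g h] by simp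
    qed
  qed
  ultimately have "vfunctor V L D ?F \<and> vfun_eq C F (vfun_comp V ?F G)"
    using rX(1) by (simp add: vfun_eq_def vfun_comp_def G_VFO)
  then show ?thesis by blast
qed

text \<open>The triangle forces \<open>\<phi>2 \<cdot> \<phi>1\<^sup>-\<^sup>1\<close> at each
  \<open>X x\<close>, and naturality along \<open>s Y\<close> forces the value at every other
  object. The work is in naturality, obtained for images of arrows of \<open>C\<close>, then for
  arrows between sequences, and then on all of \<open>L\<close>.\<close>

lemma factorisation_unique:
  assumes F1: "vfunctor V L D F1" and F2: "vfunctor V L D F2"
    and p1: "vnat_iso V C D F (vfun_comp V F1 G) \<phi>1" and p2: "vnat_iso V C D F (vfun_comp V F2 G) \<phi>2"
  shows "\<exists>!\<alpha>. \<alpha> \<in> extensional (VObj L) \<and> vnat_iso V L D F1 F2 \<alpha> \<and>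
    (\<forall>x \<in> VObj C. vnat_arr F1 F2 \<alpha> (VFO G x) \<cdot>\<^bsub>underlying V D\<^esub> vnat_arr F (vfun_comp V F1 G) \<phi>1 x
       = vnat_arr F (vfun_comp V F2 G) \<phi>2 x)"
proof -
  obtain r s t where r: "\<And>Y. Y \<in> VObj L \<Longrightarrow> r Y \<in> VObj C"
    and st: "\<And>Y. Y \<in> VObj L \<Longrightarrow> viso Ind (X (r Y)) Y (s Y) (t Y)"
    and rX: "\<And>x. x \<in> VObj C \<Longrightarrow> r (X x) = x" "\<And>x. x \<in> VObj C \<Longrightarrow> s (X x) = VId Ind (X x)"
      "\<And>x. x \<in> VObj C \<Longrightarrow> t (X x) = VId Ind (X x)"
    using L_representatives by blast
  note LC = L_vcategory
  let ?A = "\<lambda>Y. VFO F1 Y" and ?B = "\<lambda>Y. VFO F2 Y" and ?F1 = "\<lambda>Y Z u. VFH F1 Y Z \<cdot> u" and ?F2 = "\<lambda>Y Z u. VFH F2 Y Z \<cdot> u"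
  have A: "?A Y \<in> VObj D" and B: "?B Y \<in> VObj D" if "Y \<in> VObj L" for Y
    using vf_obj[OF F1 that] vf_obj[OF F2 that] by auto
  have AX: "?A (X x) \<in> VObj D" and BX: "?B (X x) \<in> VObj D" if "x \<in> VObj C" for x
    using A B X_L[OF that] by auto
  have H1: "?F1 Y Z u \<in> cpt D (?A Y) (?A Z)" and H2: "?F2 Y Z u \<in> cpt D (?B Y) (?B Z)"
    if "Y \<in> VObj L" "Z \<in> VObj L" "u \<in> pt (ihom Y Z)" for Y Z u
    using vf_pt[OF F1 that(1,2)] vf_pt[OF F2 that(1,2)] that by (auto simp: L_simps)
  have c1: "?F1 W Z (cc Ind W Y Z u v) = cc D (?A W) (?A Y) (?A Z) (?F1 Y Z u) (?F1 W Y v)"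
    and c2: "?F2 W Z (cc Ind W Y Z u v) = cc D (?B W) (?B Y) (?B Z) (?F2 Y Z u) (?F2 W Y v)"
    if "W \<in> VObj L" "Y \<in> VObj L" "Z \<in> VObj L" "u \<in> pt (ihom Y Z)" "v \<in> pt (ihom W Y)" for W Y Z u v
    using vf_cc[OF LC D F1 that(1-3)] vf_cc[OF LC D F2 that(1-3)] that by (auto simp: L_simps)
  note FG = vfun_comp_vfunctor[OF vcatC LC D G_L_vfunctor F1] vfun_comp_vfunctor[OF vcatC LC D G_L_vfunctor F2]
  have VFO: "VFO (vfun_comp V F1 G) x = ?A (X x)" "VFO (vfun_comp V F2 G) x = ?B (X x)" for x
    by (simp_all add: vfun_comp_def G_VFO)
  have VFH: "VFH (vfun_comp V F1 G) x y \<cdot> f = ?F1 (X x) (X y) (VFH G x y \<cdot> f)"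
      "VFH (vfun_comp V F2 G) x y \<cdot> f = ?F2 (X x) (X y) (VFH G x y \<cdot> f)"
    if "x \<in> VObj C" "y \<in> VObj C" "f \<in> cpt C x y" for x y f
    using vfun_comp_pt[OF G_L_vfunctor F1 that] vfun_comp_pt[OF G_L_vfunctor F2 that] by (simp_all add: G_VFO)
  have e1: "\<exists>g. viso D (VFO F x) (?A (X x)) (\<phi>1 x) g" and e2: "\<exists>g. viso D (VFO F x) (?B (X x)) (\<phi>2 x) g"
    if x: "x \<in> VObj C" for x
    using p1 p2 x iso_underlying_iff[OF F_obj[OF x] AX[OF x]] iso_underlying_iff[OF F_obj[OF x] BX[OF x]]
    by (auto simp: vnat_iso_def vnat_arr_def VFO)
  obtain \<psi>1 where \<psi>1: "\<And>x. x \<in> VObj C \<Longrightarrow> viso D (VFO F x) (?A (X x)) (\<phi>1 x) (\<psi>1 x)"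
    using e1 by metis
  obtain \<psi>2 where \<psi>2: "\<And>x. x \<in> VObj C \<Longrightarrow> viso D (VFO F x) (?B (X x)) (\<phi>2 x) (\<psi>2 x)"
    using e2 by metis
  have P: "\<phi>1 x \<in> cpt D (VFO F x) (?A (X x))" "\<psi>1 x \<in> cpt D (?A (X x)) (VFO F x)"
    "\<phi>2 x \<in> cpt D (VFO F x) (?B (X x))" "\<psi>2 x \<in> cpt D (?B (X x)) (VFO F x)" if "x \<in> VObj C" for x
    using \<psi>1[OF that] \<psi>2[OF that] by (auto simp: viso_def)
  have n1: "cc D (VFO F x) (VFO F y) (?A (X y)) (\<phi>1 y) (VFH F x y \<cdot> f)
      = cc D (VFO F x) (?A (X x)) (?A (X y)) (?F1 (X x) (X y) (VFH G x y \<cdot> f)) (\<phi>1 x)"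
    and n2: "cc D (VFO F x) (VFO F y) (?B (X y)) (\<phi>2 y) (VFH F x y \<cdot> f)
      = cc D (VFO F x) (?B (X x)) (?B (X y)) (?F2 (X x) (X y) (VFH G x y \<cdot> f)) (\<phi>2 x)"
    if "x \<in> VObj C" "y \<in> VObj C" "f \<in> cpt C x y" for x y f
    using p1 p2 that VFH[OF that] unfolding vnat_iso_def vnat_iff[OF vcatC D F FG(1)] vnat_iff[OF vcatC D F FG(2)] VFO
    by auto
  define a where "a x = cc D (?A (X x)) (VFO F x) (?B (X x)) (\<phi>2 x) (\<psi>1 x)" for x
  have ai: "viso D (?A (X x)) (?B (X x)) (a x) (cc D (?B (X x)) (VFO F x) (?A (X x)) (\<phi>1 x) (\<psi>2 x))" if x: "x \<in> VObj C" for x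
    unfolding a_def by (rule viso_cc[OF D AX[OF x] F_obj[OF x] BX[OF x] viso_sym[OF \<psi>1[OF x]] \<psi>2[OF x]])
  have ap: "a x \<in> cpt D (?A (X x)) (?B (X x))" if "x \<in> VObj C" for x using ai[OF that] by (simp add: viso_def)
  have a1: "cc D (VFO F x) (?A (X x)) (?B (X x)) (a x) (\<phi>1 x) = \<phi>2 x" if x: "x \<in> VObj C" for x
    unfolding a_def by (rule viso_cancel_right[OF D F_obj[OF x] AX[OF x] BX[OF x] \<psi>1[OF x] P(3)[OF x]])
  have a2: "h = a x" if x: "x \<in> VObj C" and h: "h \<in> cpt D (?A (X x)) (?B (X x))"
    and eq: "cc D (VFO F x) (?A (X x)) (?B (X x)) h (\<phi>1 x) = \<phi>2 x" for h x
    using viso_cancel_right[OF D AX[OF x] F_obj[OF x] BX[OF x] viso_sym[OF \<psi>1[OF x]] h] eq by (simp add: a_def)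
  \<comment> \<open>After precomposition with the invertible \<open>\<phi>1 x\<close>, naturality of
    \<open>\<phi>1\<close> and \<open>\<phi>2\<close> carries both sides to
    \<open>\<phi>2 y \<cdot> F f\<close>.\<close>
  have base: "cc D (?A (X x)) (?A (X y)) (?B (X y)) (a y) (?F1 (X x) (X y) (VFH G x y \<cdot> f))
      = cc D (?A (X x)) (?B (X x)) (?B (X y)) (?F2 (X x) (X y) (VFH G x y \<cdot> f)) (a x)"
    if x: "x \<in> VObj C" and y: "y \<in> VObj C" and f: "f \<in> cpt C x y" for x y f
  proof -
    note Gf = G_pt(1)[OF x y f] and Ff = vf_pt[OF F x y f]
    note f1 = H1[OF X_L[OF x] X_L[OF y] Gf] and f2 = H2[OF X_L[OF x] X_L[OF y] Gf]
    note ox = F_obj[OF x] AX[OF x] BX[OF x] and oy = F_obj[OF y] AX[OF y] BX[OF y]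
    note af = cc_pt[OF D ox(2) oy(2,3) ap[OF y] f1] and fa = cc_pt[OF D ox(2,3) oy(3) f2 ap[OF x]]
    have "cc D (VFO F x) (?A (X x)) (?B (X y)) (cc D (?A (X x)) (?A (X y)) (?B (X y)) (a y) (?F1 (X x) (X y) (VFH G x y \<cdot> f))) (\<phi>1 x)
       = cc D (VFO F x) (?A (X y)) (?B (X y)) (a y) (cc D (VFO F x) (VFO F y) (?A (X y)) (\<phi>1 y) (VFH F x y \<cdot> f))"
      using cc_assoc[OF D ox(1,2) oy(2,3) ap[OF y] f1 P(1)[OF x]] n1[OF x y f] by simp
    also have "\<dots> = cc D (VFO F x) (VFO F y) (?B (X y)) (\<phi>2 y) (VFH F x y \<cdot> f)"
      using cc_assoc[OF D ox(1) oy ap[OF y] P(1)[OF y] Ff] a1[OF y] by simp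
    also have "\<dots> = cc D (VFO F x) (?A (X x)) (?B (X y)) (cc D (?A (X x)) (?B (X x)) (?B (X y)) (?F2 (X x) (X y) (VFH G x y \<cdot> f)) (a x)) (\<phi>1 x)"
      using cc_assoc[OF D ox oy(3) f2 ap[OF x] P(1)[OF x]] a1[OF x] n2[OF x y f] by simp
    finally have "cc D (VFO F x) (?A (X x)) (?B (X y)) (cc D (?A (X x)) (?A (X y)) (?B (X y)) (a y) (?F1 (X x) (X y) (VFH G x y \<cdot> f))) (\<phi>1 x)
       = cc D (VFO F x) (?A (X x)) (?B (X y)) (cc D (?A (X x)) (?B (X x)) (?B (X y)) (?F2 (X x) (X y) (VFH G x y \<cdot> f)) (a x)) (\<phi>1 x)" .
    then show ?thesis
      using viso_cancel_right[OF D ox(2,1) oy(3) viso_sym[OF \<psi>1[OF x]] af]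
        viso_cancel_right[OF D ox(2,1) oy(3) viso_sym[OF \<psi>1[OF x]] fa] by metis
  qed
  \<comment> \<open>By \<open>X_hom_induct\<close> it remains to descend from
    \<open>\<theta> u\<close> to \<open>u\<close>. Naturality holds at the image of
    \<open>\<theta>\<close> by \<open>base\<close>, and \<open>F2\<close> sends that image to an
    isomorphism, which is cancelled on the left.\<close>
  have anat: "cc D (?A (X x)) (?A (X y)) (?B (X y)) (a y) (?F1 (X x) (X y) u)
      = cc D (?A (X x)) (?B (X x)) (?B (X y)) (?F2 (X x) (X y) u) (a x)"
    if x: "x \<in> VObj C" and y: "y \<in> VObj C" and u: "u \<in> pt (ihom (X x) (X y))" for x y u
    using x y u
  proof (rule X_hom_induct[where Q = "\<lambda>y u. cc D (?A (X x)) (?A (X y)) (?B (X y)) (a y) (?F1 (X x) (X y) u)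
      = cc D (?A (X x)) (?B (X x)) (?B (X y)) (?F2 (X x) (X y) u) (a x)"])
    fix y f assume "y \<in> VObj C" "f \<in> cpt C x y"
    then show "cc D (?A (X x)) (?A (X y)) (?B (X y)) (a y) (?F1 (X x) (X y) (VFH G x y \<cdot> f))
      = cc D (?A (X x)) (?B (X x)) (?B (X y)) (?F2 (X x) (X y) (VFH G x y \<cdot> f)) (a x)" by (rule base[OF x])
  next
    fix y u assume y: "y \<in> VObj C" and u: "u \<in> pt (ihom (X x) (X y))"
    let ?z = "VFO \<Omega> y" and ?t = "VFH G y (VFO \<Omega> y) \<cdot> \<theta> y"
    note z = Omega_obj[OF y]
    assume w: "cc D (?A (X x)) (?A (X ?z)) (?B (X ?z)) (a ?z) (?F1 (X x) (X ?z) (cc Ind (X x) (X y) (X ?z) ?t u))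
      = cc D (?A (X x)) (?B (X x)) (?B (X ?z)) (?F2 (X x) (X ?z) (cc Ind (X x) (X y) (X ?z) ?t u)) (a x)"
    note Lx = X_L[OF x] and Ly = X_L[OF y] and Lz = X_L[OF z]
    note t = G_theta(1)[OF y] and ax = ap[OF x] and ay = ap[OF y] and az = ap[OF z]
    note u1 = H1[OF Lx Ly u] and u2 = H2[OF Lx Ly u] and t1 = H1[OF Ly Lz t] and t2 = H2[OF Ly Lz t]
    obtain v where v: "viso Ind (X y) (X ?z) ?t v" using G_theta_viso[OF y] by blast
    have iv: "viso D (?B (X y)) (?B (X ?z)) (?F2 (X y) (X ?z) ?t) (?F2 (X ?z) (X y) v)"
      using vf_viso[OF LC D F2 Ly Lz] v by (simp add: L_simps)
    have "cc D (?A (X x)) (?B (X y)) (?B (X ?z)) (?F2 (X y) (X ?z) ?t) (cc D (?A (X x)) (?A (X y)) (?B (X y)) (a y) (?F1 (X x) (X y) u))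
       = cc D (?A (X x)) (?A (X y)) (?B (X ?z)) (cc D (?A (X y)) (?A (X ?z)) (?B (X ?z)) (a ?z) (?F1 (X y) (X ?z) ?t)) (?F1 (X x) (X y) u)"
      unfolding base[OF y z theta_pt[OF y]] by (rule cc_assoc[OF D A[OF Lx] A[OF Ly] B[OF Ly] B[OF Lz] t2 ay u1, symmetric])
    also have "\<dots> = cc D (?A (X x)) (?A (X ?z)) (?B (X ?z)) (a ?z) (?F1 (X x) (X ?z) (cc Ind (X x) (X y) (X ?z) ?t u))"
      unfolding c1[OF Lx Ly Lz t u] by (rule cc_assoc[OF D A[OF Lx] A[OF Ly] A[OF Lz] B[OF Lz] az t1 u1])
    also have "\<dots> = cc D (?A (X x)) (?B (X y)) (?B (X ?z)) (?F2 (X y) (X ?z) ?t) (cc D (?A (X x)) (?B (X x)) (?B (X y)) (?F2 (X x) (X y) u) (a x))"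
      unfolding w c2[OF Lx Ly Lz t u] by (rule cc_assoc[OF D A[OF Lx] B[OF Lx] B[OF Ly] B[OF Lz] t2 u2 ax])
    finally show "cc D (?A (X x)) (?A (X y)) (?B (X y)) (a y) (?F1 (X x) (X y) u)
      = cc D (?A (X x)) (?B (X x)) (?B (X y)) (?F2 (X x) (X y) u) (a x)"
      using viso_cancel_left[OF D B[OF Ly] B[OF Lz] A[OF Lx] iv cc_pt[OF D A[OF Lx] A[OF Ly] B[OF Ly] ay u1]]
        viso_cancel_left[OF D B[OF Ly] B[OF Lz] A[OF Lx] iv cc_pt[OF D A[OF Lx] B[OF Lx] B[OF Ly] u2 ax]] by metis
  qed
  have S: "s Y \<in> pt (ihom (X (r Y)) Y)" and T: "t Y \<in> pt (ihom Y (X (r Y)))" if "Y \<in> VObj L" for Y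
    using st[OF that] by (auto simp: viso_def Ind_simps)
  have i1: "viso D (?A (X (r Y))) (?A Y) (?F1 (X (r Y)) Y (s Y)) (?F1 Y (X (r Y)) (t Y))"
    and i2: "viso D (?B (X (r Y))) (?B Y) (?F2 (X (r Y)) Y (s Y)) (?F2 Y (X (r Y)) (t Y))" if Y: "Y \<in> VObj L" for Y
    using vf_viso[OF LC D F1 X_L[OF r[OF Y]] Y] vf_viso[OF LC D F2 X_L[OF r[OF Y]] Y] st[OF Y] by (auto simp: L_simps)
  \<comment> \<open>Naturality along \<open>s Y\<close> leaves no other choice, as
    \<open>b_unique\<close> shows; at \<open>X x\<close> the isomorphisms are identities and
    \<open>b\<close> reduces to \<open>a\<close>.\<close>
  define b where "b Y = cc D (?A Y) (?A (X (r Y))) (?B Y)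
     (cc D (?A (X (r Y))) (?B (X (r Y))) (?B Y) (?F2 (X (r Y)) Y (s Y)) (a (r Y))) (?F1 Y (X (r Y)) (t Y))" for Y
  have b_unique: "\<beta> Y = b Y"
    if \<beta>: "vnat V L D F1 F2 \<beta>" and \<beta>X: "\<And>x. x \<in> VObj C \<Longrightarrow> \<beta> (X x) = a x" and Y: "Y \<in> VObj L" for \<beta> Y
  proof -
    note R = X_L[OF r[OF Y]]
    note vn = \<beta>[unfolded vnat_iff[OF LC D F1 F2] L_simps]
    have bp: "\<beta> Y \<in> cpt D (?A Y) (?B Y)" using vn Y by blast
    have "cc D (?A (X (r Y))) (?A Y) (?B Y) (\<beta> Y) (?F1 (X (r Y)) Y (s Y))
       = cc D (?A (X (r Y))) (?B (X (r Y))) (?B Y) (?F2 (X (r Y)) Y (s Y)) (\<beta> (X (r Y)))"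
      using vn Y R S[OF Y] by blast
    then show ?thesis
      unfolding b_def using viso_cancel_right[OF D A[OF Y] A[OF R] B[OF Y] viso_sym[OF i1[OF Y]] bp] \<beta>X[OF r[OF Y]] by simp
  qed
  have bX: "b (X x) = a x" if x: "x \<in> VObj C" for x
  proof -
    note Lx = X_L[OF x]
    have "?F1 (X x) (X x) (VId Ind (X x)) = VId D (?A (X x))" "?F2 (X x) (X x) (VId Ind (X x)) = VId D (?B (X x))"
      using vf_id[OF F1 Lx] vf_id[OF F2 Lx] by (simp_all add: L_simps)
    then show ?thesis
      unfolding b_def rX(1)[OF x] rX(2)[OF x] rX(3)[OF x]
      using cc_idl[OF D AX[OF x] BX[OF x] ap[OF x]] cc_idr[OF D AX[OF x] BX[OF x] ap[OF x]] by simp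
  qed
  have bi: "\<exists>g. viso D (?A Y) (?B Y) (b Y) g" if Y: "Y \<in> VObj L" for Y
    unfolding b_def
    using viso_cc[OF D A[OF Y] AX[OF r[OF Y]] B[OF Y] viso_sym[OF i1[OF Y]]
        viso_cc[OF D AX[OF r[OF Y]] BX[OF r[OF Y]] B[OF Y] ai[OF r[OF Y]] i2[OF Y]]] by blast
  have bp: "b Y \<in> cpt D (?A Y) (?B Y)" if "Y \<in> VObj L" for Y using bi[OF that] by (auto simp: viso_def)
  have bs: "cc D (?A (X (r Y))) (?A Y) (?B Y) (b Y) (?F1 (X (r Y)) Y (s Y))
      = cc D (?A (X (r Y))) (?B (X (r Y))) (?B Y) (?F2 (X (r Y)) Y (s Y)) (a (r Y))" if Y: "Y \<in> VObj L" for Y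
    unfolding b_def
    by (rule viso_cancel_right[OF D AX[OF r[OF Y]] A[OF Y] B[OF Y] i1[OF Y]
          cc_pt[OF D AX[OF r[OF Y]] BX[OF r[OF Y]] B[OF Y] H2[OF X_L[OF r[OF Y]] Y S[OF Y]] ap[OF r[OF Y]]]])
  \<comment> \<open>The arrow \<open>u\<close> is conjugated to \<open>?v\<close> between sequences,
    where \<open>anat\<close> applies. The squares at \<open>s Y\<close> and \<open>s Z\<close>
    carry the result back, and the image of \<open>s Y\<close> is cancelled at the end.\<close>
  have bnat: "cc D (?A Y) (?A Z) (?B Z) (b Z) (?F1 Y Z u) = cc D (?A Y) (?B Y) (?B Z) (?F2 Y Z u) (b Y)"
    if Y: "Y \<in> VObj L" and Z: "Z \<in> VObj L" and u: "u \<in> pt (ihom Y Z)" for Y Z u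
  proof -
    let ?Y = "X (r Y)" and ?Z = "X (r Z)"
    note LY = X_L[OF r[OF Y]] and LZ = X_L[OF r[OF Z]]
    have ind': "ind Y" "ind Z" "ind ?Y" "ind ?Z" using Y Z LY LZ by (auto simp: L_obj)
    let ?us = "cc Ind ?Y Y Z u (s Y)"
    let ?v = "cc Ind ?Y Z ?Z (t Z) ?us"
    have us: "?us \<in> pt (ihom ?Y Z)" by (rule Ind_cc_pt[OF ind'(3,1,2) u S[OF Y]])
    have v: "?v \<in> pt (ihom ?Y ?Z)" by (rule Ind_cc_pt[OF ind'(3,2,4) T[OF Z] us])
    have sv: "cc Ind ?Y ?Z Z (s Z) ?v = ?us"
      using viso_cancel_left[OF Ind_vcategory _ _ _ viso_sym[OF st[OF Z]], of ?Y ?us] ind' us by (simp add: Ind_simps)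
    note u1 = H1[OF Y Z u] and u2 = H2[OF Y Z u] and v1 = H1[OF LY LZ v] and v2 = H2[OF LY LZ v]
    note s1 = H1[OF LY Y S[OF Y]] and s2 = H2[OF LY Y S[OF Y]] and z1 = H1[OF LZ Z S[OF Z]] and z2 = H2[OF LZ Z S[OF Z]]
    note aY = ap[OF r[OF Y]] and aZ = ap[OF r[OF Z]]
    have "cc D (?A ?Y) (?A Y) (?B Z) (cc D (?A Y) (?A Z) (?B Z) (b Z) (?F1 Y Z u)) (?F1 ?Y Y (s Y))
       = cc D (?A ?Y) (?A Z) (?B Z) (b Z) (?F1 ?Y Z ?us)"
      unfolding c1[OF LY Y Z u S[OF Y]] by (rule cc_assoc[OF D A[OF LY] A[OF Y] A[OF Z] B[OF Z] bp[OF Z] u1 s1])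
    also have "\<dots> = cc D (?A ?Y) (?A ?Z) (?B Z) (cc D (?A ?Z) (?A Z) (?B Z) (b Z) (?F1 ?Z Z (s Z))) (?F1 ?Y ?Z ?v)"
      using cc_assoc[OF D A[OF LY] A[OF LZ] A[OF Z] B[OF Z] bp[OF Z] z1 v1] c1[OF LY LZ Z S[OF Z] v] sv by simp
    also have "\<dots> = cc D (?A ?Y) (?B ?Z) (?B Z) (?F2 ?Z Z (s Z)) (cc D (?A ?Y) (?B ?Y) (?B ?Z) (?F2 ?Y ?Z ?v) (a (r Y)))"
      unfolding bs[OF Z] anat[OF r[OF Y] r[OF Z] v, symmetric]
      by (rule cc_assoc[OF D A[OF LY] A[OF LZ] B[OF LZ] B[OF Z] z2 aZ v1])
    also have "\<dots> = cc D (?A ?Y) (?B ?Y) (?B Z) (?F2 ?Y Z ?us) (a (r Y))"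
      using cc_assoc[OF D A[OF LY] B[OF LY] B[OF LZ] B[OF Z] z2 v2 aY] c2[OF LY LZ Z S[OF Z] v] sv by simp
    also have "\<dots> = cc D (?A ?Y) (?B Y) (?B Z) (?F2 Y Z u) (cc D (?A ?Y) (?A Y) (?B Y) (b Y) (?F1 ?Y Y (s Y)))"
      unfolding bs[OF Y] c2[OF LY Y Z u S[OF Y]] by (rule cc_assoc[OF D A[OF LY] B[OF LY] B[OF Y] B[OF Z] u2 s2 aY])
    also have "\<dots> = cc D (?A ?Y) (?A Y) (?B Z) (cc D (?A Y) (?B Y) (?B Z) (?F2 Y Z u) (b Y)) (?F1 ?Y Y (s Y))"
      by (rule cc_assoc[OF D A[OF LY] A[OF Y] B[OF Y] B[OF Z] u2 bp[OF Y] s1, symmetric])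
    finally show ?thesis
      using viso_cancel_right[OF D A[OF Y] A[OF LY] B[OF Z] viso_sym[OF i1[OF Y]] cc_pt[OF D A[OF Y] A[OF Z] B[OF Z] bp[OF Z] u1]]
        viso_cancel_right[OF D A[OF Y] A[OF LY] B[OF Z] viso_sym[OF i1[OF Y]] cc_pt[OF D A[OF Y] B[OF Y] B[OF Z] u2 bp[OF Y]]]
      by metis
  qed
  have tri: "vnat_arr F1 F2 \<alpha> (VFO G x) \<cdot>\<^bsub>underlying V D\<^esub> vnat_arr F (vfun_comp V F1 G) \<phi>1 x
       = vnat_arr F (vfun_comp V F2 G) \<phi>2 x \<longleftrightarrow> cc D (VFO F x) (?A (X x)) (?B (X x)) (\<alpha> (X x)) (\<phi>1 x) = \<phi>2 x" for \<alpha> x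
    unfolding vnat_arr_def VFO G_VFO underlying_cmp by simp
  \<comment> \<open>Naturality says nothing about values outside \<open>VObj L\<close>; restricting
    fixes them, so that uniqueness is an equality of functions.\<close>
  let ?b = "restrict b (VObj L)"
  show ?thesis
    unfolding tri
  proof (rule ex1I[where a = ?b], intro conjI ballI)
    show "?b \<in> extensional (VObj L)" by simp
    show "vnat_iso V L D F1 F2 ?b"
      unfolding vnat_iso_def vnat_iff[OF LC D F1 F2] L_simps vnat_arr_def
      using bp bnat bi iso_underlying_iff[OF A B] by simp
    show "cc D (VFO F x) (?A (X x)) (?B (X x)) (?b (X x)) (\<phi>1 x) = \<phi>2 x" if x: "x \<in> VObj C" for x
      using a1[OF x] bX[OF x] X_L[OF x] by simp
  next
    fix \<beta> assume \<beta>: "\<beta> \<in> extensional (VObj L) \<and> vnat_iso V L D F1 F2 \<beta> \<and>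
      (\<forall>x \<in> VObj C. cc D (VFO F x) (?A (X x)) (?B (X x)) (\<beta> (X x)) (\<phi>1 x) = \<phi>2 x)"
    then have vn: "vnat V L D F1 F2 \<beta>" by (simp add: vnat_iso_def)
    have \<beta>X: "\<beta> (X x) = a x" if x: "x \<in> VObj C" for x
    proof (rule a2[OF x])
      show "\<beta> (X x) \<in> cpt D (?A (X x)) (?B (X x))"
        using vn X_L[OF x] unfolding vnat_iff[OF LC D F1 F2] by blast
      show "cc D (VFO F x) (?A (X x)) (?B (X x)) (\<beta> (X x)) (\<phi>1 x) = \<phi>2 x" using \<beta> x by blast
    qed
    show "\<beta> = ?b"
    proof (rule extensionalityI[of _ "VObj L"])
      show "\<beta> \<in> extensional (VObj L)" using \<beta> by blast
      show "?b \<in> extensional (VObj L)" by simp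
      show "\<beta> Y = ?b Y" if "Y \<in> VObj L" for Y using b_unique[OF vn \<beta>X that] that by simp
    qed
  qed
qed

end

lemma Omega_inf_localisation: "is_localisation TYPE('d) V C \<Omega> \<theta> L G"
  unfolding is_localisation_def
proof (intro conjI allI impI; (elim conjE)?)
  fix D :: "('d, 'o, 'a) vcat" and F
  assume D: "vcategory V D" and F: "vfunctor V C D F" and inv: "inverts V C \<Omega> \<theta> D F"
  show "\<exists>F'. vfunctor V L D F' \<and> vfun_eq C F (vfun_comp V F' G)"
    by (rule factorisation_exists[OF D F inv])
  fix F1 F2 \<phi>1 \<phi>2
  assume "vfunctor V L D F1" "vfunctor V L D F2"
    "vnat_iso V C D F (vfun_comp V F1 G) \<phi>1" "vnat_iso V C D F (vfun_comp V F2 G) \<phi>2"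
  then show "\<exists>!\<alpha>. \<alpha> \<in> extensional (VObj L) \<and> vnat_iso V L D F1 F2 \<alpha> \<and>
    (\<forall>x \<in> VObj C. vnat_arr F1 F2 \<alpha> (VFO G x) \<cdot>\<^bsub>underlying V D\<^esub> vnat_arr F (vfun_comp V F1 G) \<phi>1 x
       = vnat_arr F (vfun_comp V F2 G) \<phi>2 x)"
    by (rule factorisation_unique[OF D F inv])
qed (rule L_vcategory G_L_vfunctor G_inverts)+

end

theorem theorem4:
  fixes V :: "('o, 'a) smc" and C :: "('c, 'o, 'a) vcat"
    and \<Omega> :: "('c, 'c, 'a) vfun" and \<theta> :: "'c \<Rightarrow> 'a"
  assumes "(UNIV :: nat set) \<prec> (UNIV :: 'u set)"
    and "closed_symmetric_monoidal_category V"
    and "bicomplete TYPE('u) V"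
    and "concrete V"
    and "compact_unit TYPE('u) V"
    and "created_in_set TYPE('u) V"
    and "vcategory V C"
    and "vcocomplete TYPE('u) V C"
    and "well_pointed V C \<Omega> \<theta>"
  shows "is_seq_colimit_functor TYPE('u) V C \<Omega> \<theta> (Omega_inf TYPE('u) V C \<Omega> \<theta>)
     \<and> is_localisation TYPE('d) V C \<Omega> \<theta>
         (L_Omega TYPE('u) V C \<Omega> \<theta>) (Omega_inf TYPE('u) V C \<Omega> \<theta>)"
proof -
  interpret closed_symmetric_monoidal_category V by (rule assms(2))
  interpret omega_base V C "TYPE('u)" \<Omega> \<theta>
    by unfold_locales (rule assms)+
  show ?thesis using Omega_inf_seq_colimit Omega_inf_localisation by blast
qed

end
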